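(* Let $\vec s=(s_1,\dots,s_k)\subset[n]$ be an activation sequence of length $k$. Then for every $\ell\in[n]$, $$\mu_\ell(\tau_n^{\vec s})=\tau_n^{\mu_\ell(\vec s)},$$ where $\mu_\ell(\vec s)$ is the activation sequence $$\mu_{\ell}(\vec s)=\begin{cases}(s_1,\dots,s_k,\ell) & \text{if } \ell\notin\vec s,\\ (s_1,\dots,s_{k-1}) & \text{if } \ell=s_k,\\ (s_1,\dots,s_{j-1},s_{j+1},s_{j},s_{j+2},\dots,s_k) & \text{if } \ell=s_j \text{ with } 1\le j\le k-1.\end{cases}$$
   Context: Setting. $[n]=\{1,\dots,n\}$; $R=\mathbb{Z}[A_1,\dots,A_n]$ with $A_1,\dots,A_n$ independent indeterminates; $\mathcal{F}$ is the field of rational functions in $X_1,\dots,X_n$ over $\mathrm{Frac}(R)$. Empty products equal $1$. Seeds. A seed of rank $n$ in $\mathcal{F}$ is a pair $(\mathbf{X},\mathbf{F})$ with $\mathbf{X}=\{X_1,\dots,X_n\}$ a transcendence basis of $\mathcal{F}$ over $\mathrm{Frac}(R)$ generating $\mathcal F$ (the cluster) and $\mathbf{F}=\{F_1,\dots,F_n\}\subset R[X_1,\dots,X_n]$ (exchange polynomials, $F_i$ attached to $X_i$) such that each $F_i$ is irreducible in $R[X_1,\dots,X_n]$, is not divisible by any $X_j$, and does not involve $X_i$. Equality of seeds: a seed is regarded as an unordered collection of pairs (cluster variable, exchange polynomial), the indexing by $[n]$ being only for convenience, and seeds whose corresponding cluster variables and exchange polynomials differ only by units of $R$ are identified (normalization).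 For a seed, $\hat F_i$ denotes the unique Laurent polynomial $\hat F_i=\big(\prod_{j\ne i}X_j^{a_j}\big)F_i$ with integers $a_j\le 0$ such that for every $j\neq i$ the Laurent polynomial $\hat F_i|_{X_j\leftarrow F_j/X}$ lies in $R[X_1^{\pm1},\dots,X_{j-1}^{\pm1},X^{\pm1},X_{j+1}^{\pm1},\dots,X_n^{\pm1}]$ and is not divisible by $F_j$ in that ring. Mutation. The mutation $\mu_i$ of $(\mathbf{X},\mathbf{F})$ at $i$ is the seed $(\mathbf{X}',\mathbf{F}')$ with $X'_j=X_j$ for $j\ne i$, $X'_i=\hat F_i/X_i$, and: $F'_j=F_j$ if $F_j$ does not depend on $X_i$; otherwise put $G_j=F_j|_{X_i\leftarrow (\hat F_i|_{X_j\leftarrow 0})/X'_i}$, let $H_j$ be $G_j$ with all common factors in $R[X_1,\dots,\widehat{X_i},\dots,\widehat{X_j},\dots,X_n]$ (hats mean omission) with $\hat F_i|_{X_j\leftarrow 0}$ divided out (until none remain), and $F'_j=MH_j$, where $M$ is the Laurent monomial in the new cluster variables other than $X_j'$ making $F'_j$ a polynomial not divisible by any cluster variable. This defines $F'_j$ up to a unit of $R$. The seed $\tau_n$ has cluster variables $X_1,\dots,X_n$ and exchange polynomials $F_i=A_i+\prod_{j\ne i}X_j$, $i\in[n]$. Activation sequences. An activation sequence $\vec s=(s_1,\dots,s_k)\subset[n]$ of length $k$ is an ordered subset of $[n]$ (distinct elements). The seed generated by $\vec s$ is $\tau_n^{\vec s}=\mu_{s_k}\mu_{s_{k-1}}\cdots\mu_{s_1}(\tau_n)$;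 its cluster variables and exchange polynomials keep the index $\ell\in[n]$ under these mutations, and $\mu_\ell(\tau_n^{\vec s})$ means mutation at the cluster variable of $\tau_n^{\vec s}$ with index $\ell$. *)

theory Defs
  imports
    "HOL-Library.Poly_Mapping"
    "HOL-Computational_Algebra.Computational_Algebra"
begin

text \<open>
  A finite linearly ordered type \<open>'n\<close> plays the role of \<open>[n]\<close>, with \<open>n = CARD('n)\<close>.  The order
  itself is never used in a definition; it is only what the instance of class \<open>idom\<close> for
  polynomial rings over \<^theory>\<open>HOL-Library.Poly_Mapping\<close> asks for, and that instance is needed to
  form fraction fields.

  \<open>'n coeffs\<close> is the ring \<open>R = \<int>[A\<^sub>1,\<dots>,A\<^sub>n]\<close>, \<open>'n mpol\<close> is \<open>R[X\<^sub>1,\<dots>,X\<^sub>n]\<close>, \<open>'n laur\<close> is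
  \<open>R[X\<^sub>1\<^sup>\<plusminus>\<^sup>1,\<dots>,X\<^sub>n\<^sup>\<plusminus>\<^sup>1]\<close> (integer exponent vectors), \<open>'n frpol\<close> is \<open>Frac(R)[X\<^sub>1,\<dots>,X\<^sub>n]\<close> and
  \<open>'n ambient\<close> is the field \<open>\<F>\<close> of rational functions in \<open>X\<^sub>1,\<dots>,X\<^sub>n\<close> over \<open>Frac(R)\<close>.
\<close>

type_synonym 'n coeffs = "('n \<Rightarrow>\<^sub>0 nat) \<Rightarrow>\<^sub>0 int"
type_synonym 'n mpol = "('n \<Rightarrow>\<^sub>0 nat) \<Rightarrow>\<^sub>0 'n coeffs"
type_synonym 'n laur = "('n \<Rightarrow>\<^sub>0 int) \<Rightarrow>\<^sub>0 'n coeffs"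
type_synonym 'n frpol = "('n \<Rightarrow>\<^sub>0 nat) \<Rightarrow>\<^sub>0 'n coeffs fract"
type_synonym 'n ambient = "'n frpol fract"


subsection \<open>Variables, constants, evaluation\<close>

definition indetA :: "'n \<Rightarrow> 'n coeffs" where
  "indetA i = Poly_Mapping.single (Poly_Mapping.single i 1) 1"

definition mpol_const :: "'n coeffs \<Rightarrow> 'n mpol" where
  "mpol_const c = Poly_Mapping.single 0 c"

definition mpol_var :: "'n \<Rightarrow> 'n mpol" where
  "mpol_var i = Poly_Mapping.single (Poly_Mapping.single i 1) 1"

definition laur_const :: "'n coeffs \<Rightarrow> 'n laur" where
  "laur_const c = Poly_Mapping.single 0 c"

definition laur_monom :: "('n \<Rightarrow>\<^sub>0 int) \<Rightarrow> 'n laur" where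
  "laur_monom e = Poly_Mapping.single e 1"

definition laur_var :: "'n \<Rightarrow> 'n laur" where
  "laur_var i = laur_monom (Poly_Mapping.single i 1)"

definition amb_scalar :: "'n::{finite,linorder} coeffs fract \<Rightarrow> 'n ambient" where
  "amb_scalar c = to_fract (Poly_Mapping.single 0 c)"

definition amb_const :: "'n::{finite,linorder} coeffs \<Rightarrow> 'n ambient" where
  "amb_const c = amb_scalar (to_fract c)"

definition amb_var :: "'n::{finite,linorder} \<Rightarrow> 'n ambient" where
  "amb_var i = to_fract (Poly_Mapping.single (Poly_Mapping.single i 1) 1)"

text \<open>Evaluation at \<open>x\<close>, the coefficients being mapped by \<open>h\<close>.\<close>

definition mpol_eval ::
  "('c::zero \<Rightarrow> 'r::comm_semiring_1) \<Rightarrow> ('n::finite \<Rightarrow> 'r) \<Rightarrow> (('n \<Rightarrow>\<^sub>0 nat) \<Rightarrow>\<^sub>0 'c) \<Rightarrow> 'r" where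
  "mpol_eval h x p =
     (\<Sum>m\<in>Poly_Mapping.keys p. h (Poly_Mapping.lookup p m) * (\<Prod>i\<in>UNIV. x i ^ Poly_Mapping.lookup m i))"

definition laur_eval ::
  "('c::zero \<Rightarrow> 'r::field) \<Rightarrow> ('n::finite \<Rightarrow> 'r) \<Rightarrow> (('n \<Rightarrow>\<^sub>0 int) \<Rightarrow>\<^sub>0 'c) \<Rightarrow> 'r" where
  "laur_eval h x p =
     (\<Sum>m\<in>Poly_Mapping.keys p. h (Poly_Mapping.lookup p m) * (\<Prod>i\<in>UNIV. x i powi Poly_Mapping.lookup m i))"

definition mpol_to_laur :: "'n::finite mpol \<Rightarrow> 'n laur" where
  "mpol_to_laur p = mpol_eval laur_const laur_var p"

definition involves :: "'n mpol \<Rightarrow> 'n \<Rightarrow> bool" where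
  "involves p i \<longleftrightarrow> (\<exists>m\<in>Poly_Mapping.keys p. Poly_Mapping.lookup m i \<noteq> 0)"


subsection \<open>Seeds\<close>

text \<open>
  An exchange polynomial is stored as a formal polynomial, the \<open>i\<close>-th variable standing for the
  cluster variable with index \<open>i\<close>.  Since the cluster is algebraically independent, this is the
  same as an element of \<open>R[\<X>] \<subseteq> \<F>\<close>; that element is \<open>exch_elem\<close>.
\<close>

record 'n seed =
  cluster :: "'n \<Rightarrow> 'n ambient"
  exch :: "'n \<Rightarrow> 'n mpol"

definition exch_elem :: "'n::{finite,linorder} seed \<Rightarrow> 'n \<Rightarrow> 'n ambient" where
  "exch_elem S i = mpol_eval amb_const (cluster S) (exch S i)"

definition alg_independent :: "('n::{finite,linorder} \<Rightarrow> 'n ambient) \<Rightarrow> bool" where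
  "alg_independent x \<longleftrightarrow> (\<forall>p :: 'n frpol. mpol_eval amb_scalar x p = 0 \<longrightarrow> p = 0)"

definition generates_ambient :: "('n::{finite,linorder} \<Rightarrow> 'n ambient) \<Rightarrow> bool" where
  "generates_ambient x \<longleftrightarrow>
     (\<forall>y. \<exists>p q :: 'n frpol. mpol_eval amb_scalar x q \<noteq> 0 \<and>
            y = mpol_eval amb_scalar x p / mpol_eval amb_scalar x q)"

definition is_seed :: "'n::{finite,linorder} seed \<Rightarrow> bool" where
  "is_seed S \<longleftrightarrow>
     alg_independent (cluster S) \<and> generates_ambient (cluster S) \<and>
     (\<forall>i. irreducible (exch S i) \<and> (\<forall>j. \<not> mpol_var j dvd exch S i) \<and> \<not> involves (exch S i) i)"

text \<open>
  Equality of seeds: unordered collections of pairs (cluster variable, exchange polynomial), up to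
  units of \<open>R\<close>.  The exchange polynomials are compared as elements of the ambient field.
\<close>

definition seed_eq :: "'n::{finite,linorder} seed \<Rightarrow> 'n seed \<Rightarrow> bool" where
  "seed_eq S T \<longleftrightarrow>
     (\<exists>\<sigma> :: 'n \<Rightarrow> 'n. bij \<sigma> \<and>
        (\<forall>i. \<exists>u v :: 'n coeffs. u dvd 1 \<and> v dvd 1 \<and>
           cluster T (\<sigma> i) = amb_const u * cluster S i \<and>
           exch_elem T (\<sigma> i) = amb_const v * exch_elem S i))"


subsection \<open>The Laurent polynomials attached to the exchange polynomials\<close>

text \<open>
  \<open>is_hat S i P\<close> says that \<open>P\<close> is \<open>\<hat>F\<^sub>i\<close>.  The substitution \<open>X\<^sub>j \<leftarrow> F\<^sub>j/X\<close> is
  performed in the field of rational functions in formal variables \<open>amb_var\<close>.  As \<open>X\<^sub>j\<close> no longer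
  occurs afterwards, slot \<open>j\<close> is reused for the new variable \<open>X\<close>, so that the Laurent ring in
  \<open>X\<^sub>1,\<dots>,X\<^sub>j\<^sub>-\<^sub>1,X,X\<^sub>j\<^sub>+\<^sub>1,\<dots>,X\<^sub>n\<close> is again \<open>'n laur\<close>.
\<close>

definition hat_subst :: "'n::{finite,linorder} seed \<Rightarrow> 'n laur \<Rightarrow> 'n \<Rightarrow> 'n ambient" where
  "hat_subst S P j =
     laur_eval amb_const
       (amb_var(j := mpol_eval amb_const amb_var (exch S j) / amb_var j)) P"

definition is_hat :: "'n::{finite,linorder} seed \<Rightarrow> 'n \<Rightarrow> 'n laur \<Rightarrow> bool" where
  "is_hat S i P \<longleftrightarrow>
     (\<exists>a :: 'n \<Rightarrow>\<^sub>0 int. Poly_Mapping.lookup a i = 0 \<and> (\<forall>j. Poly_Mapping.lookup a j \<le> 0) \<and>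
        P = laur_monom a * mpol_to_laur (exch S i)) \<and>
     (\<forall>j. j \<noteq> i \<longrightarrow>
        (\<exists>Q :: 'n laur. hat_subst S P j = laur_eval amb_const amb_var Q \<and>
           \<not> mpol_to_laur (exch S j) dvd Q))"


subsection \<open>Mutation\<close>

text \<open>
  \<open>P|\<^bsub>X\<^sub>j\<leftarrow>0\<^esub>\<close>: the terms of \<open>P\<close> free of \<open>X\<^sub>j\<close>.  It is applied to \<open>P = \<hat>F\<^sub>i\<close> only when \<open>F\<^sub>j\<close>
  involves \<open>X\<^sub>i\<close>; in a seed \<open>\<hat>F\<^sub>i\<close> then has no negative power of \<open>X\<^sub>j\<close>.  Indeed
  \<open>F\<^sub>i|\<^bsub>X\<^sub>j\<leftarrow>0\<^esub>\<close> is nonzero and free of \<open>X\<^sub>i\<close>, hence not divisible by \<open>F\<^sub>j\<close>, and this forces the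
  exponent of \<open>X\<^sub>j\<close> in \<open>\<hat>F\<^sub>i/F\<^sub>i\<close> to be \<open>0\<close>.
\<close>

definition laur_set_zero :: "'n \<Rightarrow> 'n laur \<Rightarrow> 'n laur" where
  "laur_set_zero j P =
     (\<Sum>m\<in>{m \<in> Poly_Mapping.keys P. Poly_Mapping.lookup m j = 0}. Poly_Mapping.single m (Poly_Mapping.lookup P m))"

text \<open>
  A common factor of the Laurent polynomials \<open>Q\<close> and \<open>G\<close> in \<open>R[X\<^sub>1,\<dots>,X\<^sub>n]\<close> without \<open>X\<^sub>i\<close>, \<open>X\<^sub>j\<close>.
  Divisibility is taken in the Laurent ring, where monomials are units and are not counted as
  factors; nonunit elements of \<open>R\<close> are.
\<close>

definition common_factor :: "'n::finite \<Rightarrow> 'n \<Rightarrow> 'n laur \<Rightarrow> 'n laur \<Rightarrow> 'n mpol \<Rightarrow> bool" where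
  "common_factor i j Q G p \<longleftrightarrow>
     \<not> involves p i \<and> \<not> involves p j \<and> \<not> mpol_to_laur p dvd 1 \<and>
     mpol_to_laur p dvd Q \<and> mpol_to_laur p dvd G"

text \<open>
  \<open>strip_common i j Q G H\<close>: \<open>H\<close> results from \<open>G\<close> by dividing out common factors with \<open>Q\<close> until
  none remain.
\<close>

inductive strip_common :: "'n::finite \<Rightarrow> 'n \<Rightarrow> 'n laur \<Rightarrow> 'n laur \<Rightarrow> 'n laur \<Rightarrow> bool"
  for i j Q where
  strip_none: "(\<And>p. \<not> common_factor i j Q G p) \<Longrightarrow> strip_common i j Q G G"
| strip_step: "common_factor i j Q (mpol_to_laur p * G) p \<Longrightarrow> strip_common i j Q G H \<Longrightarrow>
           strip_common i j Q (mpol_to_laur p * G) H"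

text \<open>
  \<open>F\<^sub>j\<close> with \<open>X\<^sub>i\<close> replaced by \<open>(\<hat>F\<^sub>i|\<^bsub>X\<^sub>j\<leftarrow>0\<^esub>)/X\<^sub>i'\<close>, where \<open>P\<close> is \<open>\<hat>F\<^sub>i\<close>.  Slot \<open>i\<close> of the result stands for
  the new variable \<open>X\<^sub>i'\<close>.
\<close>

definition mut_G :: "'n::finite seed \<Rightarrow> 'n \<Rightarrow> 'n laur \<Rightarrow> 'n \<Rightarrow> 'n laur" where
  "mut_G S i P j =
     mpol_eval laur_const
       (laur_var(i := laur_set_zero j P * laur_monom (Poly_Mapping.single i (- 1)))) (exch S j)"

text \<open>
  \<open>is_mutation i S T\<close>: the seed \<open>T\<close> is obtained from the seed \<open>S\<close> by mutation at index \<open>i\<close>.  This is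
  a relation because mutation determines the exchange polynomials only up to units of \<open>R\<close>.
\<close>

definition is_mutation :: "'n::{finite,linorder} \<Rightarrow> 'n seed \<Rightarrow> 'n seed \<Rightarrow> bool" where
  "is_mutation i S T \<longleftrightarrow> is_seed S \<and> is_seed T \<and>
     (\<exists>P. is_hat S i P \<and>
        (\<forall>j. j \<noteq> i \<longrightarrow> cluster T j = cluster S j) \<and>
        cluster T i = laur_eval amb_const (cluster S) P / cluster S i \<and>
        (\<forall>j. if \<not> involves (exch S j) i then exch T j = exch S j
             else (\<exists>H (e :: 'n \<Rightarrow>\<^sub>0 int).
                     strip_common i j (laur_set_zero j P) (mut_G S i P j) H \<and>
                     Poly_Mapping.lookup e j = 0 \<and>
                     mpol_to_laur (exch T j) = laur_monom e * H \<and>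
                     (\<forall>k. \<not> mpol_var k dvd exch T j))))"


subsection \<open>The seed \<open>\<tau>\<^sub>n\<close> and activation sequences\<close>

definition tau :: "'n::{finite,linorder} seed" where
  "tau = \<lparr>cluster = amb_var,
          exch = (\<lambda>i. mpol_const (indetA i) + (\<Prod>j\<in>UNIV - {i}. mpol_var j))\<rparr>"

fun mutation_chain :: "'n::{finite,linorder} list \<Rightarrow> 'n seed \<Rightarrow> 'n seed \<Rightarrow> bool" where
  "mutation_chain [] S T \<longleftrightarrow> T = S"
| "mutation_chain (i # s) S T \<longleftrightarrow> (\<exists>S'. is_mutation i S S' \<and> mutation_chain s S' T)"

text \<open>\<open>S\<close> is (a representative, up to units, of) the seed \<open>\<tau>\<^sub>n\<^sup>s\<close>; the head of \<open>s\<close> is mutated first.\<close>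

definition generated_by :: "'n::{finite,linorder} list \<Rightarrow> 'n seed \<Rightarrow> bool" where
  "generated_by s S \<longleftrightarrow> is_seed S \<and> mutation_chain s tau S"

text \<open>An activation sequence is a \<^const>\<open>distinct\<close> list; below, \<open>j\<close> is its 0-based position of \<open>l\<close>.\<close>

definition mutate_seq :: "'n \<Rightarrow> 'n list \<Rightarrow> 'n list" where
  "mutate_seq l s =
     (if l \<notin> set s then s @ [l]
      else let j = (THE j. j < length s \<and> s ! j = l) in
        if Suc j = length s then butlast s
        else s[j := s ! Suc j, Suc j := s ! j])"

end

theory Submission
  imports Defs
begin

text \<open>
  Let \<open>S\<^sub>j\<close> be the set of the first \<open>j\<close> entries of the activation sequence. The cluster variable created by
  the \<open>j\<close>-th mutation is \<open>Z(S\<^sub>j)\<close>, where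
  \<open>Z(S) = (\<Prod>i\<in>S. A\<^sub>i) (1 + \<Sum>i\<in>S. (\<Prod>j\<noteq>i. X\<^sub>j) / A\<^sub>i) / (\<Prod>i\<in>S. X\<^sub>i)\<close>
  depends on the set \<open>S\<close> only; so exchanging two neighbouring entries of the sequence changes a single
  variable of the cluster, up to relabelling. The exchange polynomials are explicit as well: the one at an
  unused or the last index is \<open>A\<^sub>i z + B \<Prod>x\<close>, and an inner one is
  \<open>z z' M\<^sup>2 + B\<^sup>2 N\<^sup>2\<close>, where \<open>z\<close> and \<open>z'\<close> are the neighbouring variables in
  the sequence and \<open>N / M\<close> expresses the product of the initial variables outside \<open>S\<^sub>j\<close> in the current
  cluster. They are prime: the first kind is linear in a variable, and the second kind arises from it by
  mutations, which preserve primality. The non-divisibility by \<open>F\<^sub>j\<close> required of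
  \<open>\<hat>F\<^sub>i\<close> is checked at a rational zero of \<open>F\<^sub>j\<close>. Each mutation rule is then a factorisation
  of \<open>G\<^sub>j\<close> into a power of a factor of \<open>\<hat>F\<^sub>i|\<^bsub>X\<^sub>j \<leftarrow> 0\<^esub>\<close>, a monomial and the new exchange
  polynomial. Mutation leaves signs of the exchange polynomials open; changing signs commutes with mutation.
\<close>

section \<open>Evaluation homomorphisms\<close>

text \<open>Every ring in play is generated by the \<open>A_i\<close>, the \<open>X_i\<close> and
  possibly inverses of the \<open>X_i\<close>, so a homomorphism out of it is determined by a few
  values. The closed forms are therefore written once, polymorphically, and homomorphisms carry them
  between polynomials, Laurent polynomials, the ambient field and numbers. Identities with divisions
  are proved in a field and pulled back along the injective \<open>lemb\<close>. The obstacle is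
  that mutation is only a relation, given by non-divisibility and by stripping factors in no
  prescribed order. What pins its result down is primality: the new \<open>F_j\<close> is a prime
  that involves \<open>X_l\<close>, whereas everything stripped is free of \<open>X_l\<close>. One
  factorisation of \<open>G_j\<close> thus yields both existence and uniqueness, up to the units
  \<open>1\<close> and \<open>- 1\<close>. Most non-vanishing claims are settled by positivity at a
  point with coordinates 0 and 1, or at a rational point built for the purpose.\<close>

definition rhom :: "('a::comm_ring_1 \<Rightarrow> 'b::comm_ring_1) \<Rightarrow> bool" where
  "rhom h \<longleftrightarrow> h 0 = 0 \<and> h 1 = 1 \<and> (\<forall>a b. h (a + b) = h a + h b) \<and> (\<forall>a b. h (a * b) = h a * h b)"

lemma rhomD:
  assumes "rhom h"
  shows "h 0 = 0" "h 1 = 1" "h (a + b) = h a + h b" "h (a * b) = h a * h b"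
  using assms by (auto simp: rhom_def)

lemma rhom_uminus: "rhom h \<Longrightarrow> h (- a) = - h a"
  using rhomD(3)[of h a "- a"] rhomD(1)[of h] by (simp add: eq_neg_iff_add_eq_0 add.commute)

lemma rhom_diff: "rhom h \<Longrightarrow> h (a - b) = h a - h b"
  using rhomD(3)[of h a "- b"] rhom_uminus[of h b] by simp

lemma rhom_power: "rhom h \<Longrightarrow> h (a ^ n) = h a ^ n"
  by (induction n) (auto simp: rhomD)

lemma rhom_sum: "rhom h \<Longrightarrow> h (sum f S) = (\<Sum>i\<in>S. h (f i))"
  by (induction S rule: infinite_finite_induct) (auto simp: rhomD)

lemma rhom_prod: "rhom h \<Longrightarrow> h (prod f S) = (\<Prod>i\<in>S. h (f i))"
  by (induction S rule: infinite_finite_induct) (auto simp: rhomD)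

lemma rhom_prod_list: "rhom h \<Longrightarrow> h (prod_list xs) = prod_list (map h xs)"
  by (induction xs) (auto simp: rhomD)

lemma rhom_of_nat: "rhom h \<Longrightarrow> h (of_nat n) = of_nat n"
  by (induction n) (auto simp: rhomD)

lemma rhom_of_int: "rhom h \<Longrightarrow> h (of_int n) = of_int n"
  by (cases n rule: int_cases2) (auto simp: rhom_of_nat rhom_uminus)

lemmas rhoms = rhomD(1,2) rhomD(3,4) rhom_uminus rhom_diff rhom_power rhom_sum rhom_prod
  rhom_prod_list rhom_of_nat rhom_of_int

lemma rhom_dvd: "rhom h \<Longrightarrow> a dvd b \<Longrightarrow> h a dvd h b"
  by (auto simp: dvd_def rhomD)

lemma rhom_compose: "rhom g \<Longrightarrow> rhom h \<Longrightarrow> rhom (\<lambda>a. g (h a))"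
  by (auto simp: rhom_def)

lemma rhom_ident [simp]: "rhom (\<lambda>a. a)"
  by (auto simp: rhom_def)

lemma rhom_of_int_fun [simp]: "rhom of_int"
  by (auto simp: rhom_def)

lemma rhom_inj:
  assumes "rhom h" "\<And>a. h a = 0 \<Longrightarrow> a = 0"
  shows "h a = h b \<longleftrightarrow> a = b"
  using assms(2)[of "a - b"] by (auto simp: rhom_diff[OF assms(1)])

lemma poly_mapping_induct [case_names single add]:
  assumes "\<And>m c. P (Poly_Mapping.single m c)" "\<And>p q. P p \<Longrightarrow> P q \<Longrightarrow> P (p + q)"
  shows "P p"
proof (induction p rule: update_induct)
  case const
  show ?case using assms(1)[of undefined 0] by simp
next
  case (update f a b)
  have "Poly_Mapping.update a b f = f + Poly_Mapping.single a b"
    using update(1) by (intro poly_mapping_eqI)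
      (auto simp: lookup_update lookup_add lookup_single when_def in_keys_iff)
  then show ?case using assms update by metis
qed

text \<open>Common form of \<open>mpol_eval\<close> and \<open>laur_eval\<close>, the map on
  monomials being left arbitrary. The sign change \<open>sgl\<close> on Laurent polynomials is a
  third instance.\<close>

definition peval :: "('c::zero \<Rightarrow> 'r::comm_semiring_1) \<Rightarrow> ('m \<Rightarrow> 'r) \<Rightarrow> ('m \<Rightarrow>\<^sub>0 'c) \<Rightarrow> 'r" where
  "peval h \<mu> p = (\<Sum>m\<in>Poly_Mapping.keys p. h (Poly_Mapping.lookup p m) * \<mu> m)"

lemma peval_superset:
  assumes "h 0 = 0" "finite M" "Poly_Mapping.keys p \<subseteq> M"
  shows "peval h \<mu> p = (\<Sum>m\<in>M. h (Poly_Mapping.lookup p m) * \<mu> m)"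
  unfolding peval_def using assms
  by (intro sum.mono_neutral_left) (auto simp: in_keys_iff)

lemma peval_single: "h 0 = 0 \<Longrightarrow> peval h \<mu> (Poly_Mapping.single m c) = h c * \<mu> m"
  by (subst peval_superset[where M = "{m}"]) auto

lemma peval_add:
  assumes "h 0 = 0" "\<And>a b. h (a + b) = h a + h b"
  shows "peval h \<mu> (p + q) = peval h \<mu> p + peval h \<mu> q"
proof -
  let ?M = "Poly_Mapping.keys p \<union> Poly_Mapping.keys q"
  have "Poly_Mapping.keys (p + q) \<subseteq> ?M" by (rule keys_add)
  then show ?thesis
    using assms by (simp add: peval_superset[where M = ?M] lookup_add sum.distrib distrib_right)
qed

lemma rhom_peval:
  assumes h: "rhom h" and \<mu>: "\<mu> 0 = 1" "\<And>m m'. \<mu> (m + m') = \<mu> m * \<mu> m'"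
  shows "rhom (peval h (\<mu> :: 'm::comm_monoid_add \<Rightarrow> _))"
proof -
  have s: "peval h \<mu> (Poly_Mapping.single m c) = h c * \<mu> m" for m c
    by (rule peval_single) (rule rhomD(1)[OF h])
  have a: "peval h \<mu> (p + q) = peval h \<mu> p + peval h \<mu> q" for p q
    by (rule peval_add) (auto simp: rhomD[OF h])
  have "peval h \<mu> (p * q) = peval h \<mu> p * peval h \<mu> q" for p q
  proof (induction p rule: poly_mapping_induct)
    case (single m c)
    show ?case
      by (induction q rule: poly_mapping_induct)
        (simp_all add: mult_single s a distrib_left rhomD[OF h] \<mu> algebra_simps)
  qed (simp add: a distrib_right)
  moreover have "peval h \<mu> 0 = 0" "peval h \<mu> 1 = 1"
    using s[of 0 0] s[of 0 1] by (simp_all add: rhomD[OF h] \<mu>)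
  ultimately show ?thesis by (simp add: rhom_def a)
qed

lemma mpol_eval_peval: "mpol_eval h x = peval h (\<lambda>m. \<Prod>i\<in>UNIV. x i ^ Poly_Mapping.lookup m i)"
  by (simp add: fun_eq_iff mpol_eval_def peval_def)

lemma laur_eval_peval: "laur_eval h x = peval h (\<lambda>m. \<Prod>i\<in>UNIV. x i powi Poly_Mapping.lookup m i)"
  by (simp add: fun_eq_iff laur_eval_def peval_def)

lemma rhom_mpol_eval [simp]: "rhom h \<Longrightarrow> rhom (mpol_eval h x)"
  unfolding mpol_eval_peval by (rule rhom_peval) (auto simp: lookup_add power_add prod.distrib)

lemma rhom_laur_eval [simp]: "rhom h \<Longrightarrow> (\<And>i. x i \<noteq> 0) \<Longrightarrow> rhom (laur_eval h x)"
  unfolding laur_eval_peval by (rule rhom_peval) (auto simp: lookup_add power_int_add prod.distrib)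

lemma mpol_eval_single:
  "rhom h \<Longrightarrow> mpol_eval h x (Poly_Mapping.single m c) = h c * (\<Prod>i\<in>UNIV. x i ^ Poly_Mapping.lookup m i)"
  unfolding mpol_eval_peval by (rule peval_single) (simp add: rhoms)

lemma laur_eval_single:
  "rhom h \<Longrightarrow> laur_eval h x (Poly_Mapping.single m c) = h c * (\<Prod>i\<in>UNIV. x i powi Poly_Mapping.lookup m i)"
  unfolding laur_eval_peval by (rule peval_single) (simp add: rhoms)

lemma prod_powi_single:
  "(\<Prod>i\<in>UNIV. x i powi Poly_Mapping.lookup (Poly_Mapping.single j n) i) = (x (j::'n::finite) :: 'r::field) powi n"
proof -
  have "(\<Prod>i\<in>UNIV. x i powi Poly_Mapping.lookup (Poly_Mapping.single j n) i) = (\<Prod>i\<in>UNIV. if i = j then x j powi n else 1)"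
    by (intro prod.cong) (auto simp: lookup_single when_def)
  then show ?thesis by simp
qed

lemma prod_power_single:
  "(\<Prod>i\<in>UNIV. x i ^ Poly_Mapping.lookup (Poly_Mapping.single j n) i) = (x (j::'n::finite) :: 'r::comm_semiring_1) ^ n"
proof -
  have "(\<Prod>i\<in>UNIV. x i ^ Poly_Mapping.lookup (Poly_Mapping.single j n) i) = (\<Prod>i\<in>UNIV. if i = j then x j ^ n else 1)"
    by (intro prod.cong) (auto simp: lookup_single when_def)
  then show ?thesis by simp
qed

lemma single_eq_prod_vars:
  "Poly_Mapping.single m c =
    Poly_Mapping.single 0 c * (\<Prod>i\<in>(UNIV :: 'n::finite set).
      (Poly_Mapping.single (Poly_Mapping.single i (1::nat)) (1 :: 'c::comm_ring_1)) ^ Poly_Mapping.lookup m i)"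
proof -
  have pow: "Poly_Mapping.single e (1::'c) ^ k = Poly_Mapping.single ((\<Sum>_<k. e)) 1" for e :: "'n \<Rightarrow>\<^sub>0 nat" and k
    by (induction k) (auto simp: mult_single add.commute)
  have ms: "(\<Sum>_<k. Poly_Mapping.single i (1::nat)) = Poly_Mapping.single i k" for i :: 'n and k
    by (induction k) (auto simp: single_add[symmetric])
  have pr: "(\<Prod>i\<in>S. Poly_Mapping.single (f i) (1::'c)) = Poly_Mapping.single (\<Sum>i\<in>S. f i) 1"
    if "finite S" for S :: "'n set" and f :: "'n \<Rightarrow> ('n \<Rightarrow>\<^sub>0 nat)"
    using that by (induction S rule: finite_induct) (auto simp: mult_single)
  have m: "(\<Sum>i\<in>UNIV. Poly_Mapping.single i (Poly_Mapping.lookup m i)) = m"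
    by (intro poly_mapping_eqI) (simp add: lookup_sum lookup_single when_def)
  show ?thesis by (simp only: pow ms pr[OF finite_UNIV] m mult_single) simp
qed

lemma poly_induct [case_names const var add mult]:
  fixes p :: "('n::finite \<Rightarrow>\<^sub>0 nat) \<Rightarrow>\<^sub>0 'c::comm_ring_1"
  assumes c: "\<And>c. P (Poly_Mapping.single 0 c)"
    and v: "\<And>i. P (Poly_Mapping.single (Poly_Mapping.single i 1) 1)"
    and a: "\<And>p q. P p \<Longrightarrow> P q \<Longrightarrow> P (p + q)"
    and m: "\<And>p q. P p \<Longrightarrow> P q \<Longrightarrow> P (p * q)"
  shows "P p"
proof (induction p rule: poly_mapping_induct)
  case (single k d)
  have 1: "P 1" using c[of 1] by simp
  have pw: "P q \<Longrightarrow> P (q ^ n)" for q n by (induction n) (auto intro: m 1)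
  have pr: "finite S \<Longrightarrow> (\<And>i. i \<in> S \<Longrightarrow> P (f i)) \<Longrightarrow> P (prod f S)" for f and S :: "'n set"
    by (induction S rule: finite_induct) (auto intro: m 1)
  show ?case by (subst single_eq_prod_vars) (intro m c pr pw v finite_UNIV)
qed (rule a)

section \<open>The polynomial ring as a free commutative ring\<close>

definition mpol_A :: "'n::{finite,linorder} \<Rightarrow> 'n mpol" where
  "mpol_A i = mpol_const (indetA i)"

lemma rhom_single0: "rhom (Poly_Mapping.single (0 :: 'm::comm_monoid_add) :: 'c::comm_ring_1 \<Rightarrow> _)"
  by (auto simp: rhom_def single_add mult_single)

lemma coeffs_induct [case_names of_int A add mult]:
  fixes c :: "'n::{finite,linorder} coeffs"
  assumes "\<And>n. P (of_int n)" "\<And>i. P (indetA i)"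
    "\<And>p q. P p \<Longrightarrow> P q \<Longrightarrow> P (p + q)" "\<And>p q. P p \<Longrightarrow> P q \<Longrightarrow> P (p * q)"
  shows "P c"
proof (induction c rule: poly_induct)
  case (const n)
  then show ?case using assms(1)[of n] by (simp only: flip: single_of_int) simp
next
  case (var i)
  then show ?case using assms(2)[of i] by (simp only: indetA_def)
qed (fact assms(3,4))+

lemma mpol_induct [case_names of_int A X add mult]:
  fixes p :: "'n::{finite,linorder} mpol"
  assumes i: "\<And>n. P (of_int n)" and a: "\<And>i. P (mpol_A i)" and x: "\<And>i. P (mpol_var i)"
    and ad: "\<And>p q. P p \<Longrightarrow> P q \<Longrightarrow> P (p + q)" and mu: "\<And>p q. P p \<Longrightarrow> P q \<Longrightarrow> P (p * q)"
  shows "P p"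
proof (induction p rule: poly_induct)
  case (const c)
  show ?case
  proof (induction c rule: coeffs_induct)
    case (of_int n)
    then show ?case using i[of n] by (simp only: single_of_int)
  next
    case (A i)
    then show ?case using a[of i] by (simp add: mpol_A_def mpol_const_def)
  next
    case (add p q)
    then show ?case by (simp only: single_add ad)
  next
    case (mult p q)
    then show ?case using mu[OF mult] by (simp only: mult_single add_0_left)
  qed
next
  case (var i)
  then show ?case using x[of i] by (simp only: mpol_var_def)
qed (fact ad mu)+

text \<open>\<open>'n mpol\<close> is the free commutative ring on the \<open>mpol_A i\<close> and
  \<open>mpol_var i\<close>, and \<open>EV y x\<close> is the homomorphism prescribed on them.
  Treating the \<open>A_i\<close> as further variables lets substitutions compose by
  \<open>rhom_EV_compose\<close> and lets the \<open>A_i\<close> be specialised to numbers.\<close>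

definition EV :: "('n \<Rightarrow> 'r::comm_ring_1) \<Rightarrow> ('n \<Rightarrow> 'r) \<Rightarrow> 'n::{finite,linorder} mpol \<Rightarrow> 'r" where
  "EV y x = mpol_eval (mpol_eval of_int y) x"

lemma rhom_EV [simp]: "rhom (EV y x)"
  by (simp add: EV_def)

lemma eval_indetA: "mpol_eval of_int y (indetA i) = (y i :: 'r::comm_ring_1)"
  by (simp add: indetA_def mpol_eval_single prod_power_single)

lemma rhom_coeffs_eq:
  fixes f g :: "'n::{finite,linorder} coeffs \<Rightarrow> 'r::comm_ring_1"
  assumes "rhom f" "rhom g" "\<And>i. f (indetA i) = g (indetA i)"
  shows "f c = g c"
  by (induction c rule: coeffs_induct) (auto simp: assms rhomD[OF assms(1)] rhomD[OF assms(2)] rhom_of_int[OF assms(1)] rhom_of_int[OF assms(2)])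

lemma EV_A [simp]: "EV y x (mpol_A i) = y i"
  by (simp add: EV_def mpol_A_def mpol_const_def mpol_eval_single eval_indetA)

lemma EV_X [simp]: "EV y x (mpol_var i) = x i"
  by (simp add: EV_def mpol_var_def mpol_eval_single prod_power_single rhoms)

lemma rhom_mpol_eq:
  fixes f g :: "'n::{finite,linorder} mpol \<Rightarrow> 'r::comm_ring_1"
  assumes "rhom f" "rhom g" "\<And>i. f (mpol_A i) = g (mpol_A i)" "\<And>i. f (mpol_var i) = g (mpol_var i)"
  shows "f p = g p"
  by (induction p rule: mpol_induct) (auto simp: assms rhomD[OF assms(1)] rhomD[OF assms(2)] rhom_of_int[OF assms(1)] rhom_of_int[OF assms(2)])

lemma rhom_EV_compose:
  assumes "rhom h" shows "h (EV y x p) = EV (\<lambda>i. h (y i)) (\<lambda>i. h (x i)) p"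
  by (rule rhom_mpol_eq[where f = "\<lambda>p. h (EV y x p)"]) (auto intro: rhom_compose assms)

lemma EV_ident [simp]: "EV mpol_A mpol_var p = p"
  by (rule rhom_mpol_eq[where f = "EV mpol_A mpol_var" and g = "\<lambda>p. p"]) (simp_all add: rhom_ident)

lemma mpol_eval_conv_EV:
  assumes "rhom h" shows "mpol_eval h x p = EV (\<lambda>i. h (indetA i)) x p"
proof -
  have "mpol_eval of_int (\<lambda>i. h (indetA i)) c = h c" for c
    by (rule rhom_coeffs_eq) (simp_all add: assms eval_indetA)
  then have "mpol_eval of_int (\<lambda>i. h (indetA i)) = h" by (rule ext)
  then show ?thesis by (simp add: EV_def)
qed

section \<open>Laurent polynomials inside the ambient field\<close>

definition laur_A :: "'n::{finite,linorder} \<Rightarrow> 'n laur" where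
  "laur_A i = laur_const (indetA i)"

definition amb_A :: "'n::{finite,linorder} \<Rightarrow> 'n ambient" where
  "amb_A i = amb_const (indetA i)"

definition emb :: "'n::{finite,linorder} mpol \<Rightarrow> 'n ambient" where
  "emb = EV amb_A amb_var"

text \<open>Counterpart of \<open>EV\<close> for Laurent polynomials. The target is a field because
  \<open>laur_eval\<close> takes integer powers; the homomorphism property is stated at points with
  nonzero coordinates.\<close>

definition LV :: "('n \<Rightarrow> 'r::field) \<Rightarrow> ('n \<Rightarrow> 'r) \<Rightarrow> 'n::{finite,linorder} laur \<Rightarrow> 'r" where
  "LV y x = laur_eval (mpol_eval of_int y) x"

definition lemb :: "'n::{finite,linorder} laur \<Rightarrow> 'n ambient" where
  "lemb = LV amb_A amb_var"

lemma rhom_LV [simp]: "(\<And>i. x i \<noteq> 0) \<Longrightarrow> rhom (LV y x)"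
  by (simp add: LV_def)

lemma rhom_laur_const [simp]: "rhom laur_const"
  unfolding laur_const_def by (rule rhom_single0)

lemma rhom_amb_scalar [simp]: "rhom amb_scalar"
  by (auto simp: amb_scalar_def rhom_def single_add mult_single simp flip: to_fract_add to_fract_mult)

lemma rhom_to_fract [simp]: "rhom to_fract"
  by (auto simp: rhom_def)

lemma rhom_amb_const [simp]: "rhom amb_const"
  unfolding amb_const_def by (rule rhom_compose) simp_all

lemma mpol_to_laur_EV: "mpol_to_laur = EV laur_A laur_var"
  by (simp add: fun_eq_iff mpol_to_laur_def mpol_eval_conv_EV laur_A_def[abs_def])

lemma rhom_mpol_to_laur [simp]: "rhom mpol_to_laur"
  unfolding mpol_to_laur_def[abs_def] by (rule rhom_mpol_eval) simp

lemma eval_amb_const: "mpol_eval amb_const x p = EV amb_A x p"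
  by (simp add: mpol_eval_conv_EV amb_A_def[abs_def])

lemma amb_const_eq: "amb_const = mpol_eval of_int amb_A"
  by (rule ext, rule rhom_coeffs_eq) (simp_all add: eval_indetA amb_A_def)

lemma laur_eval_amb_const: "laur_eval amb_const x p = LV amb_A x p"
  by (simp add: LV_def amb_const_eq)

lemma LV_A [simp]: "LV y x (laur_A i) = y i"
  by (simp add: LV_def laur_A_def laur_const_def laur_eval_single eval_indetA)

lemma LV_monom: "LV y x (laur_monom e) = (\<Prod>i\<in>UNIV. x i powi Poly_Mapping.lookup e i)"
  by (simp add: LV_def laur_monom_def laur_eval_single rhoms)

lemma LV_X [simp]: "LV y x (laur_var i) = x i"
  by (simp only: LV_monom laur_var_def prod_powi_single power_int_1_right)

lemma LV_mpol_to_laur: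
  assumes "\<And>i. x i \<noteq> 0" shows "LV y x (mpol_to_laur p) = EV y x p"
  by (simp add: mpol_to_laur_EV rhom_EV_compose[OF rhom_LV[OF assms]])

lemma amb_var_nonzero [simp]: "amb_var i \<noteq> 0"
  by (simp add: amb_var_def flip: keys_eq_empty)

lemma lemb_mpol_to_laur [simp]: "lemb (mpol_to_laur p) = emb p"
  by (simp add: lemb_def emb_def LV_mpol_to_laur)

lemma rhom_lemb [simp]: "rhom lemb"
  by (simp add: lemb_def)

lemma rhom_emb [simp]: "rhom emb"
  by (simp add: emb_def)

lemma emb_A [simp]: "emb (mpol_A i) = amb_A i" and emb_X [simp]: "emb (mpol_var i) = amb_var i"
  by (simp_all add: emb_def)

lemma lemb_A [simp]: "lemb (laur_A i) = amb_A i" and lemb_X [simp]: "lemb (laur_var i) = amb_var i"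
  by (simp_all add: lemb_def)

text \<open>Clusters are required to be bases over the fraction field of \<open>R\<close>, while
  exchange polynomials have coefficients in \<open>R\<close>. This extension of scalars connects the
  two.\<close>

definition coeff_fract :: "'n::{finite,linorder} mpol \<Rightarrow> 'n frpol" where
  "coeff_fract = mpol_eval (\<lambda>c. Poly_Mapping.single 0 (to_fract c)) (\<lambda>i. Poly_Mapping.single (Poly_Mapping.single i 1) 1)"

lemma rhom_single0_to_fract: "rhom (\<lambda>c. Poly_Mapping.single 0 (to_fract c))"
  by (rule rhom_compose[OF rhom_single0 rhom_to_fract])

lemma rhom_coeff_fract [simp]: "rhom coeff_fract"
  unfolding coeff_fract_def by (rule rhom_mpol_eval) (rule rhom_single0_to_fract)

lemma coeff_fract_single: "coeff_fract (Poly_Mapping.single m c) = Poly_Mapping.single m (to_fract c)"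
  unfolding coeff_fract_def by (subst mpol_eval_single) (auto simp: rhom_single0_to_fract single_eq_prod_vars[of m "to_fract c"])

lemma lookup_coeff_fract: "Poly_Mapping.lookup (coeff_fract p) m = to_fract (Poly_Mapping.lookup p m)"
  by (induction p rule: poly_mapping_induct)
    (auto simp: coeff_fract_single rhomD[OF rhom_coeff_fract] lookup_add lookup_single when_def)

lemma coeff_fract_eq_0: "coeff_fract p = 0 \<longleftrightarrow> p = 0"
  by (auto simp: poly_mapping_eq_iff fun_eq_iff lookup_coeff_fract)

lemma mpol_eval_coeff_fract:
  "mpol_eval amb_scalar x (coeff_fract p) = EV amb_A x p"
proof (rule rhom_mpol_eq[where f = "\<lambda>p. mpol_eval amb_scalar x (coeff_fract p)"])
  show "rhom (\<lambda>p. mpol_eval amb_scalar x (coeff_fract p))"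
    by (rule rhom_compose[of "mpol_eval amb_scalar x" coeff_fract]) simp_all
  show "mpol_eval amb_scalar x (coeff_fract (mpol_A i)) = EV amb_A x (mpol_A i)" for i
    by (simp add: mpol_A_def mpol_const_def coeff_fract_single mpol_eval_single)
      (simp add: amb_A_def amb_const_def flip: mpol_const_def mpol_A_def)
  show "mpol_eval amb_scalar x (coeff_fract (mpol_var i)) = EV amb_A x (mpol_var i)" for i
    unfolding EV_X by (simp add: mpol_var_def coeff_fract_single mpol_eval_single prod_power_single rhoms(2)[OF rhom_amb_scalar])
qed simp

lemma mpol_eval_amb_var: "mpol_eval amb_scalar amb_var p = to_fract p"
proof (induction p rule: poly_induct)
  case (var i)
  show ?case by (simp add: mpol_eval_single prod_power_single rhoms(2)[OF rhom_amb_scalar] amb_var_def)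
qed (simp_all add: mpol_eval_single rhomD[OF rhom_mpol_eval[OF rhom_amb_scalar]], simp add: amb_scalar_def)

lemma emb_eq_0 [simp]: "emb p = 0 \<longleftrightarrow> p = 0"
  by (simp add: emb_def mpol_eval_amb_var coeff_fract_eq_0 flip: mpol_eval_coeff_fract)

lemma emb_eq_iff [simp]: "emb p = emb q \<longleftrightarrow> p = q"
  by (rule rhom_inj) simp_all

definition laur_inv :: "'n \<Rightarrow> 'n laur" where
  "laur_inv i = laur_monom (Poly_Mapping.single i (- 1))"

lemma laur_monom_add: "laur_monom (e + f) = laur_monom e * laur_monom f"
  by (simp add: laur_monom_def mult_single)

lemma laur_monom_0 [simp]: "laur_monom 0 = 1"
  by (simp add: laur_monom_def)

lemma laur_var_inv [simp]: "laur_var i * laur_inv i = 1"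
  unfolding laur_var_def laur_inv_def by (simp flip: laur_monom_add single_add)

lemma laur_monom_uminus: "laur_monom e * laur_monom (- e) = 1"
  by (simp flip: laur_monom_add)

lemma laur_monom_single:
  "laur_monom (Poly_Mapping.single i n) = (if n \<ge> 0 then laur_var i ^ nat n else laur_inv i ^ nat (- n))"
proof -
  have *: "laur_monom (Poly_Mapping.single i m) ^ k = laur_monom (Poly_Mapping.single i (int k * m))" for m k
    by (induction k) (auto simp: distrib_right simp flip: laur_monom_add single_add)
  show ?thesis by (auto simp: laur_var_def laur_inv_def *)
qed

lemma laur_monom_prod:
  "laur_monom (e :: 'n::finite \<Rightarrow>\<^sub>0 int) = (\<Prod>i\<in>UNIV. laur_monom (Poly_Mapping.single i (Poly_Mapping.lookup e i)))"
proof -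
  have pr: "(\<Prod>i\<in>S. laur_monom (f i)) = laur_monom (\<Sum>i\<in>S. f i)" if "finite S" for S :: "'n set" and f :: "'n \<Rightarrow> ('n \<Rightarrow>\<^sub>0 int)"
    using that by (induction S rule: finite_induct) (auto simp: laur_monom_add)
  have m: "(\<Sum>i\<in>UNIV. Poly_Mapping.single i (Poly_Mapping.lookup e i)) = e"
    by (intro poly_mapping_eqI) (simp add: lookup_sum lookup_single when_def)
  show ?thesis by (simp add: pr m)
qed

lemma laur_induct [case_names of_int A X Xi add mult]:
  fixes p :: "'n::{finite,linorder} laur"
  assumes i: "\<And>n. P (of_int n)" and a: "\<And>i. P (laur_A i)" and x: "\<And>i. P (laur_var i)" and xi: "\<And>i. P (laur_inv i)"
    and ad: "\<And>p q. P p \<Longrightarrow> P q \<Longrightarrow> P (p + q)" and mu: "\<And>p q. P p \<Longrightarrow> P q \<Longrightarrow> P (p * q)"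
  shows "P p"
proof (induction p rule: poly_mapping_induct)
  case (single e c)
  have c: "P (laur_const c)"
  proof (induction c rule: coeffs_induct)
    case (of_int n)
    then show ?case using i[of n] by (simp add: rhom_of_int)
  next
    case (A i)
    then show ?case using a[of i] by (simp add: laur_A_def)
  qed (simp_all add: rhomD(3,4) ad mu)
  have 1: "P 1" using i[of 1] by simp
  have pw: "P q \<Longrightarrow> P (q ^ n)" for q n by (induction n) (auto intro: mu 1)
  have pr: "finite S \<Longrightarrow> (\<And>i. i \<in> S \<Longrightarrow> P (f i)) \<Longrightarrow> P (prod f S)" for f and S :: "'n set"
    by (induction S rule: finite_induct) (auto intro: mu 1)
  have "P (laur_monom e)"
    by (subst laur_monom_prod) (auto intro!: pr pw x xi simp: laur_monom_single)
  moreover have "Poly_Mapping.single e c = laur_const c * laur_monom e"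
    by (simp add: laur_const_def laur_monom_def mult_single)
  ultimately show ?case using mu c by metis
qed (rule ad)

lemma rhom_laur_eq:
  fixes f g :: "'n::{finite,linorder} laur \<Rightarrow> 'r::comm_ring_1"
  assumes f: "rhom f" and g: "rhom g" and "\<And>i. f (laur_A i) = g (laur_A i)" "\<And>i. f (laur_var i) = g (laur_var i)"
  shows "f p = g p"
proof (induction p rule: laur_induct)
  case (Xi i)
  \<comment> \<open>The value on \<open>laur_inv i\<close> is an inverse of the value on
    \<open>laur_var i\<close>, and inverses are unique in any commutative ring.\<close>
  have "f (laur_var i) * f (laur_inv i) = 1" "g (laur_var i) * g (laur_inv i) = 1"
    using laur_var_inv[of i] by (simp_all add: rhomD(2)[OF f] rhomD(2)[OF g] flip: rhomD(4)[OF f] rhomD(4)[OF g])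
  then show ?case using assms(4)[of i] by (metis mult.left_commute mult.right_neutral)
qed (auto simp: assms rhomD[OF f] rhomD[OF g] rhom_of_int[OF f] rhom_of_int[OF g])

definition all_vars :: "'n::{finite,linorder} mpol" where
  "all_vars = (\<Prod>i\<in>UNIV. mpol_var i)"

lemma mpol_to_laur_A [simp]: "mpol_to_laur (mpol_A i) = laur_A i"
  and mpol_to_laur_X [simp]: "mpol_to_laur (mpol_var i) = laur_var i"
  by (simp_all add: mpol_to_laur_EV)

lemma mpol_to_laur_eq_0 [simp]: "mpol_to_laur p = 0 \<longleftrightarrow> p = 0" for p :: "'n::{finite,linorder} mpol"
  by (metis emb_eq_0 lemb_mpol_to_laur rhomD(1) rhom_lemb rhom_mpol_to_laur)

lemma mpol_to_laur_eq_iff [simp]: "mpol_to_laur p = mpol_to_laur q \<longleftrightarrow> p = q" for p :: "'n::{finite,linorder} mpol"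
  by (rule rhom_inj) simp_all

text \<open>A power of the product of all variables serves as denominator, so that a single exponent
  has to be tracked.\<close>

lemma laur_clear_denominators:
  "\<exists>n d. mpol_to_laur (all_vars ^ n) * L = mpol_to_laur d"
proof (induction L rule: laur_induct)
  case (of_int n)
  show ?case by (rule exI[of _ 0], rule exI[of _ "of_int n"]) (simp add: rhoms)
next
  case (A i)
  show ?case by (rule exI[of _ 0], rule exI[of _ "mpol_A i"]) (simp add: rhoms)
next
  case (X i)
  show ?case by (rule exI[of _ 0], rule exI[of _ "mpol_var i"]) (simp add: rhoms)
next
  case (Xi i)
  have "all_vars = (\<Prod>j\<in>UNIV - {i}. mpol_var j) * mpol_var i"
    by (simp add: all_vars_def prod.remove[of UNIV i] mult.commute)
  from arg_cong[OF this, of mpol_to_laur]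
  have "mpol_to_laur (all_vars ^ 1) * laur_inv i = mpol_to_laur (\<Prod>j\<in>UNIV - {i}. mpol_var j)"
    by (simp add: rhomD(4) mult.assoc)
  then show ?case by blast
next
  case (add p q)
  then obtain n d m e where
      d: "mpol_to_laur d = mpol_to_laur (all_vars ^ n) * p" and e: "mpol_to_laur e = mpol_to_laur (all_vars ^ m) * q"
    by metis
  have "mpol_to_laur (all_vars ^ (n + m)) * (p + q) = mpol_to_laur (all_vars ^ m * d + all_vars ^ n * e)"
    by (simp only: power_add rhomD(3,4)[OF rhom_mpol_to_laur] d e) (simp add: algebra_simps)
  then show ?case by blast
next
  case (mult p q)
  then obtain n d m e where
      d: "mpol_to_laur d = mpol_to_laur (all_vars ^ n) * p" and e: "mpol_to_laur e = mpol_to_laur (all_vars ^ m) * q"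
    by metis
  have "mpol_to_laur (all_vars ^ (n + m)) * (p * q) = mpol_to_laur (d * e)"
    by (simp only: power_add rhomD(3,4)[OF rhom_mpol_to_laur] d e) (simp add: algebra_simps)
  then show ?case by blast
qed

lemma mpol_var_nonzero [simp]: "mpol_var (i :: 'n::{finite,linorder}) \<noteq> 0"
  by (metis amb_var_nonzero emb_X emb_eq_0)

lemma all_vars_nonzero [simp]: "all_vars \<noteq> 0"
  by (simp add: all_vars_def)

text \<open>Clearing denominators reduces this to injectivity of \<open>emb\<close>. It is what
  allows identities of Laurent polynomials to be checked in a field.\<close>

lemma lemb_eq_0 [simp]: "lemb L = 0 \<longleftrightarrow> L = 0"
proof
  assume L: "lemb L = 0"
  obtain n d where nd: "mpol_to_laur (all_vars ^ n) * L = mpol_to_laur d"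
    using laur_clear_denominators by blast
  from arg_cong[OF this, of lemb] L have "d = 0" by (simp add: rhomD(4))
  with nd show "L = 0" by (simp add: rhomD(1))
qed (simp add: rhomD(1))

lemma lemb_eq_iff [simp]: "lemb p = lemb q \<longleftrightarrow> p = q"
  by (rule rhom_inj) simp_all

section \<open>The cluster variables and exchange polynomials in closed form\<close>

text \<open>
  For a sequence \<open>s @ t\<close> with last variable \<open>z\<close> of \<open>s\<close>, \<open>B = \<Prod>i\<in>s. A i\<close> and
  \<open>P\<close> the product of the variables outside \<open>s @ t\<close>, \<open>PP\<close> is the product of the initial variables
  outside \<open>s\<close>: the exchange relation at the head \<open>c\<close> of \<open>t\<close> is
  \<open>x c * X c = A c * z + B * P'\<close>, where \<open>P'\<close> is the product outside \<open>s @ [c]\<close>. Its numerator and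
  denominator are \<open>NN\<close> and \<open>MM\<close>. Inverses are passed as \<open>xi\<close>, so that the formula makes sense both for
  Laurent polynomials and in a field.
\<close>

fun MM :: "('n \<Rightarrow> 'r::comm_ring_1) \<Rightarrow> 'n list \<Rightarrow> 'r" where
  "MM x [] = 1"
| "MM x (c # t) = x c * (MM x t)\<^sup>2"

fun NN :: "('n \<Rightarrow> 'r::comm_ring_1) \<Rightarrow> ('n \<Rightarrow> 'r) \<Rightarrow> 'r \<Rightarrow> 'r \<Rightarrow> 'r \<Rightarrow> 'n list \<Rightarrow> 'r" where
  "NN A x P z B [] = P"
| "NN A x P z B (c # t) =
     (A c * z * MM x t + B * NN A x P (x c) (B * A c) t) * NN A x P (x c) (B * A c) t"

fun PP :: "('n \<Rightarrow> 'r::comm_ring_1) \<Rightarrow> ('n \<Rightarrow> 'r) \<Rightarrow> ('n \<Rightarrow> 'r) \<Rightarrow> 'r \<Rightarrow> 'r \<Rightarrow> 'r \<Rightarrow> 'n list \<Rightarrow> 'r" where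
  "PP A x xi P z B [] = P"
| "PP A x xi P z B (c # t) =
     (A c * z + B * PP A x xi P (x c) (B * A c) t) * PP A x xi P (x c) (B * A c) t * xi c"

text \<open>The default \<open>d\<close> covers the empty list: it is 1, the value of
  \<open>Z\<close> at the empty set, for a prefix of the sequence, and the variable just before the
  segment for a later segment.\<close>

definition lastz :: "('n \<Rightarrow> 'r) \<Rightarrow> 'r \<Rightarrow> 'n list \<Rightarrow> 'r" where
  "lastz x d t = (if t = [] then d else x (last t))"

definition BB :: "('n \<Rightarrow> 'r::comm_ring_1) \<Rightarrow> 'n list \<Rightarrow> 'r" where
  "BB A t = prod_list (map A t)"

lemma BB_simps [simp]: "BB A [] = 1" "BB A (c # t) = A c * BB A t" "BB A (t @ u) = BB A t * BB A u"
  by (auto simp: BB_def)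

lemma lastz_simps [simp]: "lastz x d [] = d" "lastz x d (t @ [c]) = x c" "lastz x d (c # t) = lastz x (x c) t"
  "lastz x d (t @ c # u) = lastz x (x c) u"
  by (auto simp: lastz_def)

lemma rhom_MM: "rhom h \<Longrightarrow> h (MM x t) = MM (\<lambda>i. h (x i)) t"
  by (induction t) (auto simp: rhoms)

lemma rhom_NN: "rhom h \<Longrightarrow> h (NN A x P z B t) = NN (\<lambda>i. h (A i)) (\<lambda>i. h (x i)) (h P) (h z) (h B) t"
  by (induction t arbitrary: z B) (auto simp: rhomD(3,4) rhom_MM)

lemma rhom_PP: "rhom h \<Longrightarrow> h (PP A x xi P z B t) = PP (\<lambda>i. h (A i)) (\<lambda>i. h (x i)) (\<lambda>i. h (xi i)) (h P) (h z) (h B) t"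
  by (induction t arbitrary: z B) (auto simp: rhomD(3,4))

lemma rhom_BB: "rhom h \<Longrightarrow> h (BB A t) = BB (\<lambda>i. h (A i)) t"
  by (simp add: BB_def rhom_prod_list comp_def)

lemma MM_cong: "(\<And>i. i \<in> set t \<Longrightarrow> x i = x' i) \<Longrightarrow> MM x t = MM x' t"
  by (induction t) auto

lemma NN_cong:
  "(\<And>i. i \<in> set t \<Longrightarrow> x i = x' i) \<Longrightarrow> (\<And>i. i \<in> set t \<Longrightarrow> A i = A' i) \<Longrightarrow> P = P' \<Longrightarrow> z = z' \<Longrightarrow> B = B' \<Longrightarrow>
    NN A x P z B t = NN A' x' P' z' B' t"
proof (induction t arbitrary: z z' B B')
  case (Cons c t)
  have "MM x t = MM x' t" using Cons.prems by (intro MM_cong) auto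
  moreover have "NN A x P (x c) (B * A c) t = NN A' x' P' (x' c) (B' * A' c) t"
    using Cons.prems by (intro Cons.IH) auto
  ultimately show ?case using Cons.prems by simp
qed simp

lemma PP_cong:
  "(\<And>i. i \<in> set t \<Longrightarrow> x i = x' i) \<Longrightarrow> (\<And>i. i \<in> set t \<Longrightarrow> xi i = xi' i) \<Longrightarrow> (\<And>i. i \<in> set t \<Longrightarrow> A i = A' i) \<Longrightarrow>
    P = P' \<Longrightarrow> z = z' \<Longrightarrow> B = B' \<Longrightarrow> PP A x xi P z B t = PP A' x' xi' P' z' B' t"
proof (induction t arbitrary: z z' B B')
  case (Cons c t)
  have "PP A x xi P (x c) (B * A c) t = PP A' x' xi' P' (x' c) (B' * A' c) t"
    using Cons.prems by (intro Cons.IH) auto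
  then show ?case using Cons.prems by simp
qed simp

lemma NN_PP:
  "(\<And>c. c \<in> set t \<Longrightarrow> x c * xi c = 1) \<Longrightarrow> NN A x P z B t = PP A x xi P z B t * MM x t"
proof (induction t arbitrary: z B)
  case (Cons c t)
  define q M where "q = PP A x xi P (x c) (B * A c) t" and "M = MM x t"
  have q: "NN A x P (x c) (B * A c) t = q * M"
    unfolding q_def M_def using Cons.prems by (intro Cons.IH) auto
  have "x c * xi c = 1" using Cons.prems by simp
  then have "(A c * z + B * q) * q * xi c * (x c * M\<^sup>2) = (A c * z + B * q) * q * M\<^sup>2"
    by (metis (no_types, opaque_lifting) mult.assoc mult.commute mult.right_neutral)
  then show ?case by (simp add: q flip: q_def M_def) (simp add: power2_eq_square algebra_simps)
qed simp

text \<open>Each step of \<open>MM\<close> squares what follows, so a final segment is raised to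
  \<open>2 ^ length t\<close>. This is the origin of the powers of two in the exponents
  below.\<close>

lemma MM_append: "MM x (t @ u) = MM x t * MM x u ^ (2 ^ length t)"
  by (induction t) (auto simp: power_mult_distrib power_mult [symmetric] mult.commute mult.left_commute)

text \<open>\<open>PP\<close> is computed from the right: the value for the tail \<open>u\<close>,
  with \<open>z\<close> and \<open>B\<close> advanced past \<open>t\<close>, takes the place of the
  product \<open>P\<close>.\<close>

lemma PP_append:
  "PP A x xi P z B (t @ u) = PP A x xi (PP A x xi P (lastz x z t) (B * BB A t) u) z B t"
  by (induction t arbitrary: z B) (auto simp: mult.assoc)

lemma PP_zero: "PP A x xi 0 z B t = 0"
  by (induction t arbitrary: z B) auto

lemma NN_zero: "NN A x 0 z B t = 0"
  by (induction t arbitrary: z B) auto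

lemma exchange_swap:
  fixes z q B Al Ab xl xb :: "'r::field"
  assumes "xl \<noteq> 0" "xb \<noteq> 0" "z * xb + B\<^sup>2 * q\<^sup>2 \<noteq> 0"
  defines "w \<equiv> (z * xb + B\<^sup>2 * q\<^sup>2) / xl"
  defines "q1 \<equiv> (Ab * w + B * Al * q) * q * inverse xb"
    and "q2 \<equiv> (Al * xl + B * Ab * q) * q * inverse xb"
  shows "(Al * z + B * q1) * q1 * inverse w = (Ab * z + B * q2) * q2 * inverse xl"
proof -
  have w0: "w \<noteq> 0" using assms by simp
  have q1: "q1 = q / xl * (Ab * z + B * q2)"
    unfolding q1_def q2_def w_def using assms(1,2) by (simp add: field_simps power2_eq_square)
  have "(Al * z + B * q1) * q = w * q2"
    unfolding q1 unfolding q2_def w_def using assms(1,2) by (simp add: field_simps power2_eq_square)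
  then have "(Al * z + B * q1) * q1 = w * q2 / xl * (Ab * z + B * q2)"
    using q1 by (metis (no_types, opaque_lifting) mult.assoc times_divide_eq_left times_divide_eq_right)
  moreover have "w * q2 / xl * Y * inverse w = Y * q2 * inverse xl" for Y
    using w0 assms(1) by (simp add: field_simps)
  ultimately show ?thesis by simp
qed

text \<open>
  \<open>FF\<close> and \<open>HF\<close> are \<open>F\<^sub>i\<close> and \<open>\<hat>F\<^sub>i\<close> of the seed generated by \<open>s\<close>, evaluated in an arbitrary ring.
\<close>

definition FF :: "('n::finite \<Rightarrow> 'r::comm_ring_1) \<Rightarrow> ('n \<Rightarrow> 'r) \<Rightarrow> 'n list \<Rightarrow> 'n \<Rightarrow> 'r" where
  "FF A x s i = (let pre = takeWhile (\<lambda>j. j \<noteq> i) s; L = A i * lastz x 1 pre + BB A pre * (\<Prod>j\<in>- insert i (set pre). x j) in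
     case tl (dropWhile (\<lambda>j. j \<noteq> i) s) of [] \<Rightarrow> L
     | b # post \<Rightarrow> lastz x 1 pre * x b * (MM x post)\<^sup>2 +
         (BB A pre)\<^sup>2 * (NN A x (\<Prod>j\<in>- set s. x j) (x b) (BB A pre * A i * A b) post)\<^sup>2)"

definition HF :: "('n::finite \<Rightarrow> 'r::comm_ring_1) \<Rightarrow> ('n \<Rightarrow> 'r) \<Rightarrow> ('n \<Rightarrow> 'r) \<Rightarrow> 'n list \<Rightarrow> 'n \<Rightarrow> 'r" where
  "HF A x xi s i = (let pre = takeWhile (\<lambda>j. j \<noteq> i) s; L = A i * lastz x 1 pre + BB A pre * (\<Prod>j\<in>- insert i (set pre). x j) in
     case tl (dropWhile (\<lambda>j. j \<noteq> i) s) of [] \<Rightarrow> L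
     | b # post \<Rightarrow> lastz x 1 pre * x b +
         (BB A pre)\<^sup>2 * (PP A x xi (\<Prod>j\<in>- set s. x j) (x b) (BB A pre * A i * A b) post)\<^sup>2)"

lemma takeWhile_neq [simp]: "i \<notin> set s \<Longrightarrow> takeWhile (\<lambda>j. j \<noteq> i) s = s"
  by (induction s) auto
lemma dropWhile_neq [simp]: "i \<notin> set s \<Longrightarrow> dropWhile (\<lambda>j. j \<noteq> i) s = []"
  by (induction s) auto
lemma takeWhile_neq' [simp]: "i \<notin> set s \<Longrightarrow> takeWhile (\<lambda>j. j \<noteq> i) (s @ i # t) = s"
  by (induction s) auto
lemma dropWhile_neq' [simp]: "i \<notin> set s \<Longrightarrow> dropWhile (\<lambda>j. j \<noteq> i) (s @ i # t) = i # t"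
  by (induction s) auto

lemma FF_notin: "i \<notin> set s \<Longrightarrow> FF A x s i = A i * lastz x 1 s + BB A s * (\<Prod>j\<in>- insert i (set s). x j)"
  by (simp add: FF_def Let_def)
lemma FF_last: "i \<notin> set s \<Longrightarrow> FF A x (s @ [i]) i = A i * lastz x 1 s + BB A s * (\<Prod>j\<in>- insert i (set s). x j)"
  by (simp add: FF_def Let_def)
lemma FF_inner: "i \<notin> set pre \<Longrightarrow> FF A x (pre @ i # b # post) i =
    lastz x 1 pre * x b * (MM x post)\<^sup>2 +
         (BB A pre)\<^sup>2 * (NN A x (\<Prod>j\<in>- set (pre @ i # b # post). x j) (x b) (BB A pre * A i * A b) post)\<^sup>2"
  by (simp add: FF_def Let_def)
lemma HF_notin: "i \<notin> set s \<Longrightarrow> HF A x xi s i = A i * lastz x 1 s + BB A s * (\<Prod>j\<in>- insert i (set s). x j)"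
  by (simp add: HF_def Let_def)
lemma HF_last: "i \<notin> set s \<Longrightarrow> HF A x xi (s @ [i]) i = A i * lastz x 1 s + BB A s * (\<Prod>j\<in>- insert i (set s). x j)"
  by (simp add: HF_def Let_def)
lemma HF_inner: "i \<notin> set pre \<Longrightarrow> HF A x xi (pre @ i # b # post) i =
    lastz x 1 pre * x b +
         (BB A pre)\<^sup>2 * (PP A x xi (\<Prod>j\<in>- set (pre @ i # b # post). x j) (x b) (BB A pre * A i * A b) post)\<^sup>2"
  by (simp add: HF_def Let_def)

text \<open>In the first two cases the exchange polynomial is linear in \<open>A_i\<close>, in the
  third it is of the inner kind.\<close>

lemma index_cases:
  obtains (notin) "i \<notin> set s" | (last) pre where "s = pre @ [i]" "i \<notin> set pre"
  | (inner) pre b post where "s = pre @ i # b # post" "i \<notin> set pre"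
proof (cases "i \<in> set s")
  case True
  then obtain pre t where s: "s = pre @ i # t" "i \<notin> set pre" by (meson split_list_first)
  then show ?thesis by (cases t) (auto intro: last inner)
qed (auto intro: notin)

lemma rhom_lastz: "rhom h \<Longrightarrow> h (lastz x d t) = lastz (\<lambda>i. h (x i)) (h d) t"
  by (auto simp: lastz_def)

lemma rhom_FF:
  assumes h: "rhom h" shows "h (FF A x s i) = FF (\<lambda>i. h (A i)) (\<lambda>i. h (x i)) s i"
  by (cases i s rule: index_cases)
    (simp_all add: FF_notin FF_last FF_inner rhomD(2-4)[OF h] rhom_power[OF h] rhom_prod[OF h] rhom_lastz[OF h] rhom_BB[OF h] rhom_NN[OF h] rhom_MM[OF h])

lemma rhom_HF:
  assumes h: "rhom h" shows "h (HF A x xi s i) = HF (\<lambda>i. h (A i)) (\<lambda>i. h (x i)) (\<lambda>i. h (xi i)) s i"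
  by (cases i s rule: index_cases)
    (simp_all add: HF_notin HF_last HF_inner rhomD(2-4)[OF h] rhom_power[OF h] rhom_prod[OF h] rhom_lastz[OF h] rhom_BB[OF h] rhom_PP[OF h])

text \<open>The square of the monomial \<open>MM\<close> of the entries after \<open>b\<close>
  separates \<open>F_i\<close> from hat \<open>F_i\<close>, so it supplies the exponents in the
  definition of hat \<open>F_i\<close>, up to sign.\<close>

lemma FF_inner_HF:
  assumes "i \<notin> set pre" "\<And>c. c \<in> set post \<Longrightarrow> x c * xi c = 1"
  shows "FF A x (pre @ i # b # post) i = HF A x xi (pre @ i # b # post) i * (MM x post)\<^sup>2"
  using assms by (simp add: FF_inner HF_inner NN_PP[of post x xi] power_mult_distrib algebra_simps)

section \<open>The cluster variables and their exchange relations\<close>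

definition ZZ :: "('n::finite \<Rightarrow> 'r::field) \<Rightarrow> ('n \<Rightarrow> 'r) \<Rightarrow> 'n set \<Rightarrow> 'r" where
  "ZZ A x S = (\<Prod>j\<in>S. A j) * (1 + (\<Sum>i\<in>S. (\<Prod>j\<in>- {i}. x j) / A i)) / (\<Prod>j\<in>S. x j)"

lemma ZZ_empty [simp]: "ZZ A x {} = 1"
  by (simp add: ZZ_def)

text \<open>Adding \<open>l\<close> to the index set contributes one new summand to the sum in
  \<open>ZZ\<close>; after multiplication by \<open>x l\<close> it becomes the second term, while
  the old summands give \<open>A l * ZZ A x S\<close>.\<close>

lemma ZZ_insert:
  fixes A x :: "'n::finite \<Rightarrow> 'r::field"
  assumes nz: "\<And>i. A i \<noteq> 0" "\<And>i. x i \<noteq> 0" and l: "l \<notin> S"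
  shows "x l * ZZ A x (insert l S) = A l * ZZ A x S + prod A S * (\<Prod>j\<in>- insert l S. x j)"
proof -
  define T where "T = 1 + (\<Sum>i\<in>S. (\<Prod>j\<in>- {i}. x j) / A i)"
  have U: "- {l} = S \<union> - insert l S" using l by auto
  have "(\<Prod>j\<in>- {l}. x j) = prod x S * (\<Prod>j\<in>- insert l S. x j)"
    unfolding U by (rule prod.union_disjoint) auto
  then have "x l * ZZ A x (insert l S) =
      x l * (A l * prod A S * (prod x S * (\<Prod>j\<in>- insert l S. x j) / A l + T) / (x l * prod x S))"
    using l by (simp add: ZZ_def T_def algebra_simps)
  also have "\<dots> = A l * (prod A S * T / prod x S) + prod A S * (\<Prod>j\<in>- insert l S. x j)"
    using nz by (simp add: field_simps)
  finally show ?thesis by (simp add: ZZ_def T_def)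
qed

text \<open>Three instances of \<open>ZZ_insert\<close> imply the relation after multiplication by
  \<open>x l * x b\<close>: at \<open>l\<close> and at \<open>b\<close> over \<open>S\<close>, and
  at \<open>b\<close> over \<open>S\<close> with \<open>l\<close> added.\<close>

lemma ZZ_exchange:
  fixes A x :: "'n::finite \<Rightarrow> 'r::field"
  assumes nz: "\<And>i. A i \<noteq> 0" "\<And>i. x i \<noteq> 0" and l: "l \<notin> S" "b \<notin> S" "l \<noteq> b"
  shows "ZZ A x (insert l S) * ZZ A x (insert b S) =
    ZZ A x S * ZZ A x (insert b (insert l S)) + (prod A S)\<^sup>2 * (\<Prod>j\<in>- insert b (insert l S). x j)\<^sup>2"
proof -
  define P where "P = (\<Prod>j\<in>- insert b (insert l S). x j)"
  have U: "- insert l S = insert b (- insert b (insert l S))" "- insert b S = insert l (- insert b (insert l S))"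
    using l by auto
  have P: "(\<Prod>j\<in>- insert l S. x j) = x b * P" "(\<Prod>j\<in>- insert b S. x j) = x l * P"
    unfolding P_def by (subst U, simp)+
  define Z Zl Zb Zlb where "Z = ZZ A x S" and "Zl = ZZ A x (insert l S)" and "Zb = ZZ A x (insert b S)"
    and "Zlb = ZZ A x (insert b (insert l S))"
  have "x l * Zl = A l * Z + prod A S * (x b * P)"
    "x b * Zb = A b * Z + prod A S * (x l * P)"
    using ZZ_insert[of A x, OF nz, where l = l and S = S] ZZ_insert[of A x, OF nz, where l = b and S = S] l P
    by (simp_all add: Z_def Zl_def Zb_def)
  moreover have "x b * Zlb = A b * Zl + A l * prod A S * P"
    using ZZ_insert[of A x, OF nz, where l = b and S = "insert l S"] l P by (simp add: Zl_def Zlb_def P_def)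
  ultimately have "x l * x b * (Zl * Zb) = x l * x b * (Z * Zlb + (prod A S)\<^sup>2 * P\<^sup>2)"
    by algebra
  then show ?thesis using nz by (simp add: Z_def Zl_def Zb_def Zlb_def P_def)
qed

definition CL :: "('n::finite \<Rightarrow> 'r::field) \<Rightarrow> ('n \<Rightarrow> 'r) \<Rightarrow> 'n list \<Rightarrow> 'n \<Rightarrow> 'r" where
  "CL A x s i = (if i \<in> set s then ZZ A x (insert i (set (takeWhile (\<lambda>j. j \<noteq> i) s))) else x i)"

lemma CL_at: "i \<notin> set pre \<Longrightarrow> CL A x (pre @ i # t) i = ZZ A x (insert i (set pre))"
  by (simp add: CL_def)

lemma CL_notin: "i \<notin> set s \<Longrightarrow> CL A x s i = x i"
  by (simp add: CL_def)

lemma lastz_CL: "distinct (pre @ t) \<Longrightarrow> lastz (CL A x (pre @ t)) 1 pre = ZZ A x (set pre)"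
proof (cases pre rule: rev_cases)
  case (snoc ys y)
  then show "distinct (pre @ t) \<Longrightarrow> ?thesis" by (auto simp: CL_at)
qed simp

lemma BB_prod: "distinct t \<Longrightarrow> BB A t = prod A (set t)"
  by (induction t) auto

lemma prod_CL_notin: "(\<Prod>j\<in>- set s. CL A x s j) = (\<Prod>j\<in>- set s. x j)"
  by (intro prod.cong) (auto simp: CL_notin)

text \<open>This confirms the reading of \<open>PP\<close> on the actual cluster. The induction
  moves the head \<open>c\<close> of \<open>t\<close> into \<open>pre\<close>; its step is the
  relation \<open>ZZ_insert\<close> at \<open>c\<close>, which turns the bracket of
  \<open>PP\<close> into \<open>x c\<close> times the cluster variable.\<close>

lemma PP_CL:
  fixes A x :: "'n::finite \<Rightarrow> 'r::field"
  assumes nz: "\<And>i. A i \<noteq> 0" "\<And>i. x i \<noteq> 0"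
  assumes "distinct (pre @ t)" "\<And>i. CL A x (pre @ t) i \<noteq> 0"
  shows "PP A (CL A x (pre @ t)) (\<lambda>i. inverse (CL A x (pre @ t) i)) (\<Prod>j\<in>- set (pre @ t). x j) (ZZ A x (set pre)) (prod A (set pre)) t
    = (\<Prod>j\<in>- set pre. x j)"
  using assms(3,4)
proof (induction t arbitrary: pre)
  case (Cons c t)
  have s: "pre @ c # t = (pre @ [c]) @ t" by simp
  have c: "CL A x (pre @ c # t) c = ZZ A x (set (pre @ [c]))"
    using Cons.prems(1) by (simp add: CL_at)
  have IH: "PP A (CL A x (pre @ c # t)) (\<lambda>i. inverse (CL A x (pre @ c # t) i)) (\<Prod>j\<in>- set (pre @ c # t). x j)
      (CL A x (pre @ c # t) c) (prod A (set pre) * A c) t = (\<Prod>j\<in>- set (pre @ [c]). x j)"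
    using Cons.IH[of "pre @ [c]"] Cons.prems unfolding c by (simp add: mult.commute)
  have U: "- set pre = insert c (- set (pre @ [c]))" using Cons.prems(1) by auto
  have Q: "(\<Prod>j\<in>- set pre. x j) = x c * (\<Prod>j\<in>- set (pre @ [c]). x j)"
    by (subst U) simp
  have "x c * ZZ A x (set (pre @ [c])) = A c * ZZ A x (set pre) + prod A (set pre) * (\<Prod>j\<in>- set (pre @ [c]). x j)"
    using ZZ_insert[of A x, OF nz, where l = c and S = "set pre"] Cons.prems(1) by simp
  moreover have "ZZ A x (set (pre @ [c])) \<noteq> 0" using Cons.prems(2)[of c] c by simp
  moreover have "E * q * inverse Z = u * q" if "u * Z = E" "Z \<noteq> 0" for E q u Z :: 'r
    using that by (auto simp: field_simps)
  ultimately show ?case unfolding PP.simps IH Q unfolding c by metis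
qed simp

text \<open>The first factor is the cluster variable with label \<open>l\<close>. Dividing by it
  leaves the variable that \<open>b\<close> has when it precedes \<open>l\<close>, and this is why
  the mutation interchanges the two entries.\<close>

lemma HF_CL_inner:
  fixes A x :: "'n::finite \<Rightarrow> 'r::field"
  assumes nz: "\<And>i. A i \<noteq> 0" "\<And>i. x i \<noteq> 0"
  assumes d: "distinct (pre @ l # b # post)" and c: "\<And>i. CL A x (pre @ l # b # post) i \<noteq> 0"
  shows "HF A (CL A x (pre @ l # b # post)) (\<lambda>i. inverse (CL A x (pre @ l # b # post) i)) (pre @ l # b # post) l
    = ZZ A x (insert l (set pre)) * ZZ A x (insert b (set pre))"
proof -
  let ?s = "pre @ l # b # post"
  have b: "CL A x ?s b = ZZ A x (insert b (insert l (set pre)))"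
    using d CL_at[of b "pre @ [l]" A x post] by auto
  have P: "PP A (CL A x ?s) (\<lambda>i. inverse (CL A x ?s i)) (\<Prod>j\<in>- set ?s. CL A x ?s j) (CL A x ?s b) (BB A pre * A l * A b) post
    = (\<Prod>j\<in>- insert b (insert l (set pre)). x j)"
    unfolding prod_CL_notin b
    using PP_CL[of A x, OF nz, where pre = "pre @ [l, b]" and t = post] d c not_sym[of l b]
    by (auto simp: BB_prod mult.commute mult.left_commute insert_commute)
  have lz: "lastz (CL A x ?s) 1 pre = ZZ A x (set pre)"
    using d by (intro lastz_CL) auto
  have l: "l \<notin> set pre" "BB A pre = prod A (set pre)" using d by (auto intro: BB_prod)
  show ?thesis
    unfolding HF_inner[OF l(1)] unfolding P unfolding lz b l(2)
    using ZZ_exchange[of A x, OF nz, where l = l and b = b and S = "set pre"] d by auto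
qed

text \<open>One of the two factors is the present variable with label \<open>l\<close>, the other
  its replacement. Both the adjunction and the deletion of \<open>l\<close> are covered.\<close>

lemma HF_CL_linear:
  fixes A x :: "'n::finite \<Rightarrow> 'r::field"
  assumes nz: "\<And>i. A i \<noteq> 0" "\<And>i. x i \<noteq> 0"
  assumes d: "distinct (pre @ [l])" and s: "s = pre \<or> s = pre @ [l]"
  shows "HF A (CL A x s) xi s l = x l * ZZ A x (insert l (set pre))"
proof -
  have "HF A (CL A x s) xi s l = A l * lastz (CL A x s) 1 pre + BB A pre * (\<Prod>j\<in>- insert l (set pre). CL A x s j)"
    using s d by (auto simp: HF_notin HF_last)
  also have "lastz (CL A x s) 1 pre = ZZ A x (set pre)"
    using s d lastz_CL[of pre "[]"] lastz_CL[of pre "[l]"] by auto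
  also have "(\<Prod>j\<in>- insert l (set pre). CL A x s j) = (\<Prod>j\<in>- insert l (set pre). x j)"
    using s by (intro prod.cong) (auto simp: CL_notin)
  finally show ?thesis
    using ZZ_insert[of A x, OF nz, where l = l and S = "set pre"] d by (simp add: BB_prod)
qed

section \<open>Irreducibility\<close>

text \<open>One substitution serves two tests: it fixes \<open>p\<close> exactly if
  \<open>X_i\<close> is absent from \<open>p\<close>, and kills \<open>p\<close> exactly if
  \<open>X_i\<close> divides \<open>p\<close>.\<close>

definition sub0 :: "'n::{finite,linorder} \<Rightarrow> 'n mpol \<Rightarrow> 'n mpol" where
  "sub0 i = EV mpol_A (mpol_var(i := 0))"

lemma rhom_sub0 [simp]: "rhom (sub0 i)"
  by (simp add: sub0_def)

lemma mpol_const_conv: "EV mpol_A x p = mpol_eval mpol_const x p"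
proof -
  have h: "rhom mpol_const" unfolding mpol_const_def by (rule rhom_single0)
  show ?thesis unfolding mpol_A_def[abs_def] by (rule mpol_eval_conv_EV[OF h, symmetric])
qed

lemma rhom_mpol_const [simp]: "rhom mpol_const"
  unfolding mpol_const_def by (rule rhom_single0)

lemma sub0_single: "sub0 i (Poly_Mapping.single m c) = (if Poly_Mapping.lookup m i = 0 then Poly_Mapping.single m c else 0)"
proof -
  have *: "sub0 i (Poly_Mapping.single m c) = mpol_const c * (\<Prod>j\<in>UNIV. (mpol_var(i := 0)) j ^ Poly_Mapping.lookup m j)"
    by (simp add: sub0_def mpol_const_conv mpol_eval_single)
  show ?thesis
  proof (cases "Poly_Mapping.lookup m i = 0")
    case True
    then have "(\<Prod>j\<in>UNIV. (mpol_var(i := 0)) j ^ Poly_Mapping.lookup m j) = (\<Prod>j\<in>UNIV. mpol_var j ^ Poly_Mapping.lookup m j)"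
      by (intro prod.cong) auto
    then show ?thesis using True unfolding * by (simp add: mpol_const_def mpol_var_def single_eq_prod_vars[of m c])
  next
    case False
    then have "(\<Prod>j\<in>UNIV. (mpol_var(i := 0)) j ^ Poly_Mapping.lookup m j) = (0 :: 'a mpol)"
      by (intro prod_zero) (auto intro!: bexI[of _ i])
    then show ?thesis using False unfolding * by simp
  qed
qed

lemma lookup_sub0: "Poly_Mapping.lookup (sub0 i p) m = (if Poly_Mapping.lookup m i = 0 then Poly_Mapping.lookup p m else 0)"
  by (induction p rule: poly_mapping_induct)
    (auto simp: sub0_single rhomD(3) lookup_add lookup_single when_def)

lemma not_involves_iff: "\<not> involves p i \<longleftrightarrow> sub0 i p = p"
proof -
  have "sub0 i p = p \<longleftrightarrow> (\<forall>m. Poly_Mapping.lookup (sub0 i p) m = Poly_Mapping.lookup p m)"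
    by (metis poly_mapping_eqI)
  also have "\<dots> \<longleftrightarrow> (\<forall>m\<in>Poly_Mapping.keys p. Poly_Mapping.lookup m i = 0)"
    unfolding lookup_sub0 Ball_def in_keys_iff by metis
  finally show ?thesis by (auto simp: involves_def)
qed

lemma EV_sub0: "EV y x (sub0 i p) = EV y (x(i := 0)) p"
  unfolding sub0_def by (subst rhom_EV_compose) (auto intro!: arg_cong2[where f = "\<lambda>a b. EV a b p"] simp: rhoms)

lemma EV_not_involves: "\<not> involves p i \<Longrightarrow> EV y (x(i := t)) p = EV y x p"
  using EV_sub0[of y "x(i := t)" i p] EV_sub0[of y x i p] by (simp add: not_involves_iff)

lemma involvesI: "EV y (x(i := t)) p \<noteq> EV y x p \<Longrightarrow> involves p i"
  using EV_not_involves by blast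

lemma dvd_sub0: "\<exists>q. p = mpol_var i * q + sub0 i p"
proof (induction p rule: mpol_induct)
  case (of_int n)
  show ?case by (rule exI[of _ 0]) (simp add: rhom_of_int)
next
  case (A j)
  show ?case by (rule exI[of _ 0]) (simp add: sub0_def)
next
  case (X j)
  show ?case by (rule exI[of _ "if i = j then 1 else 0"]) (simp add: sub0_def)
next
  case (add p q)
  then obtain a b where "p = mpol_var i * a + sub0 i p" "q = mpol_var i * b + sub0 i q" by blast
  then have "p + q = mpol_var i * (a + b) + sub0 i (p + q)"
    by (simp add: rhomD(3) algebra_simps)
  then show ?case by blast
next
  case (mult p q)
  then obtain a b where p: "p = mpol_var i * a + sub0 i p" and q: "q = mpol_var i * b + sub0 i q" by blast
  have "p * q = (mpol_var i * a + sub0 i p) * (mpol_var i * b + sub0 i q)" using p q by simp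
  also have "\<dots> = mpol_var i * (a * (mpol_var i * b + sub0 i q) + sub0 i p * b) + sub0 i (p * q)"
    by (simp add: rhomD(4) algebra_simps)
  finally show ?case by blast
qed

lemma var_dvd_iff: "mpol_var i dvd p \<longleftrightarrow> sub0 i p = 0"
proof
  assume "mpol_var i dvd p"
  moreover have "sub0 i (mpol_var i) = 0" by (simp add: sub0_def)
  ultimately show "sub0 i p = 0" by (auto simp: rhomD(4))
next
  assume "sub0 i p = 0"
  then show "mpol_var i dvd p" using dvd_sub0[of p i] by (auto simp: dvd_def)
qed

lemma prime_elem_var: "prime_elem (mpol_var (i :: 'n::{finite,linorder}))"
proof (rule prime_elemI)
  show "\<not> mpol_var i dvd 1" by (simp add: var_dvd_iff rhomD(2))
qed (auto simp: var_dvd_iff rhomD(4))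

lemma not_var_dvdI: "EV y x p \<noteq> 0 \<Longrightarrow> x i = 0 \<Longrightarrow> \<not> mpol_var i dvd p"
  using rhom_dvd[of "EV y x" "mpol_var i" p] by auto

text \<open>Univariate view in \<open>X_l\<close>. The coefficients are taken in the whole ring
  \<open>'n mpol\<close>, so that evaluation at \<open>0\<close> or at \<open>X_l\<close> itself
  lands in that ring again.\<close>

definition as_poly :: "'n::{finite,linorder} \<Rightarrow> 'n mpol \<Rightarrow> 'n mpol poly" where
  "as_poly l = EV (\<lambda>i. [:mpol_A i:]) ((\<lambda>i. [:mpol_var i:])(l := [:0, 1:]))"

lemma rhom_as_poly [simp]: "rhom (as_poly l)"
  by (simp add: as_poly_def)

lemma rhom_poly [simp]: "rhom (\<lambda>p. poly p t)"
  by (simp add: rhom_def)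

lemma poly_as_poly: "poly (as_poly l p) t = EV mpol_A (mpol_var(l := t)) p"
  unfolding as_poly_def
  by (subst rhom_EV_compose[OF rhom_poly]) (auto intro!: arg_cong2[where f = "\<lambda>a b. EV a b p"])

lemma unit_poly_const:
  fixes f :: "'a::idom poly"
  assumes "f * g = 1" shows "poly f t = poly f u"
proof -
  have "f \<noteq> 0" "g \<noteq> 0" using assms by auto
  then have "degree f + degree g = 0" using degree_mult_eq[of f g] assms by simp
  then obtain c where "f = [:c:]" by (auto elim: degree_eq_zeroE)
  then show ?thesis by simp
qed

lemma unit_not_involves:
  fixes c :: "'n::{finite,linorder} mpol"
  assumes "c * d = 1" shows "\<not> involves c l"
proof -
  have "as_poly l c * as_poly l d = 1"
    using assms by (simp add: rhomD(2) flip: rhomD(4)[OF rhom_as_poly])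
  from unit_poly_const[OF this, of 0 "mpol_var l"] show ?thesis
    by (simp add: poly_as_poly not_involves_iff sub0_def)
qed

lemma unit_eval_A:
  fixes c :: "'n::{finite,linorder} mpol"
  assumes "c * d = 1" shows "EV (mpol_A(l := 0)) mpol_var c = c"
proof -
  define \<phi> :: "'n mpol \<Rightarrow> 'n mpol poly" where "\<phi> = EV ((\<lambda>i. [:mpol_A i:])(l := [:0, 1:])) (\<lambda>i. [:mpol_var i:])"
  have h: "rhom \<phi>" by (simp add: \<phi>_def)
  have p: "poly (\<phi> p) t = EV (mpol_A(l := t)) mpol_var p" for p t
    unfolding \<phi>_def by (subst rhom_EV_compose[OF rhom_poly]) (auto intro!: arg_cong2[where f = "\<lambda>a b. EV a b p"])
  have "\<phi> c * \<phi> d = 1"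
    using assms by (simp add: rhomD(2)[OF h] flip: rhomD(4)[OF h])
  from unit_poly_const[OF this, of 0 "mpol_A l"] show ?thesis by (simp add: p)
qed

lemma EV_compose_EV: "EV y x (EV y' x' p) = EV (\<lambda>i. EV y x (y' i)) (\<lambda>i. EV y x (x' i)) p"
  by (rule rhom_EV_compose) simp

text \<open>A unit has degree 0 in each \<open>X_l\<close> and each \<open>A_l\<close>, so these can
  be set to 0 one after the other. What remains is an invertible integer.\<close>

lemma unit_mpol:
  fixes c :: "'n::{finite,linorder} mpol"
  assumes cd: "c * d = 1" shows "c = 1 \<or> c = - 1"
proof -
  have "EV mpol_A (\<lambda>i. if i \<in> S then 0 else mpol_var i) c = c" if "finite S" for S
    using that
  proof (induction S rule: finite_induct)
    case (insert l S)
    have "EV mpol_A (\<lambda>i. if i \<in> S then 0 else mpol_var i) c = EV mpol_A (\<lambda>i. if i \<in> S then 0 else mpol_var i) (sub0 l c)"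
      using unit_not_involves[OF cd, of l] by (simp add: not_involves_iff)
    also have "\<dots> = EV mpol_A (\<lambda>i. if i \<in> insert l S then 0 else mpol_var i) c"
      unfolding EV_sub0 by (intro arg_cong2[where f = "\<lambda>a b. EV a b c"]) auto
    finally show ?case using insert by simp
  qed simp
  from this[of UNIV] have 1: "EV mpol_A (\<lambda>i. 0) c = c" by simp
  have "EV (\<lambda>i. if i \<in> S then 0 else mpol_A i) mpol_var c = c" if "finite S" for S
    using that
  proof (induction S rule: finite_induct)
    case (insert l S)
    have "EV (\<lambda>i. if i \<in> S then 0 else mpol_A i) mpol_var c = EV (\<lambda>i. if i \<in> S then 0 else mpol_A i) mpol_var (EV (mpol_A(l := 0)) mpol_var c)"
      using unit_eval_A[OF cd, of l] by simp
    also have "\<dots> = EV (\<lambda>i. if i \<in> insert l S then 0 else mpol_A i) mpol_var c"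
      unfolding EV_compose_EV by (intro arg_cong2[where f = "\<lambda>a b. EV a b c"]) (auto simp: rhoms)
    finally show ?case using insert by simp
  qed simp
  from this[of UNIV] have 2: "EV (\<lambda>i. 0) mpol_var c = c" by simp
  have "EV (\<lambda>i. 0) (\<lambda>i. 0) c = EV (\<lambda>i. 0) mpol_var (EV mpol_A (\<lambda>i. 0) c)"
    unfolding EV_compose_EV by (intro arg_cong2[where f = "\<lambda>a b. EV a b c"]) (auto simp: rhoms)
  then have 3: "EV (\<lambda>i. 0) (\<lambda>i. 0) c = c" using 1 2 by simp
  have "EV (\<lambda>i. 0 :: int) (\<lambda>i. 0) c * EV (\<lambda>i. 0) (\<lambda>i. 0) d = 1"
    using cd by (simp add: rhoms(2) flip: rhomD(4)[OF rhom_EV])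
  then have 4: "EV (\<lambda>i. 0 :: int) (\<lambda>i. 0) c \<in> {1, -1}"
    using zmult_eq_1_iff by auto
  have "c = of_int (EV (\<lambda>i. 0 :: int) (\<lambda>i. 0) c)"
    by (subst rhom_EV_compose[OF rhom_of_int_fun]) (simp add: 3)
  then show ?thesis using 4 by (metis insert_iff of_int_1 of_int_minus singletonD)
qed

text \<open>If \<open>F\<close> divided a variable \<open>X_j\<close>, primality of
  \<open>X_j\<close> would make \<open>X_j\<close> divide \<open>F\<close> or the cofactor, and in
  the second case \<open>F\<close> would be a unit. So \<open>F\<close> does not become invertible
  among the Laurent polynomials.\<close>

lemma prime_not_dvd_all_vars:
  assumes "prime_elem F" "\<And>j. \<not> mpol_var j dvd F" shows "\<not> F dvd all_vars ^ n"
proof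
  assume "F dvd all_vars ^ n"
  then have "F dvd (\<Prod>j\<in>UNIV. mpol_var j)"
    using assms(1) prime_elem_dvd_power by (auto simp: all_vars_def)
  moreover have "\<not> F dvd (\<Prod>j\<in>S. mpol_var j)" if "finite S" for S
    using that
  proof (induction S rule: finite_induct)
    case empty
    then show ?case using prime_elem_not_unit[OF assms(1)] by simp
  next
    case (insert j S)
    have "\<not> F dvd mpol_var j"
    proof
      assume "F dvd mpol_var j"
      then obtain c where c: "mpol_var j = F * c" by (auto simp: dvd_def)
      then have "mpol_var j dvd F * c" by simp
      then have "mpol_var j dvd c"
        using prime_elem_dvd_multD[OF prime_elem_var] assms(2) by blast
      then obtain c' where "c = mpol_var j * c'" by (auto simp: dvd_def)
      with c have "mpol_var j * 1 = mpol_var j * (F * c')" by (simp add: mult.left_commute)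
      then have "F dvd 1" using mpol_var_nonzero[of j] mult_left_cancel by (metis dvdI)
      then show False using prime_elem_not_unit[OF assms(1)] by simp
    qed
    then show ?case using insert prime_elem_dvd_multD[OF assms(1)] by auto
  qed
  ultimately show False by simp
qed

text \<open>Clearing the denominator of the quotient multiplies \<open>q\<close> by a power of
  \<open>all_vars\<close>, which the prime \<open>F\<close> does not divide.\<close>

lemma mpol_to_laur_dvdD:
  fixes F q :: "'n::{finite,linorder} mpol"
  assumes "prime_elem F" "\<And>j. \<not> mpol_var j dvd F" "mpol_to_laur F dvd mpol_to_laur q"
  shows "F dvd q"
proof -
  obtain L where L: "mpol_to_laur q = mpol_to_laur F * L" using assms(3) by (auto simp: dvd_def)
  obtain n d where d: "mpol_to_laur (all_vars ^ n) * L = mpol_to_laur d"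
    using laur_clear_denominators by blast
  have "mpol_to_laur (all_vars ^ n * q) = mpol_to_laur (F * d)"
    by (simp add: rhomD(4) L mult.left_commute flip: d)
  then have "F dvd all_vars ^ n * q" by (simp only: mpol_to_laur_eq_iff) simp
  then show ?thesis using prime_elem_dvd_multD[OF assms(1)] prime_not_dvd_all_vars[OF assms(1,2)] by blast
qed

lemma all_vars_unit: "\<exists>U. mpol_to_laur (all_vars ^ n) * U = 1"
proof
  have *: "mpol_to_laur all_vars * (\<Prod>i\<in>UNIV. laur_inv i) = 1"
    by (simp add: all_vars_def rhom_prod flip: prod.distrib)
  then show "mpol_to_laur (all_vars ^ n) * (\<Prod>i\<in>UNIV. laur_inv i) ^ n = 1"
    by (simp add: rhom_power * flip: power_mult_distrib)
qed

text \<open>Primality survives the inversion of the variables: both factors are multiplied by units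
  to become polynomials.\<close>

lemma mpol_to_laur_prime:
  fixes F :: "'n::{finite,linorder} mpol"
  assumes "prime_elem F" "\<And>j. \<not> mpol_var j dvd F" "mpol_to_laur F dvd L * L'"
  shows "mpol_to_laur F dvd L \<or> mpol_to_laur F dvd L'"
proof -
  obtain n d n' d' where d: "mpol_to_laur (all_vars ^ n) * L = mpol_to_laur d"
    "mpol_to_laur (all_vars ^ n') * L' = mpol_to_laur d'"
    using laur_clear_denominators by metis
  have "mpol_to_laur (d * d') = mpol_to_laur (all_vars ^ n) * mpol_to_laur (all_vars ^ n') * (L * L')"
    by (simp add: rhomD(4) algebra_simps flip: d)
  then have "mpol_to_laur F dvd mpol_to_laur (d * d')" using assms(3) by simp
  then have "F dvd d * d'" by (rule mpol_to_laur_dvdD[OF assms(1,2)])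
  then have dd: "F dvd d \<or> F dvd d'" using prime_elem_dvd_multD[OF assms(1)] by blast
  have *: "mpol_to_laur F dvd L" if "mpol_to_laur (all_vars ^ n) * L = mpol_to_laur d" "F dvd d" for n and d :: "'n mpol" and L
  proof -
    obtain U where "mpol_to_laur (all_vars ^ n :: 'n mpol) * U = 1" using all_vars_unit by blast
    then have "L = U * (mpol_to_laur (all_vars ^ n) * L)" by (simp add: mult.commute[of U] flip: mult.assoc)
    then have "L = U * mpol_to_laur d" unfolding that(1) .
    then show ?thesis using rhom_dvd[OF rhom_mpol_to_laur that(2)] by simp
  qed
  show ?thesis using dd * d by blast
qed

text \<open>After clearing denominators, \<open>F * d\<close> is, as a polynomial in
  \<open>X_l\<close>, a monomial of some degree \<open>n\<close>. Its order at 0 is also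
  \<open>n\<close>, and \<open>F\<close> has order 0 there, so \<open>d\<close> has order, hence
  degree, at least \<open>n\<close>. Then \<open>F\<close> has degree 0 in \<open>X_l\<close>. This
  is the fact that prevents stripped factors from containing the new exchange polynomial.\<close>

lemma not_dvd_not_involves:
  fixes F q :: "'n::{finite,linorder} mpol"
  assumes F: "involves F l" "\<not> mpol_var l dvd F" and q: "\<not> involves q l" "q \<noteq> 0"
  shows "\<not> mpol_to_laur F dvd mpol_to_laur q"
proof
  assume "mpol_to_laur F dvd mpol_to_laur q"
  then obtain L where L: "mpol_to_laur q = mpol_to_laur F * L" by (auto simp: dvd_def)
  obtain n d where d: "mpol_to_laur (all_vars ^ n) * L = mpol_to_laur d"
    using laur_clear_denominators by blast
  have "mpol_to_laur (all_vars ^ n * q) = mpol_to_laur (F * d)"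
    by (simp add: rhomD(4) L mult.left_commute flip: d)
  then have e: "all_vars ^ n * q = F * d" by (simp only: mpol_to_laur_eq_iff)
  have const: "as_poly l r = [:r:]" if "\<not> involves r l" for r
  proof -
    have "as_poly l r = as_poly l (sub0 l r)" using that by (simp add: not_involves_iff)
    also have "\<dots> = EV (\<lambda>i. [:mpol_A i:]) (\<lambda>i. [:(mpol_var(l := 0)) i:]) r"
      unfolding as_poly_def EV_sub0 by (intro arg_cong2[where f = "\<lambda>a b. EV a b r"]) (auto simp: fun_eq_iff)
    also have "\<dots> = [:sub0 l r:]" unfolding sub0_def
      by (rule rhom_EV_compose[symmetric]) (auto simp: rhom_def)
    finally show ?thesis using that by (simp add: not_involves_iff)
  qed
  define c where "c = (\<Prod>j\<in>UNIV - {l}. mpol_var j)"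
  have "as_poly l all_vars = (\<Prod>j\<in>UNIV. as_poly l (mpol_var j))"
    by (simp add: all_vars_def rhom_prod)
  also have "\<dots> = [:0, 1:] * (\<Prod>j\<in>UNIV - {l}. as_poly l (mpol_var j))"
    by (subst prod.remove[of UNIV l]) (auto simp: as_poly_def)
  also have "(\<Prod>j\<in>UNIV - {l}. as_poly l (mpol_var j)) = as_poly l c"
    by (simp add: c_def rhom_prod)
  also have "as_poly l c = [:c:]"
    by (rule const) (auto simp: not_involves_iff c_def sub0_def rhom_prod intro!: prod.cong)
  finally have av: "as_poly l all_vars = monom c 1" by (simp add: monom_altdef)
  have c0: "c \<noteq> 0" by (simp add: c_def)
  have "as_poly l F * as_poly l d = as_poly l all_vars ^ n * as_poly l q"
    using arg_cong[OF e, of "as_poly l"] by (simp add: rhomD(4) rhom_power)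
  also have "\<dots> = monom (c ^ n * q) n"
    by (simp add: av monom_power const[OF q(1)] mult.commute flip: smult_monom)
  finally have eq: "as_poly l F * as_poly l d = monom (c ^ n * q) n" .
  let ?f = "as_poly l F" and ?d = "as_poly l d"
  have nz: "?f \<noteq> 0" "?d \<noteq> 0" using eq c0 q(2) by (auto simp: monom_eq_0_iff)
  have "degree ?f + degree ?d = n"
    using nz eq c0 q(2) by (metis degree_mult_eq degree_monom_eq mult_eq_0_iff power_not_zero)
  moreover have "order 0 ?f = 0"
    using F(2) by (intro order_0I) (simp add: poly_as_poly var_dvd_iff sub0_def)
  moreover have "order 0 (monom (c ^ n * q) n) = n"
  proof -
    have "monom (c ^ n * q) n = [:c ^ n * q:] * [:- 0, 1:] ^ n" by (simp add: monom_altdef)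
    moreover have "order 0 [:c ^ n * q:] = 0" using c0 q(2) by (intro order_0I) auto
    moreover have "order 0 ([:- 0, 1:] ^ n :: 'n mpol poly) = n" by (rule order_power_n_n)
    ultimately show ?thesis using c0 q(2)
      by (simp only:) (subst order_mult, simp_all del: mult_pCons_left)
  qed
  moreover have "order 0 (?f * ?d) = order 0 ?f + order 0 ?d"
    using nz by (intro order_mult) simp
  moreover have "order 0 ?d \<le> degree ?d" using nz by (intro order_degree) auto
  ultimately have "degree ?f = 0" using eq by simp
  then obtain a where "?f = [:a:]" by (auto elim: degree_eq_zeroE)
  then have "EV mpol_A (mpol_var(l := 0)) F = EV mpol_A (mpol_var(l := mpol_var l)) F"
    using poly_as_poly[of l F 0] poly_as_poly[of l F "mpol_var l"] by simp
  then show False using F(1) not_involves_iff[of F l] by (simp add: sub0_def)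
qed

lemma dvd_cancel_prime_power:
  fixes f g p :: "'a::idom"
  assumes "prime_elem p" "\<not> p dvd f" "f dvd p ^ n * g"
  shows "f dvd g"
  using assms(3)
proof (induction n)
  case (Suc n)
  then obtain k where k: "p * (p ^ n * g) = f * k" by (auto simp: dvd_def mult.assoc)
  then have "p dvd f * k" by (metis dvd_triv_left)
  then obtain k' where "k = p * k'" using prime_elem_dvd_multD[OF assms(1)] assms(2) by (auto simp: dvd_def)
  with k have "p * (p ^ n * g) = p * (f * k')" by (simp add: mult.left_commute)
  then have "p ^ n * g = f * k'" using assms(1) by auto
  then show ?case using Suc.IH by simp
qed simp

lemma emb_0_1 [simp]: "emb 0 = 0" "emb 1 = 1"
  by (simp_all add: rhomD(2)[OF rhom_emb])

lemma mpol_A_neq_var [simp]: "mpol_A i \<noteq> mpol_var j"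
proof
  assume "mpol_A i = mpol_var j"
  from arg_cong[OF this, of "EV (\<lambda>_. 1 :: int) (\<lambda>_. 0)"] show False by simp
qed

text \<open>\<open>\<rho>\<close> solves \<open>f = 0\<close> for the variable \<open>v\<close> in
  the ambient field. The multiples of \<open>f\<close> are exactly its zeros, and the target is a
  field, so \<open>f\<close> is prime.\<close>

lemma prime_elem_linear:
  fixes f a b v :: "'n::{finite,linorder} mpol"
  assumes f: "f = v * a + b" "f \<noteq> 0"
    and a: "a = 1 \<or> prime_elem a \<and> \<not> a dvd f"
    and v: "v \<in> range mpol_A \<union> range mpol_var"
    and \<rho>: "rhom \<rho>" "\<rho> f = 0" "\<rho> a = emb a" "\<rho> b = emb b"
      "\<And>i. mpol_A i \<noteq> v \<Longrightarrow> \<rho> (mpol_A i) = amb_A i" "\<And>i. mpol_var i \<noteq> v \<Longrightarrow> \<rho> (mpol_var i) = amb_var i"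
  shows "prime_elem f"
proof -
  note \<rho>h = rhomD[OF \<rho>(1)]
  \<comment> \<open>Pseudo-division by \<open>f\<close> in the variable \<open>v\<close>: a power of
    the leading coefficient \<open>a\<close> makes a remainder possible on which
    \<open>\<rho>\<close> and \<open>emb\<close> agree.\<close>
  have red: "\<exists>m q r. a ^ m * g = f * q + r \<and> \<rho> r = emb r" for g
  proof (induction g rule: mpol_induct)
    case (of_int n)
    show ?case by (rule exI[of _ 0], rule exI[of _ 0], rule exI[of _ "of_int n"]) (simp add: rhom_of_int \<rho>(1))
  next
    case (A i)
    show ?case
    proof (cases "mpol_A i = v")
      case True
      have "a ^ 1 * v = f * 1 + (- b)" "\<rho> (- b) = emb (- b)"
        using \<rho> by (simp_all add: f(1) rhom_uminus mult.commute)
      then show ?thesis unfolding True by blast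
    next
      case False
      then have "a ^ 0 * mpol_A i = f * 0 + mpol_A i" "\<rho> (mpol_A i) = emb (mpol_A i)" by (simp_all add: \<rho>)
      then show ?thesis by blast
    qed
  next
    case (X i)
    show ?case
    proof (cases "mpol_var i = v")
      case True
      have "a ^ 1 * v = f * 1 + (- b)" "\<rho> (- b) = emb (- b)"
        using \<rho> by (simp_all add: f(1) rhom_uminus mult.commute)
      then show ?thesis unfolding True by blast
    next
      case False
      then have "a ^ 0 * mpol_var i = f * 0 + mpol_var i" "\<rho> (mpol_var i) = emb (mpol_var i)" by (simp_all add: \<rho>)
      then show ?thesis by blast
    qed
  next
    case (add g g')
    then obtain m q r m' q' r' where *: "a ^ m * g = f * q + r" "\<rho> r = emb r" "a ^ m' * g' = f * q' + r'" "\<rho> r' = emb r'"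
      by blast
    have "a ^ (m + m') * (g + g') = a ^ m' * (a ^ m * g) + a ^ m * (a ^ m' * g')"
      by (simp add: power_add algebra_simps)
    also have "\<dots> = f * (a ^ m' * q + a ^ m * q') + (a ^ m' * r + a ^ m * r')"
      unfolding * by (simp add: algebra_simps)
    finally have "a ^ (m + m') * (g + g') = f * (a ^ m' * q + a ^ m * q') + (a ^ m' * r + a ^ m * r')" .
    moreover have "\<rho> (a ^ m' * r + a ^ m * r') = emb (a ^ m' * r + a ^ m * r')"
      by (simp add: \<rho>h rhomD(3,4) rhom_power \<rho>(1,3) *)
    ultimately show ?case by blast
  next
    case (mult g g')
    then obtain m q r m' q' r' where *: "a ^ m * g = f * q + r" "\<rho> r = emb r" "a ^ m' * g' = f * q' + r'" "\<rho> r' = emb r'"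
      by blast
    have "a ^ (m + m') * (g * g') = (a ^ m * g) * (a ^ m' * g')"
      by (simp add: power_add algebra_simps)
    also have "\<dots> = f * (q * (f * q' + r') + r * q') + r * r'"
      unfolding * by (simp add: algebra_simps)
    finally have "a ^ (m + m') * (g * g') = f * (q * (f * q' + r') + r * q') + r * r'" .
    moreover have "\<rho> (r * r') = emb (r * r')"
      by (simp add: \<rho>h rhomD(4) *)
    ultimately show ?case by blast
  qed
  \<comment> \<open>If \<open>\<rho>\<close> kills \<open>g\<close>, then \<open>emb\<close> kills
    the remainder, which is therefore 0; the power of \<open>a\<close> cancels because
    \<open>a\<close> is 1 or a prime not dividing \<open>f\<close>.\<close>
  have dvd: "f dvd g" if "\<rho> g = 0" for g
  proof -
    obtain m q r where *: "a ^ m * g = f * q + r" "\<rho> r = emb r" using red by blast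
    from arg_cong[OF *(1), of \<rho>] have "emb r = 0" using that \<rho>(2) *(2) by (simp add: \<rho>h)
    then have "f dvd a ^ m * g" using *(1) by simp
    then show ?thesis using a dvd_cancel_prime_power by auto
  qed
  show ?thesis
  proof (rule prime_elemI)
    show "\<not> f dvd 1" using rhom_dvd[OF \<rho>(1), of f 1] \<rho>(2) \<rho>h(2) by auto
  next
    fix g h assume "f dvd g * h"
    then have "\<rho> g * \<rho> h = 0" using rhom_dvd[OF \<rho>(1)] \<rho>(2) \<rho>h(4) by (metis dvd_0_left_iff)
    then show "f dvd g \<or> f dvd h" using dvd by auto
  qed (use f in simp)
qed

text \<open>That \<open>b\<close> is free of \<open>A_i\<close> is expressed by an evaluation that
  does not depend on the value \<open>t\<close> given to \<open>A_i\<close>.\<close>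

lemma prime_elem_linear_A:
  fixes f a b :: "'n::{finite,linorder} mpol"
  assumes f: "f = mpol_A i * a + b"
    and a: "a = 1 \<or> (\<exists>j. a = mpol_var j) \<and> \<not> a dvd f"
    and b: "\<And>t. EV (amb_A(i := t)) amb_var b = emb b"
  shows "prime_elem f"
proof -
  have a0: "a \<noteq> 0" and a': "EV (amb_A(i := t)) amb_var a = emb a" for t
    using a by (auto simp: rhoms)
  have ev: "EV (amb_A(i := t)) amb_var f = t * emb a + emb b" for t
    by (simp add: f rhomD(3,4) a' b)
  have "f \<noteq> 0"
  proof
    assume "f = 0"
    then have "t * emb a + emb b = 0" for t using ev[of t] by (simp add: rhoms)
    from this[of 0] this[of 1] show False using a0 by simp
  qed
  moreover have "inj (mpol_A :: 'n \<Rightarrow> _)"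
  proof (rule injI)
    fix i j :: 'n assume "mpol_A i = mpol_A j"
    from arg_cong[OF this, of "EV (\<lambda>k. if k = i then 1 else 0 :: int) (\<lambda>_. 0)"] show "i = j"
      by (simp split: if_splits)
  qed
  ultimately show ?thesis
    \<comment> \<open>\<open>A_i\<close> is sent to the root \<open>- b / a\<close> of
      \<open>f\<close>.\<close>
    using a a0 ev[of "- emb b / emb a"]
    by (intro prime_elem_linear[where \<rho> = "EV (amb_A(i := - emb b / emb a)) amb_var" and v = "mpol_A i" and a = a and b = b])
      (auto simp: f a' b prime_elem_var inj_eq)
qed

lemma mpol_var_eq_iff [simp]: "mpol_var i = mpol_var j \<longleftrightarrow> i = (j :: 'n::{finite,linorder})"
proof
  assume "mpol_var i = mpol_var j"
  from arg_cong[OF this, of "EV (\<lambda>_. 0) (\<lambda>k. if k = i then 1 else 0 :: int)"] show "i = j"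
    by (simp split: if_splits)
qed simp

lemma prime_elem_linear_X:
  fixes f a b :: "'n::{finite,linorder} mpol"
  assumes f: "f = mpol_var i * a + b"
    and a: "a = 1 \<or> (\<exists>j. j \<noteq> i \<and> a = mpol_var j) \<and> \<not> a dvd f"
    and b: "\<And>t. EV amb_A (amb_var(i := t)) b = emb b"
  shows "prime_elem f"
proof -
  have a0: "a \<noteq> 0" and a': "EV amb_A (amb_var(i := t)) a = emb a" for t
    using a by (auto simp: rhoms)
  have ev: "EV amb_A (amb_var(i := t)) f = t * emb a + emb b" for t
    by (simp add: f rhomD(3,4) a' b)
  have "f \<noteq> 0"
  proof
    assume "f = 0"
    then have "t * emb a + emb b = 0" for t using ev[of t] by (simp add: rhoms)
    from this[of 0] this[of 1] show False using a0 by simp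
  qed
  then show ?thesis
    using a a0 ev[of "- emb b / emb a"]
    by (intro prime_elem_linear[where \<rho> = "EV amb_A (amb_var(i := - emb b / emb a))" and v = "mpol_var i" and a = a and b = b])
      (auto simp: f a' b prime_elem_var)
qed

text \<open>Replacing \<open>X_l\<close> by \<open>W / t\<close> creates only powers of
  \<open>t\<close> as denominators, and \<open>W\<close>, being free of \<open>X_l\<close>, has the
  same value whatever is put for \<open>X_l\<close>. The same \<open>c\<close> and \<open>g'\<close>
  serve for all \<open>t\<close>.\<close>

lemma var_clear_denominators:
  fixes W g :: "'n::{finite,linorder} mpol"
  assumes W: "\<not> involves W l"
  shows "\<exists>c g'. \<forall>t. t \<noteq> 0 \<longrightarrow> EV amb_A (amb_var(l := t)) g' = t ^ c * EV amb_A (amb_var(l := emb W / t)) g"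
proof (induction g rule: mpol_induct)
  case (of_int n)
  show ?case by (rule exI[of _ 0], rule exI[of _ "of_int n"]) (simp add: rhom_of_int)
next
  case (A i)
  show ?case by (rule exI[of _ 0], rule exI[of _ "mpol_A i"]) simp
next
  case (X i)
  have "EV amb_A (amb_var(l := t)) W = emb W" for t
    using EV_not_involves[OF W] by (simp add: emb_def)
  then have "\<forall>t. t \<noteq> 0 \<longrightarrow> EV amb_A (amb_var(l := t)) (if i = l then W else mpol_var i) =
      t ^ (if i = l then 1 else 0) * EV amb_A (amb_var(l := emb W / t)) (mpol_var i)"
    by simp
  then show ?case by blast
next
  case (add p q)
  then obtain c p' d q' where
    "\<And>t. t \<noteq> 0 \<Longrightarrow> EV amb_A (amb_var(l := t)) p' = t ^ c * EV amb_A (amb_var(l := emb W / t)) p"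
    "\<And>t. t \<noteq> 0 \<Longrightarrow> EV amb_A (amb_var(l := t)) q' = t ^ d * EV amb_A (amb_var(l := emb W / t)) q"
    by blast
  then have "\<forall>t. t \<noteq> 0 \<longrightarrow> EV amb_A (amb_var(l := t)) (mpol_var l ^ d * p' + mpol_var l ^ c * q') = t ^ (c + d) * EV amb_A (amb_var(l := emb W / t)) (p + q)"
    by (auto simp: rhomD(3,4) rhom_power power_add algebra_simps)
  then show ?case by blast
next
  case (mult p q)
  then obtain c p' d q' where
    "\<And>t. t \<noteq> 0 \<Longrightarrow> EV amb_A (amb_var(l := t)) p' = t ^ c * EV amb_A (amb_var(l := emb W / t)) p"
    "\<And>t. t \<noteq> 0 \<Longrightarrow> EV amb_A (amb_var(l := t)) q' = t ^ d * EV amb_A (amb_var(l := emb W / t)) q"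
    by blast
  then have "\<forall>t. t \<noteq> 0 \<longrightarrow> EV amb_A (amb_var(l := t)) (p' * q') = t ^ (c + d) * EV amb_A (amb_var(l := emb W / t)) (p * q)"
    by (auto simp: rhomD(3,4) power_add algebra_simps)
  then show ?case by blast
qed

text \<open>The substitution of \<open>W / X_l\<close> for \<open>X_l\<close> is an involution once
  \<open>X_l\<close> and \<open>W\<close> are invertible, and it takes \<open>f\<close> to
  \<open>f'\<close> up to a power of \<open>X_l\<close>. Divisibility is moved across it in both
  directions; powers of \<open>X_l\<close> and \<open>W\<close> cancel because neither of these
  primes divides \<open>f'\<close>, and because \<open>f\<close> divides no power of
  \<open>X_l\<close>.\<close>

lemma prime_elem_transfer:
  fixes f f' W :: "'n::{finite,linorder} mpol"
  assumes W: "\<not> involves W l" "prime_elem W" "\<not> W dvd f'"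
    and f: "prime_elem f" "\<And>j. \<not> mpol_var j dvd f" and f': "\<not> mpol_var l dvd f'"
    and e: "\<And>t. t \<noteq> 0 \<Longrightarrow> EV amb_A (amb_var(l := t)) f' = t ^ m * EV amb_A (amb_var(l := emb W / t)) f"
  shows "prime_elem f'"
proof -
  define \<psi> where "\<psi> = EV amb_A (amb_var(l := emb W / amb_var l))"
  let ?x = "amb_var l" and ?W = "emb W"
  have W0: "?W \<noteq> 0" using W(2) by auto
  have h: "rhom \<psi>" by (simp add: \<psi>_def)
  have emb': "EV amb_A (amb_var(l := amb_var l)) g = emb g" for g by (simp add: emb_def)
  have clear: "\<exists>c g'. emb g' = ?x ^ c * \<psi> g \<and> \<psi> g' = (?W / ?x) ^ c * emb g" for g
  proof -
    obtain c g' where *: "\<And>t. t \<noteq> 0 \<Longrightarrow> EV amb_A (amb_var(l := t)) g' = t ^ c * EV amb_A (amb_var(l := emb W / t)) g"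
      \<comment> \<open>The two evaluations wanted are \<open>t = X_l\<close> and
        \<open>t = W / X_l\<close>; the involution exchanges them.\<close>
      using var_clear_denominators[OF W(1)] by blast
    show ?thesis using *[of ?x] *[of "?W / ?x"] W0 emb' by (auto simp: \<psi>_def)
  qed
  have ef: "emb f' = ?x ^ m * \<psi> f" "\<psi> f' = (?W / ?x) ^ m * emb f"
    using e[of ?x] e[of "?W / ?x"] W0 emb' by (auto simp: \<psi>_def)
  have fx: "\<not> f dvd mpol_var l ^ n" for n
  proof
    assume "f dvd mpol_var l ^ n"
    then have "f dvd all_vars ^ n"
      by (rule dvd_trans) (auto simp: all_vars_def intro!: dvd_power_same dvd_prodI)
    then show False using prime_not_dvd_all_vars[OF f] by blast
  qed
  have bwd: "f' dvd g" if g': "emb g' = ?x ^ c * \<psi> g" "\<psi> g' = (?W / ?x) ^ c * emb g" and "f dvd g'" for g g' c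
  proof -
    obtain u where u: "g' = f * u" using \<open>f dvd g'\<close> by (auto simp: dvd_def)
    obtain k u' where u': "emb u' = ?x ^ k * \<psi> u" using clear by blast
    have "(?W / ?x) ^ c * emb g = \<psi> f * \<psi> u" using g'(2) by (simp add: u rhomD(4)[OF h])
    then have "?x ^ (m + k) * (?W ^ c * emb g) = ?x ^ c * (emb f' * emb u')"
      unfolding u' ef(1) by (simp add: power_divide power_add field_simps)
    then have "emb (mpol_var l ^ (m + k) * (W ^ c * g)) = emb (mpol_var l ^ c * (f' * u'))"
      by (simp add: rhomD(4) rhom_power)
    then have "mpol_var l ^ (m + k) * (W ^ c * g) = f' * (mpol_var l ^ c * u')"
      unfolding emb_eq_iff by (simp add: mult.left_commute)
    then have "f' dvd mpol_var l ^ (m + k) * (W ^ c * g)" by simp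
    then show ?thesis
      using dvd_cancel_prime_power[OF prime_elem_var f'] dvd_cancel_prime_power[OF W(2,3)] by blast
  qed
  have fwd: "\<exists>n. f dvd mpol_var l ^ n * (g' * h')"
    if fgh: "f' dvd g * h" and gh: "emb g' = ?x ^ c * \<psi> g" "emb h' = ?x ^ d * \<psi> h" for g h g' h' c d
  proof -
    obtain q where q: "g * h = f' * q" using fgh by (auto simp: dvd_def)
    obtain k q' where q': "emb q' = ?x ^ k * \<psi> q" using clear by blast
    have "\<psi> g * \<psi> h = (?W / ?x) ^ m * emb f * \<psi> q"
      using arg_cong[OF q, of \<psi>] by (simp add: rhomD(4)[OF h] ef)
    then have "?x ^ (m + k) * (emb g' * emb h') = ?x ^ (c + d) * (?W ^ m * (emb f * emb q'))"
      unfolding gh q' by (simp add: power_divide power_add field_simps)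
    then have "emb (mpol_var l ^ (m + k) * (g' * h')) = emb (mpol_var l ^ (c + d) * (W ^ m * (f * q')))"
      by (simp add: rhomD(4) rhom_power)
    then have "mpol_var l ^ (m + k) * (g' * h') = f * (mpol_var l ^ (c + d) * (W ^ m * q'))"
      unfolding emb_eq_iff by (simp add: mult.left_commute)
    then show ?thesis by (metis dvd_triv_left)
  qed
  show ?thesis
  proof (rule prime_elemI)
    show "f' \<noteq> 0" using W(3) by auto
    show "\<not> f' dvd 1"
    proof
      assume "f' dvd 1"
      then have "\<exists>n. f dvd mpol_var l ^ n * (1 * 1)"
        by (intro fwd[of 1 1 1 0 1 0]) (auto simp: rhomD(2)[OF h] rhomD(2)[OF rhom_emb])
      then show False using fx by auto
    qed
    fix g h assume gh: "f' dvd g * h"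
    obtain c g' d h' where *: "emb g' = ?x ^ c * \<psi> g" "\<psi> g' = (?W / ?x) ^ c * emb g"
       "emb h' = ?x ^ d * \<psi> h" "\<psi> h' = (?W / ?x) ^ d * emb h"
      using clear by metis
    then obtain n where "f dvd mpol_var l ^ n * (g' * h')" using fwd[OF gh] by blast
    then have "f dvd g' \<or> f dvd h'" using fx prime_elem_dvd_multD[OF f(1)] by blast
    then show "f' dvd g \<or> f' dvd h" using bwd * by blast
  qed
qed

section \<open>The seed generated by a sequence\<close>

definition Fp :: "'n::{finite,linorder} list \<Rightarrow> 'n \<Rightarrow> 'n mpol" where
  "Fp s i = FF mpol_A mpol_var s i"

lemma EV_Fp [simp]: "EV y x (Fp s i) = FF y x s i"
  by (simp add: Fp_def rhom_FF)

lemma emb_Fp: "emb (Fp s i) = FF amb_A amb_var s i"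
  by (simp add: emb_def)

lemma lastz_upd [simp]: "pre = [] \<or> last pre \<noteq> l \<Longrightarrow> lastz (x(l := t)) d pre = lastz x d pre"
  by (auto simp: lastz_def)

lemma lastz_upd' [simp]: "l \<notin> set pre \<Longrightarrow> lastz (x(l := t)) d pre = lastz x d pre"
  using last_in_set[of pre] by (auto simp: lastz_def)

lemma MM_upd [simp]: "l \<notin> set t \<Longrightarrow> MM (x(l := u)) t = MM x t"
  by (rule MM_cong) auto

lemma NN_upd [simp]: "l \<notin> set t \<Longrightarrow> NN A (x(l := u)) P z B t = NN A x P z B t"
  by (rule NN_cong) auto

lemma prod_upd [simp]: "l \<notin> S \<Longrightarrow> prod (x(l := u)) S = prod x S"
  by (intro prod.cong) auto

lemma BB_upd [simp]: "l \<notin> set t \<Longrightarrow> BB (A(l := u)) t = BB A t"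
  unfolding BB_def by (intro arg_cong[where f = prod_list] map_cong) auto

lemma BB_const_1 [simp]: "BB (\<lambda>_. 1) t = 1"
  by (induction t) auto

lemma FF_self: "distinct s \<Longrightarrow> FF A (x(i := t)) s i = FF A x s i"
proof (cases i s rule: index_cases)
  case (inner pre b post)
  then show "distinct s \<Longrightarrow> ?thesis" using last_in_set[of pre] by (auto simp: FF_inner)
next
  case notin
  then show ?thesis using last_in_set[of s] by (auto simp: FF_notin)
next
  case (last pre)
  then show ?thesis using last_in_set[of pre] by (auto simp: FF_last)
qed

lemma not_involves_self: "distinct s \<Longrightarrow> \<not> involves (Fp s i) i"
proof -
  assume "distinct s"
  then have "sub0 i (Fp s i) = Fp s i"
    by (simp add: sub0_def FF_self) (simp add: Fp_def)
  then show ?thesis by (simp add: not_involves_iff)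
qed

section \<open>Positivity and monotonicity of the closed forms\<close>

lemma MM_nonneg: "(\<And>i. 0 \<le> x i) \<Longrightarrow> 0 \<le> (MM x t :: 'r::linordered_idom)"
  by (induction t) auto

lemma NN_pos:
  fixes x :: "'n \<Rightarrow> 'r::linordered_idom"
  assumes "\<And>i. 0 < A i" "\<And>i. 0 \<le> x i"
  shows "0 < P \<Longrightarrow> 0 \<le> z \<Longrightarrow> 0 < B \<Longrightarrow> 0 < NN A x P z B t"
proof (induction t arbitrary: z B)
  case (Cons c t)
  have "0 < NN A x P (x c) (B * A c) t" using Cons.prems assms by (intro Cons.IH) auto
  moreover have "0 \<le> A c * z * MM x t"
    using Cons.prems assms(1)[of c] assms(2) by (intro mult_nonneg_nonneg MM_nonneg) auto
  ultimately show ?case using Cons.prems by (auto intro!: mult_pos_pos add_nonneg_pos)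
qed simp

lemma MM_mono:
  fixes x :: "'n \<Rightarrow> 'r::linordered_idom"
  assumes "\<And>i. 0 \<le> x i" "\<And>i. x i \<le> x' i"
  shows "MM x t \<le> MM x' t"
proof (induction t)
  case (Cons c t)
  then show ?case using assms MM_nonneg[OF assms(1)] order_trans[OF assms(1) assms(2)]
    by (auto intro!: mult_mono power_mono)
qed simp

lemma NN_nonneg:
  fixes x :: "'n \<Rightarrow> 'r::linordered_idom"
  assumes "\<And>i. 0 \<le> A i" "\<And>i. 0 \<le> x i"
  shows "0 \<le> P \<Longrightarrow> 0 \<le> z \<Longrightarrow> 0 \<le> B \<Longrightarrow> 0 \<le> NN A x P z B t"
  by (induction t arbitrary: z B) (auto intro!: mult_nonneg_nonneg add_nonneg_nonneg MM_nonneg simp: assms)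

lemma NN_mono:
  fixes x :: "'n \<Rightarrow> 'r::linordered_idom"
  assumes A: "\<And>i. 0 \<le> A i" and x: "\<And>i. 0 \<le> x i" "\<And>i. x i \<le> x' i" and P: "0 \<le> P" "P \<le> P'"
  shows "0 \<le> z \<Longrightarrow> z \<le> z' \<Longrightarrow> 0 \<le> B \<Longrightarrow> NN A x P z B t \<le> NN A x' P' z' B t"
proof (induction t arbitrary: z z' B)
  case (Cons c t)
  have x': "0 \<le> x' i" for i using x(1)[of i] x(2)[of i] by simp
  define n n' where "n = NN A x P (x c) (B * A c) t" and "n' = NN A x' P' (x' c) (B * A c) t"
  have n: "n \<le> n'" unfolding n_def n'_def using Cons.prems A[of c] x by (intro Cons.IH) auto
  have n0: "0 \<le> n" unfolding n_def using Cons.prems A x P by (intro NN_nonneg) auto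
  have m: "MM x t \<le> MM x' t" by (rule MM_mono) (use x in auto)
  have m0: "0 \<le> MM x t" by (rule MM_nonneg) (use x in auto)
  have "A c * z * MM x t \<le> A c * z' * MM x' t"
    using Cons.prems A[of c] m m0 by (intro mult_mono) auto
  moreover have "B * n \<le> B * n'" using n Cons.prems by (intro mult_left_mono) auto
  moreover have "0 \<le> A c * z * MM x t + B * n" using Cons.prems A[of c] m0 n0 by auto
  ultimately have "(A c * z * MM x t + B * n) * n \<le> (A c * z' * MM x' t + B * n') * n'"
    using n n0 by (intro mult_mono) auto
  then show ?case by (simp add: n_def n'_def)
qed (use P in simp)

lemma MM_one [simp]: "MM (\<lambda>_. 1) t = 1"
  by (induction t) auto

lemma MM_upd0: "l \<in> set t \<Longrightarrow> MM (x(l := 0)) t = 0"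
  by (induction t) auto

lemma lastz_one [simp]: "lastz (\<lambda>_. 1) 1 t = 1"
  by (simp add: lastz_def)

lemma lastz_nonneg: "(\<And>i. 0 \<le> x i) \<Longrightarrow> 0 \<le> lastz x (1 :: 'r::linordered_idom) t"
  by (simp add: lastz_def)

lemma lastz_delta: "lastz ((\<lambda>_. 1)(l := 0)) (1 :: 'r::linordered_idom) t = (if t \<noteq> [] \<and> last t = l then 0 else 1)"
  by (auto simp: lastz_def)

text \<open>The value with \<open>X_l = 0\<close> and everything else 1 is nonzero. At an inner
  index with \<open>l\<close> in the sequence the second summand is positive; with \<open>l\<close>
  outside it the second summand vanishes, but the first one is 1.\<close>

lemma not_var_dvd_Fp:
  fixes s :: "'n::{finite,linorder} list"
  assumes "distinct s" shows "\<not> mpol_var l dvd Fp s i"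
proof (rule not_var_dvdI[where y = "\<lambda>_. 1 :: int" and x = "(\<lambda>_. 1)(l := 0)"])
  let ?x = "(\<lambda>_. 1)(l := 0) :: 'n \<Rightarrow> int"
  have x: "0 \<le> ?x i" for i by simp
  show "EV (\<lambda>_. 1) ?x (Fp s i) \<noteq> 0"
  proof (cases i s rule: index_cases)
    case notin
    then show ?thesis using last_in_set[of s] by (auto simp: FF_notin lastz_delta)
  next
    case (last pre)
    then show ?thesis using last_in_set[of pre] by (auto simp: FF_last lastz_delta)
  next
    case (inner pre b post)
    show ?thesis
    proof (cases "l \<in> set s")
      case True
      then have P: "prod ?x (- set s) = 1" by simp
      have "0 < NN (\<lambda>_. 1) ?x 1 (?x b) 1 post" by (rule NN_pos) auto
      moreover have "0 \<le> lastz ?x 1 pre * ?x b * (MM ?x post)\<^sup>2"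
        by (intro mult_nonneg_nonneg lastz_nonneg) auto
      ultimately show ?thesis
        using P inner by (simp add: FF_inner del: fun_upd_apply)
          (metis add_nonneg_pos order_less_irrefl zero_less_power)
    next
      case False
      then show ?thesis using inner last_in_set[of pre] by (auto simp: FF_inner NN_zero lastz_delta)
    qed
  qed
qed simp

text \<open>With all values 1 both summands are 1, and setting \<open>X_l\<close> to 0 removes
  exactly one of them.\<close>

lemma involves_Fp_linear:
  fixes pre :: "'n::{finite,linorder} list"
  assumes "distinct (pre @ [i])" "s = pre \<or> s = pre @ [i]"
    "pre \<noteq> [] \<and> last pre = l \<or> l \<notin> set pre \<and> l \<noteq> i"
  shows "involves (Fp s i) l"
proof (rule involvesI[where y = "\<lambda>_. 1 :: int" and x = "\<lambda>_. 1" and t = 0])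
  show "EV (\<lambda>_. 1) ((\<lambda>_. 1)(l := 0)) (Fp s i) \<noteq> EV (\<lambda>_. 1 :: int) (\<lambda>_. 1) (Fp s i)"
    using assms last_in_set[of pre] by (auto simp: FF_notin FF_last lastz_delta split: if_splits)
qed

text \<open>Setting \<open>X_l\<close> from 1 to 0 strictly lowers the value. If \<open>l\<close>
  occurs in the sequence, the first summand drops from 1 to 0 and the second cannot grow; otherwise
  the second, positive summand disappears.\<close>

lemma involves_Fp_inner:
  fixes pre :: "'n::{finite,linorder} list"
  assumes d: "distinct (pre @ i # b # post)"
    and l: "pre \<noteq> [] \<and> last pre = l \<or> l \<notin> set pre \<and> l \<noteq> i"
  shows "involves (Fp (pre @ i # b # post) i) l"
proof (rule involvesI[where y = "\<lambda>_. 1 :: int" and x = "\<lambda>_. 1" and t = 0])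
  let ?x = "(\<lambda>_. 1)(l := 0) :: 'n \<Rightarrow> int" and ?s = "pre @ i # b # post"
  have 1: "FF (\<lambda>_. 1) (\<lambda>_. 1) ?s i = 1 + (NN (\<lambda>_. 1) (\<lambda>_. 1) 1 1 1 post)\<^sup>2"
    using d by (simp add: FF_inner)
  have n: "0 < NN (\<lambda>_. 1) (\<lambda>_. 1) 1 1 (1::int) post" by (rule NN_pos) auto
  have "FF (\<lambda>_. 1) ?x ?s i < FF (\<lambda>_. 1) (\<lambda>_. 1) ?s i"
  proof (cases "l \<in> set ?s")
    case True
    have Z: "lastz ?x 1 pre * ?x b * (MM ?x post)\<^sup>2 = 0"
      using True l d by (auto simp: lastz_delta MM_upd0)
    moreover have "(NN (\<lambda>_. 1) ?x 1 (?x b) 1 post)\<^sup>2 \<le> (NN (\<lambda>_. 1) (\<lambda>_. 1) 1 1 1 post)\<^sup>2"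
      by (intro power_mono NN_mono NN_nonneg) auto
    moreover have "FF (\<lambda>_. 1) ?x ?s i = (NN (\<lambda>_. 1) ?x 1 (?x b) 1 post)\<^sup>2"
    proof -
      have P: "prod ?x (- set ?s) = 1" using True by simp
      have i: "i \<notin> set pre" using d by simp
      show ?thesis unfolding FF_inner[OF i] P Z by simp
    qed
    ultimately show ?thesis unfolding 1 by linarith
  next
    case False
    then show ?thesis unfolding 1 using d n last_in_set[of pre] by (auto simp: FF_inner NN_zero lastz_delta)
  qed
  then show "EV (\<lambda>_. 1) ?x (Fp ?s i) \<noteq> EV (\<lambda>_. 1) (\<lambda>_. 1) (Fp ?s i)" by simp
qed

lemma prime_Fp_linear:
  fixes pre :: "'n::{finite,linorder} list"
  assumes d: "distinct (pre @ [i])" and s: "s = pre \<or> s = pre @ [i]"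
  shows "prime_elem (Fp s i)"
proof (rule prime_elem_linear_A)
  show "Fp s i = mpol_A i * lastz mpol_var 1 pre + BB mpol_A pre * (\<Prod>j\<in>- insert i (set pre). mpol_var j)"
    using s d by (auto simp: Fp_def FF_notin FF_last)
  have "distinct s" using s d by auto
  then show "lastz mpol_var 1 pre = 1 \<or> (\<exists>j. lastz mpol_var 1 pre = mpol_var j) \<and> \<not> lastz mpol_var 1 pre dvd Fp s i"
    using not_var_dvd_Fp by (auto simp: lastz_def)
  show "EV (amb_A(i := t)) amb_var (BB mpol_A pre * (\<Prod>j\<in>- insert i (set pre). mpol_var j)) =
      emb (BB mpol_A pre * (\<Prod>j\<in>- insert i (set pre). mpol_var j))" for t
    using d by (simp add: emb_def rhomD(4) rhom_prod rhom_BB del: fun_upd_apply)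
qed

text \<open>Appending \<open>l\<close> changes hat \<open>F_i\<close> only through the product of
  the outside variables. This loses \<open>X_l\<close> and acquires the step of \<open>PP\<close> at
  \<open>l\<close>, which is the same as replacing \<open>X_l\<close> by
  \<open>F_l / X_l\<close>.\<close>

lemma HF_append:
  fixes A x :: "'n::finite \<Rightarrow> 'r::field"
  assumes d: "distinct (pre @ i # b # post)" and l: "l \<notin> set (pre @ i # b # post)"
  defines "s \<equiv> pre @ i # b # post"
  defines "x' \<equiv> x(l := FF A x s l / x l)"
  shows "HF A x' (\<lambda>i. inverse (x' i)) s i = HF A x (\<lambda>i. inverse (x i)) (s @ [l]) i"
proof -
  have U: "- set s = insert l (- set (s @ [l]))" using l by (auto simp: s_def)
  have "(\<Prod>j\<in>- set s. x' j) = FF A x s l / x l * (\<Prod>j\<in>- set (s @ [l]). x j)"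
    by (subst U, subst prod.insert) (auto simp: x'_def intro!: prod.cong)
  also have "FF A x s l = A l * lastz x (x b) post + BB A pre * A i * A b * BB A post * (\<Prod>j\<in>- set (s @ [l]). x j)"
    using l by (simp add: FF_notin s_def mult.assoc insert_commute)
  finally have P: "(\<Prod>j\<in>- set s. x' j) =
     PP A x (\<lambda>i. inverse (x i)) (\<Prod>j\<in>- set (s @ [l]). x j) (lastz x (x b) post) (BB A pre * A i * A b * BB A post) [l]"
    by (simp add: field_simps)
  have lz: "lastz x' 1 pre = lastz x 1 pre" "x' b = x b"
    unfolding x'_def using l last_in_set[of pre] by (auto simp: s_def)
  have "PP A x' (\<lambda>i. inverse (x' i)) (\<Prod>j\<in>- set s. x' j) (x' b) (BB A pre * A i * A b) post =
     PP A x (\<lambda>i. inverse (x i)) (\<Prod>j\<in>- set (s @ [l]). x j) (x b) (BB A pre * A i * A b) (post @ [l])"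
    unfolding PP_append P[symmetric] lz(2)
    by (rule PP_cong) (use l in \<open>auto simp: x'_def s_def\<close>)
  then show ?thesis
    using d by (simp add: HF_inner s_def lz del: set_append)
qed

text \<open>The exponent is that of \<open>x l\<close> in the square of
  \<open>MM x (post @ [l])\<close>, the factor by which \<open>F_i\<close> differs from hat
  \<open>F_i\<close>.\<close>

lemma FF_append:
  fixes A x :: "'n::finite \<Rightarrow> 'r::field"
  assumes d: "distinct (pre @ i # b # post)" and l: "l \<notin> set (pre @ i # b # post)" and nz: "\<And>j. x j \<noteq> 0"
  defines "s \<equiv> pre @ i # b # post"
  shows "FF A x (s @ [l]) i = x l ^ (2 * 2 ^ length post) * FF A (x(l := FF A x s l / x l)) s i"
proof -
  define x1 where "x1 = x(l := FF A x s l / x l)"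
  have i: "i \<notin> set pre" and x1: "\<And>c. c \<in> set post \<Longrightarrow> x1 c = x c"
    using d l by (auto simp: x1_def)
  have "FF A x (s @ [l]) i = HF A x (\<lambda>i. inverse (x i)) (s @ [l]) i * (MM x (post @ [l]))\<^sup>2"
    using FF_inner_HF[of i pre "post @ [l]" x "\<lambda>i. inverse (x i)" A b] i nz by (simp add: s_def)
  also have "HF A x (\<lambda>i. inverse (x i)) (s @ [l]) i = HF A x1 (\<lambda>i. inverse (x1 i)) s i"
    unfolding x1_def s_def by (rule HF_append[OF d l, symmetric])
  also have "(MM x (post @ [l]))\<^sup>2 = x l ^ (2 * 2 ^ length post) * (MM x1 post)\<^sup>2"
    using MM_cong[of post x1 x] x1
    by (simp add: MM_append power_mult_distrib power_mult[symmetric] mult.commute)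
  finally show ?thesis
    using FF_inner_HF[of i pre post x1 "\<lambda>i. inverse (x1 i)" A b] i nz x1
    unfolding x1_def[symmetric] by (simp add: s_def)
qed

text \<open>The hypothesis is the vanishing of the innermost bracket, the one at \<open>l\<close>;
  every outer step of \<open>NN\<close> multiplies by the inner value.\<close>

lemma NN_snoc_zero:
  "A l * lastz x z t + B * BB A t * P = 0 \<Longrightarrow> NN A x P z B (t @ [l]) = 0"
  by (induction t arbitrary: z B) (auto simp: mult.assoc)

text \<open>For empty \<open>post\<close> the polynomial is linear in \<open>X_b\<close>. Appending
  an entry \<open>l\<close> substitutes \<open>F_l / X_l\<close> for \<open>X_l\<close> by
  \<open>FF_append\<close>, and \<open>prime_elem_transfer\<close> applies with
  \<open>W = F_l\<close>.\<close>

lemma prime_Fp_inner: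
  fixes pre :: "'n::{finite,linorder} list"
  assumes "distinct (pre @ i # b # post)"
  shows "prime_elem (Fp (pre @ i # b # post) i)"
  using assms
proof (induction post rule: rev_induct)
  case Nil
  show ?case
  proof (rule prime_elem_linear_X)
    let ?B = "(BB mpol_A pre)\<^sup>2 * (\<Prod>j\<in>- set (pre @ [i, b]). mpol_var j)\<^sup>2"
    show "Fp (pre @ [i, b]) i = mpol_var b * lastz mpol_var 1 pre + ?B"
      using Nil by (simp add: Fp_def FF_inner)
    show "lastz mpol_var 1 pre = 1 \<or> (\<exists>j. j \<noteq> b \<and> lastz mpol_var 1 pre = mpol_var j) \<and> \<not> lastz mpol_var 1 pre dvd Fp (pre @ [i, b]) i"
      using not_var_dvd_Fp[OF Nil] Nil last_in_set[of pre] by (auto simp: lastz_def)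
    show "EV amb_A (amb_var(b := t)) ?B = emb ?B" for t
      by (simp add: emb_def rhomD(4) rhom_prod rhom_power rhom_BB del: fun_upd_apply)
  qed
next
  case (snoc l post)
  let ?s = "pre @ i # b # post"
  have d: "distinct ?s" and l: "l \<notin> set ?s" using snoc.prems by auto
  have s: "pre @ i # b # post @ [l] = ?s @ [l]" by simp
  have ds: "distinct (?s @ [l])" using d l by auto
  show ?case unfolding s
  proof (rule prime_elem_transfer[where W = "Fp ?s l" and f = "Fp ?s i" and l = l and m = "2 * 2 ^ length post"])
    show "\<not> involves (Fp ?s l) l" by (rule not_involves_self[OF d])
    show "prime_elem (Fp ?s l)" by (rule prime_Fp_linear[OF ds]) simp
    show "prime_elem (Fp ?s i)" by (rule snoc.IH[OF d])
    show "\<not> mpol_var j dvd Fp ?s i" for j by (rule not_var_dvd_Fp[OF d])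
    show "\<not> mpol_var l dvd Fp (?s @ [l]) i" by (rule not_var_dvd_Fp[OF ds])
    show "\<not> Fp ?s l dvd Fp (?s @ [l]) i"
    proof
      assume *: "Fp ?s l dvd Fp (?s @ [l]) i"
      \<comment> \<open>With \<open>A_l = - 1\<close> and all else 1, \<open>F_l\<close> becomes
        \<open>- 1 + 1\<close>. Then \<open>NN\<close> vanishes too, and only the summand 1 of
        \<open>F_i\<close> is left.\<close>
      let ?y = "(\<lambda>_. 1)(l := - 1) :: 'n \<Rightarrow> int" and ?x = "\<lambda>_. 1 :: int"
      have "FF ?y ?x ?s l = 0" using l by (auto simp: FF_notin)
      moreover have "FF ?y ?x (?s @ [l]) i = 1"
        using d l FF_inner[of i pre ?y ?x b "post @ [l]"] NN_snoc_zero[of ?y l ?x 1 post 1 1]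
        by (auto simp: lastz_def)
      ultimately show False using rhom_dvd[OF rhom_EV *, of ?y ?x] by simp
    qed
    show "EV amb_A (amb_var(l := t)) (Fp (?s @ [l]) i) =
        t ^ (2 * 2 ^ length post) * EV amb_A (amb_var(l := emb (Fp ?s l) / t)) (Fp ?s i)" if "t \<noteq> 0" for t
      using FF_append[OF d l, of "amb_var(l := t)" amb_A] that FF_self[OF d, of amb_A amb_var l t]
      by (auto simp: emb_Fp)
  qed
qed

lemma prime_Fp: "distinct s \<Longrightarrow> prime_elem (Fp s i)"
proof (cases i s rule: index_cases)
  case notin
  then show "distinct s \<Longrightarrow> ?thesis" using prime_Fp_linear[of s i s] by auto
next
  case (last pre)
  then show "distinct s \<Longrightarrow> ?thesis" using prime_Fp_linear[of pre i s] by auto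
next
  case (inner pre b post)
  then show "distinct s \<Longrightarrow> ?thesis" using prime_Fp_inner by auto
qed

section \<open>Clusters as transcendence bases\<close>

lemma frpol_clear_denominators:
  fixes q p :: "'n::{finite,linorder} frpol"
  shows "\<exists>c p'. \<forall>x. x l \<noteq> 0 \<longrightarrow> mpol_eval amb_scalar x p' = x l ^ c * mpol_eval amb_scalar (x(l := mpol_eval amb_scalar x q / x l)) p"
proof (induction p rule: poly_induct)
  case (const k)
  show ?case by (rule exI[of _ 0], rule exI[of _ "Poly_Mapping.single 0 k"]) (simp add: mpol_eval_single)
next
  case (var i)
  have "\<forall>x. x l \<noteq> 0 \<longrightarrow> mpol_eval amb_scalar x (if i = l then q else Poly_Mapping.single (Poly_Mapping.single i 1) 1) =
     x l ^ (if i = l then 1 else 0) * mpol_eval amb_scalar (x(l := mpol_eval amb_scalar x q / x l)) (Poly_Mapping.single (Poly_Mapping.single i 1) 1)"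
    by (auto simp: mpol_eval_single prod_power_single rhomD(2)[OF rhom_amb_scalar])
  then show ?case by blast
next
  case (add p r)
  then obtain c p' d r' where *:
    "\<And>x. x l \<noteq> 0 \<Longrightarrow> mpol_eval amb_scalar x p' = x l ^ c * mpol_eval amb_scalar (x(l := mpol_eval amb_scalar x q / x l)) p"
    "\<And>x. x l \<noteq> 0 \<Longrightarrow> mpol_eval amb_scalar x r' = x l ^ d * mpol_eval amb_scalar (x(l := mpol_eval amb_scalar x q / x l)) r"
    by blast
  let ?X = "Poly_Mapping.single (Poly_Mapping.single l 1) 1 :: 'n frpol"
  have X: "mpol_eval amb_scalar x ?X = x l" for x
    by (simp add: mpol_eval_single prod_power_single rhomD(2)[OF rhom_amb_scalar])
  have "\<forall>x. x l \<noteq> 0 \<longrightarrow> mpol_eval amb_scalar x (?X ^ d * p' + ?X ^ c * r') = x l ^ (c + d) * mpol_eval amb_scalar (x(l := mpol_eval amb_scalar x q / x l)) (p + r)"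
    by (simp only: rhomD(3,4)[OF rhom_mpol_eval[OF rhom_amb_scalar]] rhom_power[OF rhom_mpol_eval[OF rhom_amb_scalar]] X)
      (auto simp: * power_add algebra_simps)
  then show ?case by blast
next
  case (mult p r)
  then obtain c p' d r' where *:
    "\<And>x. x l \<noteq> 0 \<Longrightarrow> mpol_eval amb_scalar x p' = x l ^ c * mpol_eval amb_scalar (x(l := mpol_eval amb_scalar x q / x l)) p"
    "\<And>x. x l \<noteq> 0 \<Longrightarrow> mpol_eval amb_scalar x r' = x l ^ d * mpol_eval amb_scalar (x(l := mpol_eval amb_scalar x q / x l)) r"
    by blast
  have "\<forall>x. x l \<noteq> 0 \<longrightarrow> mpol_eval amb_scalar x (p' * r') = x l ^ (c + d) * mpol_eval amb_scalar (x(l := mpol_eval amb_scalar x q / x l)) (p * r)"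
    by (simp only: rhomD(4)[OF rhom_mpol_eval[OF rhom_amb_scalar]])
      (auto simp: * power_add algebra_simps)
  then show ?case by blast
qed

lemma frpol_eval_var: "mpol_eval amb_scalar x (Poly_Mapping.single (Poly_Mapping.single l 1) 1) = x l"
  by (simp add: mpol_eval_single prod_power_single rhomD(2)[OF rhom_amb_scalar])

lemma alg_independent_nonzero: "alg_independent x \<Longrightarrow> x l \<noteq> 0"
  using frpol_eval_var[of x l] by (auto simp: alg_independent_def simp flip: keys_eq_empty)

lemma alg_independent_eval: "alg_independent x \<Longrightarrow> EV amb_A x p = 0 \<longleftrightarrow> p = 0"
  unfolding mpol_eval_coeff_fract[symmetric] alg_independent_def
  by (metis coeff_fract_eq_0 rhomD(1) rhom_amb_scalar rhom_mpol_eval)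

text \<open>Exchanging \<open>x l\<close> twice gives back \<open>x\<close>, since \<open>W\<close>
  does not see the variable \<open>l\<close>. Both properties therefore pass from \<open>x\<close>
  to \<open>x'\<close> by clearing denominators in either direction.\<close>

lemma cluster_exchange:
  fixes W :: "'n::{finite,linorder} mpol"
  assumes x: "alg_independent x" "generates_ambient x" and W: "\<not> involves W l" "W \<noteq> 0"
  defines "x' \<equiv> x(l := EV amb_A x W / x l)"
  shows "alg_independent x'" "generates_ambient x'"
proof -
  let ?e = "mpol_eval amb_scalar"
  define q where "q = coeff_fract W"
  have q: "?e z q = EV amb_A z W" for z by (simp add: q_def mpol_eval_coeff_fract)
  have xl: "x l \<noteq> 0" by (rule alg_independent_nonzero[OF x(1)])
  have W0: "EV amb_A x W \<noteq> 0" using alg_independent_eval[OF x(1)] W(2) by simp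
  have xl': "x' l \<noteq> 0" using xl W0 by (simp add: x'_def)
  have qx': "?e x' q = EV amb_A x W" unfolding q x'_def by (rule EV_not_involves[OF W(1)])
  have inv: "x'(l := ?e x' q / x' l) = x" unfolding qx' using xl W0 by (auto simp: x'_def)
  have inv': "x(l := ?e x q / x l) = x'" unfolding q by (simp add: x'_def)
  have clear: "\<exists>c p'. ?e x p' = x l ^ c * ?e x' p \<and> ?e x' p' = x' l ^ c * ?e x p" for p
    using frpol_clear_denominators[of l q p] xl xl' inv inv' by metis
  show "alg_independent x'"
    unfolding alg_independent_def
  proof (intro allI impI)
    fix p assume "?e x' p = 0"
    then obtain c p' where "?e x p' = 0" and c: "?e x' p' = x' l ^ c * ?e x p"
      using clear[of p] by auto
    then have "p' = 0" using x(1) by (auto simp: alg_independent_def)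
    then have "?e x p = 0" using c xl' by (simp add: rhomD(1)[OF rhom_mpol_eval[OF rhom_amb_scalar]])
    then show "p = 0" using x(1) by (auto simp: alg_independent_def)
  qed
  show "generates_ambient x'"
    unfolding generates_ambient_def
  proof
    fix y
    obtain p d where pd: "?e x d \<noteq> 0" "y = ?e x p / ?e x d"
      using x(2) unfolding generates_ambient_def by blast
    obtain c p' where p': "?e x' p' = x' l ^ c * ?e x p" using clear by blast
    obtain c' d' where d': "?e x' d' = x' l ^ c' * ?e x d" using clear by blast
    let ?X = "Poly_Mapping.single (Poly_Mapping.single l 1) 1 :: 'n frpol"
    have "?e x' (?X ^ c * d') = x' l ^ c * (x' l ^ c' * ?e x d)"
      "?e x' (?X ^ c' * p') = x' l ^ c' * (x' l ^ c * ?e x p)"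
      by (simp_all only: rhomD(4)[OF rhom_mpol_eval[OF rhom_amb_scalar]] rhom_power[OF rhom_mpol_eval[OF rhom_amb_scalar]]
        frpol_eval_var p' d')
    then have "?e x' (?X ^ c * d') \<noteq> 0 \<and> y = ?e x' (?X ^ c' * p') / ?e x' (?X ^ c * d')"
      using pd xl' by (simp add: field_simps)
    then show "\<exists>p q. ?e x' q \<noteq> 0 \<and> y = ?e x' p / ?e x' q" by blast
  qed
qed

lemma amb_A_nonzero [simp]: "amb_A i \<noteq> 0"
proof -
  have "mpol_A i \<noteq> 0"
  proof
    assume "mpol_A i = 0"
    from arg_cong[OF this, of "EV (\<lambda>_. 1 :: int) (\<lambda>_. 0)"] show False by (simp add: rhomD(1))
  qed
  then show ?thesis by (simp flip: emb_A)
qed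

abbreviation clu :: "'n::{finite,linorder} list \<Rightarrow> 'n \<Rightarrow> 'n ambient" where
  "clu \<equiv> CL amb_A amb_var"

text \<open>The representative of the generated seed in which every sign left open by mutation is
  chosen positive.\<close>

definition can :: "'n::{finite,linorder} list \<Rightarrow> 'n seed" where
  "can s = \<lparr>cluster = clu s, exch = Fp s\<rparr>"

lemma alg_independent_amb_var: "alg_independent (amb_var :: 'n::{finite,linorder} \<Rightarrow> _)"
  by (simp add: alg_independent_def mpol_eval_amb_var)

lemma generates_ambient_amb_var: "generates_ambient (amb_var :: 'n::{finite,linorder} \<Rightarrow> _)"
  unfolding generates_ambient_def mpol_eval_amb_var
proof
  fix y :: "'n ambient"
  obtain a b where "y = Fract a b" "b \<noteq> 0" by (cases y)
  then show "\<exists>p q. to_fract q \<noteq> 0 \<and> y = to_fract p / to_fract q"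
    by (intro exI[of _ a] exI[of _ b]) (simp add: Fract_conv_to_fract)
qed

lemma clu_basis: "distinct s \<Longrightarrow> alg_independent (clu s) \<and> generates_ambient (clu s)"
proof (induction s rule: rev_induct)
  case Nil
  have "clu [] = (amb_var :: 'a \<Rightarrow> _)" by (simp add: fun_eq_iff CL_def)
  then show ?case using alg_independent_amb_var generates_ambient_amb_var by simp
next
  case (snoc l s)
  then have d: "distinct s" "l \<notin> set s" by auto
  have "EV amb_A (clu s) (Fp s l) = HF amb_A (clu s) (\<lambda>_. 0) s l"
    using d by (simp add: FF_notin HF_notin)
  also have "\<dots> = amb_var l * ZZ amb_A amb_var (insert l (set s))"
    using d by (intro HF_CL_linear) auto
  finally have "clu (s @ [l]) = (clu s)(l := EV amb_A (clu s) (Fp s l) / clu s l)"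
    using d by (auto simp: fun_eq_iff CL_def)
  moreover have "\<not> involves (Fp s l) l" "Fp s l \<noteq> 0"
    using not_involves_self[OF d(1)] prime_Fp[OF d(1), of l] by auto
  ultimately show ?case
    using cluster_exchange[of "clu s" "Fp s l" l] snoc.IH[OF d(1)] by metis
qed

text \<open>The library has this only for rings with a division operation.\<close>

lemma prime_elem_irreducible:
  fixes p :: "'a::idom"
  assumes "prime_elem p" shows "irreducible p"
proof (rule irreducibleI)
  show "p \<noteq> 0" using assms by auto
  show "\<not> p dvd 1" using assms by (rule prime_elem_not_unit)
  fix a b assume p: "p = a * b"
  have *: "b dvd 1" if ab: "p = a * b" and pa: "p dvd a" for a b
  proof -
    obtain c where "a = p * c" using pa by (auto simp: dvd_def)
    then have "p * (c * b) = p * 1" using ab by (metis mult.assoc mult_1_right)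
    then have "c * b = 1" using \<open>p \<noteq> 0\<close> by (simp only: mult_cancel_left) simp
    then show ?thesis by (metis dvd_triv_right)
  qed
  have "p dvd a \<or> p dvd b" using prime_elem_dvd_multD[OF assms, of a b] p by simp
  then show "a dvd 1 \<or> b dvd 1" using *[of a b] *[of b a] p by (auto simp: mult.commute)
qed

lemma is_seed_can:
  assumes d: "distinct s" shows "is_seed (can s)"
  using clu_basis[OF d] not_involves_self[OF d] not_var_dvd_Fp[OF d] prime_elem_irreducible[OF prime_Fp[OF d]]
  by (auto simp: is_seed_def can_def)

lemma clu_nonzero: "distinct s \<Longrightarrow> clu s i \<noteq> 0"
  using clu_basis alg_independent_nonzero by blast

lemma tau_can: "tau = can []"
  by (simp add: tau_def can_def fun_eq_iff CL_def Fp_def FF_def mpol_A_def Compl_eq_Diff_UNIV)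

section \<open>Removal of common factors\<close>

text \<open>\<open>strip_common\<close> fixes neither the factors nor their order. The shape of the
  total factor removed is what the uniqueness argument uses.\<close>

lemma strip_common_factor:
  assumes "strip_common i j Q G H"
  shows "\<exists>p :: 'n::{finite,linorder} mpol. \<not> involves p i \<and> \<not> involves p j \<and> G = mpol_to_laur p * H"
  using assms
proof induction
  case (strip_none G)
  have "\<not> involves (1 :: 'n mpol) k" for k by (simp add: not_involves_iff rhomD(2))
  then show ?case by (intro exI[of _ 1]) (simp add: rhomD(2))
next
  case (strip_step p G H)
  then obtain q where "\<not> involves q i" "\<not> involves q j" "G = mpol_to_laur q * H" by blast
  moreover have "\<not> involves p i" "\<not> involves p j" using strip_step(1) by (auto simp: common_factor_def)
  ultimately show ?case
    by (intro exI[of _ "p * q"]) (simp add: not_involves_iff rhomD(4) mult.assoc)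
qed

lemma strip_common_power:
  fixes p :: "'n::{finite,linorder} mpol"
  assumes p: "\<not> involves p i" "\<not> involves p j" "\<not> mpol_to_laur p dvd 1" "mpol_to_laur p dvd Q"
    and H: "\<And>q. \<not> common_factor i j Q H q"
  shows "strip_common i j Q (mpol_to_laur p ^ m * H) H"
proof (induction m)
  case 0
  show ?case using strip_none[OF H] by simp
next
  case (Suc m)
  show ?case unfolding power_Suc mult.assoc
    by (rule strip_step) (use Suc p in \<open>auto simp: common_factor_def\<close>)
qed

lemma laur_monom_cancel: "laur_monom (- e) * (laur_monom e * q) = q"
proof -
  have "laur_monom (- e) * laur_monom e = 1" by (simp flip: laur_monom_add)
  then show ?thesis by (simp flip: mult.assoc)
qed

lemma laur_monom_dvd_cancel: "p dvd laur_monom e * q \<longleftrightarrow> p dvd q"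
proof
  assume "p dvd laur_monom e * q"
  then have "p dvd laur_monom (- e) * (laur_monom e * q)" by simp
  then show "p dvd q" unfolding laur_monom_cancel .
qed simp

text \<open>Stripping \<open>p\<close> \<open>m\<close> times leaves a monomial times
  \<open>F\<close>. A further common factor \<open>q\<close> would divide the prime
  \<open>F\<close>; being free of \<open>X_l\<close> it is not a multiple of \<open>F\<close>, so it
  would be a unit.\<close>

lemma exchange_step_ex:
  fixes F p :: "'n::{finite,linorder} mpol"
  assumes F: "prime_elem F" "\<And>k. \<not> mpol_var k dvd F" "involves F l"
    and p: "\<not> involves p l" "\<not> involves p j" "p = 1 \<or> \<not> mpol_to_laur p dvd 1 \<and> mpol_to_laur p dvd Q"
    and e: "Poly_Mapping.lookup e j = 0" and G: "G = mpol_to_laur p ^ m * (laur_monom e * mpol_to_laur F)"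
  shows "\<exists>H e'. strip_common l j Q G H \<and> Poly_Mapping.lookup e' j = 0 \<and> mpol_to_laur F = laur_monom e' * H"
proof -
  let ?H = "laur_monom e * mpol_to_laur F"
  have H: "\<not> common_factor l j Q ?H q" for q
  proof
    assume "common_factor l j Q ?H q"
    then have q: "\<not> involves q l" "\<not> mpol_to_laur q dvd 1" "mpol_to_laur q dvd mpol_to_laur F"
      by (auto simp: common_factor_def laur_monom_dvd_cancel)
    then obtain L where L: "mpol_to_laur F = mpol_to_laur q * L" by (auto simp: dvd_def)
    have F0: "F \<noteq> 0" using F(1) by auto
    have "q \<noteq> 0" using L F0 by (auto simp: rhomD(1))
    then have "\<not> mpol_to_laur F dvd mpol_to_laur q"
      using not_dvd_not_involves[OF F(3) F(2) q(1)] by blast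
    then have "mpol_to_laur F dvd L"
      using mpol_to_laur_prime[OF F(1,2), of "mpol_to_laur q" L] L by auto
    then obtain k where "L = mpol_to_laur F * k" by (auto simp: dvd_def)
    with L have "mpol_to_laur F * 1 = mpol_to_laur F * (mpol_to_laur q * k)" by (simp add: mult.left_commute)
    then have "mpol_to_laur q * k = 1" using F0 by (simp only: mult_cancel_left) simp
    then show False using q(2) by (metis dvd_triv_left)
  qed
  have "strip_common l j Q G ?H"
  proof (cases "p = 1")
    case True
    then show ?thesis using strip_none[OF H] by (simp add: G rhomD(2))
  next
    case False
    then show ?thesis unfolding G using p H by (intro strip_common_power) auto
  qed
  moreover have "mpol_to_laur F = laur_monom (- e) * ?H"
    by (rule laur_monom_cancel[symmetric])
  ultimately show ?thesis using e by (metis lookup_uminus neg_equal_0_iff_equal)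
qed

text \<open>Any stripping result satisfies \<open>q * F' =\<close> a multiple of \<open>F\<close>,
  where \<open>q\<close> is free of \<open>X_l\<close>. Hence the prime \<open>F\<close> divides the
  irreducible \<open>F'\<close>, and the cofactor is a unit.\<close>

lemma exchange_step_unique:
  fixes F F' p :: "'n::{finite,linorder} mpol"
  assumes F: "prime_elem F" "\<And>k. \<not> mpol_var k dvd F" "involves F l"
    and p: "p \<noteq> 0" and G: "G = mpol_to_laur p ^ m * (laur_monom e * mpol_to_laur F)"
    and H: "strip_common l j Q G H" "mpol_to_laur F' = laur_monom e' * H"
    and F': "irreducible F'"
  shows "F' = F \<or> F' = - F"
proof -
  obtain q :: "'n mpol" where q: "\<not> involves q l" "G = mpol_to_laur q * H"
    using strip_common_factor[OF H(1)] by blast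
  have F0: "F \<noteq> 0" using F(1) by auto
  have m0: "laur_monom e \<noteq> (0 :: 'n laur)" by (simp add: laur_monom_def flip: keys_eq_empty)
  have "G \<noteq> 0" using p F0 m0 by (simp add: G)
  then have "q \<noteq> 0" using q by (auto simp: rhomD(1))
  then have nd: "\<not> mpol_to_laur F dvd mpol_to_laur q"
    by (rule not_dvd_not_involves[OF F(3) F(2) q(1)])
  have "mpol_to_laur q * mpol_to_laur F' = laur_monom e' * G"
    by (simp add: q(2) H(2) mult.left_commute)
  also have "\<dots> = mpol_to_laur F * (laur_monom e' * mpol_to_laur p ^ m * laur_monom e)"
    by (simp add: G algebra_simps)
  finally have "mpol_to_laur F dvd mpol_to_laur q * mpol_to_laur F'" by simp
  then have "mpol_to_laur F dvd mpol_to_laur F'"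
    using mpol_to_laur_prime[OF F(1,2)] nd by blast
  then have "F dvd F'" by (rule mpol_to_laur_dvdD[OF F(1,2)])
  then obtain c where c: "F' = F * c" by (auto simp: dvd_def)
  then have "F dvd 1 \<or> c dvd 1" using F' by (auto simp: irreducible_def)
  then have "c dvd 1" using prime_elem_not_unit[OF F(1)] by blast
  then obtain d where "c * d = 1" by (metis dvdE)
  then show ?thesis using unit_mpol[of c d] c by auto
qed

text \<open>Laurent monomials are viewed in the ambient field so that they can be written as
  quotients. The condition on \<open>j\<close> reflects that the normalising monomial of
  \<open>F_j\<close> omits the variable with index \<open>j\<close>.\<close>

definition is_mono :: "'n::{finite,linorder} \<Rightarrow> 'n ambient \<Rightarrow> bool" where
  "is_mono j u \<longleftrightarrow> (\<exists>e. Poly_Mapping.lookup e j = 0 \<and> u = lemb (laur_monom e))"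

lemma is_mono_1 [simp]: "is_mono j 1"
  unfolding is_mono_def by (intro exI[of _ 0]) (simp add: rhomD(2))

lemma is_mono_mult: "is_mono j u \<Longrightarrow> is_mono j v \<Longrightarrow> is_mono j (u * v)"
proof -
  assume "is_mono j u" "is_mono j v"
  then obtain e f where "Poly_Mapping.lookup e j = 0" "Poly_Mapping.lookup f j = 0" "u = lemb (laur_monom e)" "v = lemb (laur_monom f)"
    by (auto simp: is_mono_def)
  then show ?thesis unfolding is_mono_def
    by (intro exI[of _ "e + f"]) (simp add: laur_monom_add rhomD(4) lookup_add)
qed

lemma is_mono_inverse: "is_mono j u \<Longrightarrow> is_mono j (inverse u)"
proof -
  assume "is_mono j u"
  then obtain e where e: "Poly_Mapping.lookup e j = 0" "u = lemb (laur_monom e)" by (auto simp: is_mono_def)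
  have "lemb (laur_monom e) * lemb (laur_monom (- e)) = 1"
    using laur_monom_uminus[of e] by (simp add: rhomD(2) flip: rhomD(4)[OF rhom_lemb])
  then have "inverse u = lemb (laur_monom (- e))" unfolding e by (rule inverse_unique)
  then show ?thesis using e(1) unfolding is_mono_def by (intro exI[of _ "- e"]) simp
qed

lemma is_mono_divide: "is_mono j u \<Longrightarrow> is_mono j v \<Longrightarrow> is_mono j (u / v)"
  by (simp add: divide_inverse is_mono_mult is_mono_inverse)

lemma is_mono_power: "is_mono j u \<Longrightarrow> is_mono j (u ^ n)"
  by (induction n) (auto intro: is_mono_mult)

lemma is_mono_var: "i \<noteq> j \<Longrightarrow> is_mono j (amb_var i)"
  unfolding is_mono_def
  by (intro exI[of _ "Poly_Mapping.single i 1"]) (simp add: lookup_single flip: laur_var_def)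

lemma is_mono_prod: "(\<And>i. i \<in> S \<Longrightarrow> is_mono j (f i)) \<Longrightarrow> is_mono j (prod f S)"
  by (induction S rule: infinite_finite_induct) (auto intro: is_mono_mult)

lemma is_mono_MM: "j \<notin> set t \<Longrightarrow> is_mono j (MM amb_var t)"
  by (induction t) (auto intro!: is_mono_mult is_mono_power is_mono_var)

lemma is_mono_lastz: "t = [] \<or> last t \<noteq> j \<Longrightarrow> is_mono j (lastz amb_var 1 t)"
  by (auto simp: lastz_def intro: is_mono_var)

lemmas is_mono_intros = is_mono_1 is_mono_mult is_mono_inverse is_mono_divide is_mono_power is_mono_var
  is_mono_prod is_mono_MM is_mono_lastz

text \<open>Used for two sets: \<open>{0}\<close> says that \<open>X_j\<close> does not occur,
  \<open>{0..}\<close> that it has no negative exponent. Both are closed under addition, so the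
  closure rules are proved once in \<open>expo_monoid\<close>.\<close>

definition expo_in :: "int set \<Rightarrow> 'n \<Rightarrow> (('n \<Rightarrow>\<^sub>0 int) \<Rightarrow>\<^sub>0 'c::comm_ring_1) \<Rightarrow> bool" where
  "expo_in S j p \<longleftrightarrow> (\<forall>m\<in>Poly_Mapping.keys p. Poly_Mapping.lookup m j \<in> S)"

lemma expo_in_add: "expo_in S j p \<Longrightarrow> expo_in S j q \<Longrightarrow> expo_in S j (p + q)"
  using keys_add[of p q] unfolding expo_in_def by blast

lemma expo_in_mult:
  assumes "\<And>a b. a \<in> S \<Longrightarrow> b \<in> S \<Longrightarrow> a + b \<in> S" "expo_in S j p" "expo_in S j q"
  shows "expo_in S j (p * q)"
  unfolding expo_in_def
proof
  fix m assume "m \<in> Poly_Mapping.keys (p * q)"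
  then obtain a b where "m = a + b" "a \<in> Poly_Mapping.keys p" "b \<in> Poly_Mapping.keys q"
    using keys_mult[of p q] by blast
  then show "Poly_Mapping.lookup m j \<in> S" using assms by (simp add: lookup_add expo_in_def)
qed

lemma expo_in_single: "Poly_Mapping.lookup m j \<in> S \<Longrightarrow> expo_in S j (Poly_Mapping.single m c)"
  by (cases "c = 0") (auto simp: expo_in_def)

lemma expo_in_var: "(if i = j then 1 else 0) \<in> S \<Longrightarrow> expo_in S j (laur_var i)"
  unfolding laur_var_def laur_monom_def by (rule expo_in_single) (auto simp: lookup_single when_def)

lemma expo_in_inv: "(if i = j then - 1 else 0) \<in> S \<Longrightarrow> expo_in S j (laur_inv i)"
  unfolding laur_inv_def laur_monom_def by (rule expo_in_single) (auto simp: lookup_single when_def)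

lemma expo_in_A: "0 \<in> S \<Longrightarrow> expo_in S j (laur_A i)"
  unfolding laur_A_def laur_const_def by (rule expo_in_single) simp

lemma expo_in_1: "0 \<in> S \<Longrightarrow> expo_in S j 1"
  using expo_in_single[of 0 j S 1] by simp

locale expo_monoid =
  fixes S :: "int set"
  assumes zero: "0 \<in> S" and add: "a \<in> S \<Longrightarrow> b \<in> S \<Longrightarrow> a + b \<in> S"
begin

lemma expo_mult: "expo_in S j p \<Longrightarrow> expo_in S j q \<Longrightarrow> expo_in S j (p * q)"
  by (rule expo_in_mult) (auto intro: add)

lemma expo_power: "expo_in S j p \<Longrightarrow> expo_in S j (p ^ n)"
  by (induction n) (auto intro: expo_mult expo_in_1 zero)

lemma expo_prod: "(\<And>i. i \<in> T \<Longrightarrow> expo_in S j (f i)) \<Longrightarrow> expo_in S j (prod f T)"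
  by (induction T rule: infinite_finite_induct) (auto intro: expo_mult expo_in_1 zero)

lemma expo_BB: "expo_in S j (BB laur_A t)"
  by (induction t) (auto intro: expo_mult expo_in_1 zero expo_in_A)

lemma expo_var: "i \<noteq> j \<Longrightarrow> expo_in S j (laur_var i)"
  by (rule expo_in_var) (simp add: zero)

lemma expo_lastz: "t = [] \<or> last t \<noteq> j \<Longrightarrow> expo_in S j (lastz laur_var 1 t)"
  by (auto simp: lastz_def intro: expo_in_1 zero expo_var)

lemma expo_PP:
  "j \<notin> set t \<Longrightarrow> expo_in S j P \<Longrightarrow> expo_in S j z \<Longrightarrow> expo_in S j B \<Longrightarrow> expo_in S j (PP laur_A laur_var laur_inv P z B t)"
proof (induction t arbitrary: z B)
  case (Cons c t)
  have "expo_in S j (PP laur_A laur_var laur_inv P (laur_var c) (B * laur_A c) t)"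
    using Cons.prems by (intro Cons.IH expo_var expo_mult expo_in_A zero) auto
  then show ?case using Cons.prems
    by (auto intro!: expo_mult expo_in_add expo_in_A expo_in_inv zero)
qed simp

lemmas intros = expo_mult expo_power expo_prod expo_BB expo_var expo_lastz expo_PP expo_in_add expo_in_A[OF zero] expo_in_1[OF zero]

end

interpretation free: expo_monoid "{0}" by unfold_locales auto
interpretation nonneg: expo_monoid "{0..}" by unfold_locales auto

lemma lookup_laur_set_zero:
  "Poly_Mapping.lookup (laur_set_zero j P) m = (if Poly_Mapping.lookup m j = 0 then Poly_Mapping.lookup P m else 0)"
proof -
  let ?M = "{m \<in> Poly_Mapping.keys P. Poly_Mapping.lookup m j = 0}"
  have "Poly_Mapping.lookup (laur_set_zero j P) m = (\<Sum>k\<in>?M. if k = m then Poly_Mapping.lookup P m else 0)"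
    unfolding laur_set_zero_def lookup_sum
    by (intro sum.cong refl) (auto simp: lookup_single when_def)
  also have "\<dots> = (if m \<in> ?M then Poly_Mapping.lookup P m else 0)"
    by (subst sum.delta) auto
  finally show ?thesis by (simp add: in_keys_iff)
qed

lemma laur_set_zero_free: "expo_in {0} j P \<Longrightarrow> laur_set_zero j P = P"
proof (rule poly_mapping_eqI)
  fix m assume "expo_in {0} j P"
  then show "Poly_Mapping.lookup (laur_set_zero j P) m = Poly_Mapping.lookup P m"
    by (cases "m \<in> Poly_Mapping.keys P") (auto simp: lookup_laur_set_zero expo_in_def in_keys_iff)
qed

text \<open>To set \<open>X_j\<close> to 0 in hat \<open>F_i\<close> it suffices to split off a
  multiple of \<open>X_j\<close>; all computations of this kind below take this form.\<close>

lemma laur_set_zero_split: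
  assumes R: "expo_in {0} j R" and R': "expo_in {0..} j R'"
  shows "laur_set_zero j (R + laur_var j * R') = R"
proof (rule poly_mapping_eqI)
  fix m
  have "Poly_Mapping.lookup (laur_var j * R') m = 0" if "Poly_Mapping.lookup m j = 0"
  proof (rule ccontr)
    assume "Poly_Mapping.lookup (laur_var j * R') m \<noteq> 0"
    then have "m \<in> Poly_Mapping.keys (laur_var j * R')" by (simp add: in_keys_iff)
    then obtain b where "m = Poly_Mapping.single j 1 + b" "b \<in> Poly_Mapping.keys R'"
      using keys_mult[of "laur_var j" R'] by (auto simp: laur_var_def laur_monom_def)
    then show False using R' that by (auto simp: expo_in_def lookup_add)
  qed
  moreover have "Poly_Mapping.lookup R m = 0" if "Poly_Mapping.lookup m j \<noteq> 0"
    using R that by (auto simp: expo_in_def in_keys_iff)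
  ultimately show "Poly_Mapping.lookup (laur_set_zero j (R + laur_var j * R')) m = Poly_Mapping.lookup R m"
    by (auto simp: lookup_laur_set_zero lookup_add)
qed

section \<open>The Laurent polynomials \<open>\<hat>F\<^sub>i\<close>\<close>

definition Hl :: "'n::{finite,linorder} list \<Rightarrow> 'n \<Rightarrow> 'n laur" where
  "Hl s i = HF laur_A laur_var laur_inv s i"

lemma LV_inv [simp]: "(\<And>i. x i \<noteq> 0) \<Longrightarrow> LV y x (laur_inv i) = inverse (x i)"
proof -
  assume x: "\<And>i. x i \<noteq> 0"
  have "x i * LV y x (laur_inv i) = LV y x (laur_var i * laur_inv i)"
    by (simp only: rhomD(4)[OF rhom_LV[of x y, OF x]] LV_X)
  also have "\<dots> = 1" using rhomD(2)[OF rhom_LV[of x y, OF x]] by simp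
  finally show ?thesis by (simp add: inverse_unique)
qed

lemma LV_HF:
  assumes x: "\<And>i. x i \<noteq> 0"
  shows "LV y x (HF A v vi s i) = HF (\<lambda>i. LV y x (A i)) (\<lambda>i. LV y x (v i)) (\<lambda>i. LV y x (vi i)) s i"
  by (rule rhom_HF) (rule rhom_LV[of x y, OF x])

lemma LV_Hl: "(\<And>i. x i \<noteq> 0) \<Longrightarrow> LV y x (Hl s i) = HF y x (\<lambda>i. inverse (x i)) s i"
  unfolding Hl_def by (subst LV_HF) auto

lemma lemb_Hl: "lemb (Hl s i) = HF amb_A amb_var (\<lambda>i. inverse (amb_var i)) s i"
  unfolding lemb_def by (rule LV_Hl) simp

lemma MM_laur_inv:
  "\<exists>a. MM laur_inv t = laur_monom a \<and> (\<forall>j. Poly_Mapping.lookup a j \<le> 0) \<and> (\<forall>j. j \<notin> set t \<longrightarrow> Poly_Mapping.lookup a j = 0)"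
proof (induction t)
  case Nil
  show ?case by (intro exI[of _ 0]) auto
next
  case (Cons c t)
  then obtain a where a: "MM laur_inv t = laur_monom a" "\<And>j. Poly_Mapping.lookup a j \<le> 0" "\<And>j. j \<notin> set t \<Longrightarrow> Poly_Mapping.lookup a j = 0"
    by auto
  have "MM laur_inv (c # t) = laur_monom (Poly_Mapping.single c (- 1) + a + a)"
    by (simp add: a(1) laur_inv_def power2_eq_square laur_monom_add mult.assoc)
  moreover have "Poly_Mapping.lookup (Poly_Mapping.single c (- 1) + a + a) j \<le> 0" for j
    using a(2)[of j] by (auto simp: lookup_add lookup_single when_def)
  moreover have "Poly_Mapping.lookup (Poly_Mapping.single c (- 1) + a + a) j = 0" if "j \<notin> set (c # t)" for j
    using a(3)[of j] that by (auto simp: lookup_add lookup_single when_def)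
  ultimately show ?case by blast
qed

lemma MM_laur_var_inv: "MM laur_inv t * MM laur_var t = 1"
proof (induction t)
  case (Cons c t)
  have "a * m\<^sup>2 * (b * n\<^sup>2) = b * a * (m * n)\<^sup>2" for a b m n :: "'a laur"
    by (simp add: power_mult_distrib algebra_simps)
  then show ?case unfolding MM.simps by (simp only: Cons laur_var_inv) simp
qed simp

lemma mpol_to_laur_Fp: "mpol_to_laur (Fp s i) = FF laur_A laur_var s i"
  by (simp add: mpol_to_laur_EV)

lemma Hl_monom:
  assumes "distinct s"
  shows "\<exists>a. Poly_Mapping.lookup a i = 0 \<and> (\<forall>j. Poly_Mapping.lookup a j \<le> 0) \<and> Hl s i = laur_monom a * mpol_to_laur (Fp s i)"
proof (cases i s rule: index_cases)
  case notin
  then show ?thesis by (intro exI[of _ 0]) (simp add: Hl_def mpol_to_laur_Fp FF_notin HF_notin)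
next
  case (last pre)
  then show ?thesis by (intro exI[of _ 0]) (simp add: Hl_def mpol_to_laur_Fp FF_last HF_last)
next
  case (inner pre b post)
  obtain a where a: "MM laur_inv post = laur_monom a" "\<And>j. Poly_Mapping.lookup a j \<le> 0" "\<And>j. j \<notin> set post \<Longrightarrow> Poly_Mapping.lookup a j = 0"
    using MM_laur_inv[of post] by auto
  have "mpol_to_laur (Fp s i) = Hl s i * (MM laur_var post)\<^sup>2"
    unfolding mpol_to_laur_Fp Hl_def inner(1) by (rule FF_inner_HF) (use inner in auto)
  then have "laur_monom (a + a) * mpol_to_laur (Fp s i) = Hl s i * (MM laur_inv post * MM laur_var post)\<^sup>2"
    by (simp add: laur_monom_add a(1)[symmetric] power2_eq_square algebra_simps)
  then have "Hl s i = laur_monom (a + a) * mpol_to_laur (Fp s i)"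
    unfolding MM_laur_var_inv by simp
  moreover have "Poly_Mapping.lookup (a + a) i = 0" "\<And>j. Poly_Mapping.lookup (a + a) j \<le> 0"
    using a(2,3) assms inner by (auto simp: lookup_add)
  ultimately show ?thesis by blast
qed

text \<open>If the exponent of \<open>X_j\<close> in the second candidate were larger by
  \<open>c > 0\<close>, the substitution would produce an additional factor \<open>F_j\<close> to
  the power \<open>c\<close>, contradicting non-divisibility. The exponents are thus equal by
  symmetry.\<close>

lemma is_hat_unique:
  assumes S: "is_seed S" and P: "is_hat S i P" "is_hat S i P'"
  shows "P = P'"
proof -
  obtain a where a: "Poly_Mapping.lookup a i = 0" "P = laur_monom a * mpol_to_laur (exch S i)"
    using P(1) unfolding is_hat_def by blast
  obtain a' where a': "Poly_Mapping.lookup a' i = 0" "P' = laur_monom a' * mpol_to_laur (exch S i)"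
    using P(2) unfolding is_hat_def by blast
  have le: "Poly_Mapping.lookup a' j \<le> Poly_Mapping.lookup a j"
    if P: "is_hat S i P" "is_hat S i P'" and a: "P = laur_monom a * mpol_to_laur (exch S i)"
      and a': "P' = laur_monom a' * mpol_to_laur (exch S i)" and j: "j \<noteq> i" for a a' j P P'
  proof (rule ccontr)
    assume "\<not> ?thesis"
    then have lt: "Poly_Mapping.lookup a j < Poly_Mapping.lookup a' j" by simp
    define c where "c = Poly_Mapping.lookup a' j - Poly_Mapping.lookup a j"
    have c: "c > 0" using lt by (simp add: c_def)
    define e where "e = a' - a"
    have ec: "Poly_Mapping.lookup e j = c" by (simp add: e_def c_def lookup_minus)
    have P': "P' = laur_monom e * P"
      by (simp add: a a' e_def mult.assoc[symmetric] flip: laur_monom_add)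
    let ?F = "exch S j"
    have F0: "emb ?F \<noteq> 0" using S by (auto simp: is_seed_def irreducible_def)
    define x where "x = amb_var(j := emb ?F / amb_var j)"
    have x: "x k \<noteq> 0" for k using F0 by (simp add: x_def)
    have hs: "hat_subst S P j = LV amb_A x P" for P
      by (simp add: hat_subst_def laur_eval_amb_const eval_amb_const x_def emb_def)
    obtain Q where Q: "LV amb_A x P = lemb Q"
      using P(1) j unfolding is_hat_def laur_eval_amb_const lemb_def[symmetric] hs[symmetric] by blast
    obtain Q' where Q': "LV amb_A x P' = lemb Q'" "\<not> mpol_to_laur ?F dvd Q'"
      using P(2) j unfolding is_hat_def laur_eval_amb_const lemb_def[symmetric] hs[symmetric] by blast
    \<comment> \<open>The substitution turns \<open>X_j\<close> to the power \<open>c\<close> into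
      \<open>F_j\<close> to the power \<open>c\<close> times \<open>X\<close> to the power
      \<open>- c\<close>, so the exponent in slot \<open>j\<close> changes from \<open>c\<close> to
      \<open>c - 2 * c\<close>.\<close>
    define e1 where "e1 = e - Poly_Mapping.single j (2 * c)"
    have "LV amb_A x (laur_monom e) = (emb ?F / amb_var j) powi c * (\<Prod>k\<in>UNIV - {j}. amb_var k powi Poly_Mapping.lookup e k)"
      unfolding LV_monom by (subst prod.remove[of UNIV j]) (auto simp: x_def ec intro!: prod.cong)
    also have "(emb ?F / amb_var j) powi c = emb ?F ^ nat c * amb_var j powi (- c)"
      using c by (simp add: power_int_divide_distrib power_int_def field_simps)
    also have "amb_var j powi (- c) = amb_var j powi Poly_Mapping.lookup e1 j"
      by (simp add: e1_def lookup_minus ec)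
    also have "(\<Prod>k\<in>UNIV - {j}. amb_var k powi Poly_Mapping.lookup e k) = (\<Prod>k\<in>UNIV - {j}. amb_var k powi Poly_Mapping.lookup e1 k)"
      by (intro prod.cong) (auto simp: e1_def lookup_minus lookup_single)
    finally have "LV amb_A x (laur_monom e) = emb ?F ^ nat c * lemb (laur_monom e1)"
      unfolding lemb_def LV_monom by (subst prod.remove[of UNIV j]) (simp_all add: mult.assoc)
    then have "lemb Q' = emb ?F ^ nat c * lemb (laur_monom e1) * lemb Q"
      unfolding Q'(1)[symmetric] P' by (simp add: rhomD(4)[OF rhom_LV[of x amb_A, OF x]] Q)
    then have "lemb Q' = lemb (mpol_to_laur ?F ^ nat c * laur_monom e1 * Q)"
      by (simp add: rhomD(4)[OF rhom_lemb] rhom_power[OF rhom_lemb])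
    then have "Q' = mpol_to_laur ?F ^ nat c * laur_monom e1 * Q" unfolding lemb_eq_iff .
    moreover have "mpol_to_laur ?F dvd mpol_to_laur ?F ^ nat c" using c by (intro dvd_power) auto
    ultimately show False using Q'(2) by (simp add: mult.assoc)
  qed
  have "Poly_Mapping.lookup a j = Poly_Mapping.lookup a' j" for j
    using le[OF P a(2) a'(2), of j] le[OF P(2,1) a'(2) a(2), of j] a(1) a'(1) by (cases "j = i") auto
  then have "a = a'" by (intro poly_mapping_eqI)
  then show ?thesis using a a' by simp
qed

section \<open>Interchanging two neighbours in the sequence\<close>

definition swp :: "'n \<Rightarrow> 'n \<Rightarrow> 'n \<Rightarrow> 'n" where
  "swp a b = id(a := b, b := a)"

lemma swp_simps [simp]: "swp a b a = b" "swp a b b = a" "k \<noteq> a \<Longrightarrow> k \<noteq> b \<Longrightarrow> swp a b k = k"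
  by (auto simp: swp_def)

lemma swp_swp [simp]: "swp a b (swp a b k) = k"
  by (cases "k = a"; cases "k = b") auto

text \<open>\<open>exchange_swap\<close> in the setting of \<open>PP\<close>: \<open>x'\<close>
  carries the old variable \<open>h / u\<close> at \<open>j\<close>, and \<open>xs\<close> assigns
  the variables of the order \<open>c, j\<close>, where \<open>u\<close> sits at \<open>c\<close>
  and \<open>x c\<close> at \<open>j\<close>.\<close>

lemma PP_swap:
  fixes A x xs :: "'n \<Rightarrow> 'r::field"
  assumes jc: "j \<noteq> c" "j \<notin> set t" "c \<notin> set t" and nz: "u \<noteq> 0" "x c \<noteq> 0"
    and h: "h = z * x c + B\<^sup>2 * (PP A x (\<lambda>k. inverse (x k)) P (x c) (B * A j * A c) t)\<^sup>2" "h \<noteq> 0"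
    and x': "x' j = h / u" "\<And>k. k \<noteq> j \<Longrightarrow> x' k = x k"
    and xs: "xs j = x c" "xs c = u" "\<And>k. k \<noteq> j \<Longrightarrow> k \<noteq> c \<Longrightarrow> xs k = x k"
  shows "PP A x' (\<lambda>k. inverse (x' k)) P z B (j # c # t) = PP A xs (\<lambda>k. inverse (xs k)) P z B (c # j # t)"
proof -
  define q where "q = PP A x (\<lambda>k. inverse (x k)) P (x c) (B * A j * A c) t"
  have "x' k = x k" "xs k = x k" if "k \<in> set t" for k
    using that jc by (auto intro: x' xs)
  then have q: "PP A x' (\<lambda>k. inverse (x' k)) P (x' c) (B * A j * A c) t = q"
    "PP A xs (\<lambda>k. inverse (xs k)) P (xs j) (B * A c * A j) t = q"
    unfolding q_def using jc by (auto intro!: PP_cong simp: x' xs)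
  have "h \<noteq> 0" "h = z * x c + B\<^sup>2 * q\<^sup>2" using h by (auto simp: q_def)
  then show ?thesis
    using exchange_swap[of u "x c" z B q "A j" "A c"] nz
    unfolding PP.simps q unfolding x'(1) xs(1,2) x'(2)[OF jc(1)[symmetric]] by simp
qed

text \<open>For \<open>i\<close> before the pair \<open>j, c\<close> but not next to it, hat
  \<open>F_i\<close> sees the pair only through \<open>PP\<close>, so substituting hat
  \<open>F_j / u\<close> for \<open>X_j\<close> gives hat \<open>F_i\<close> of the interchanged
  sequence.\<close>

lemma HF_swap:
  fixes A x :: "'n::finite \<Rightarrow> 'r::field"
  assumes d: "distinct (pre @ i # b # p @ j # c # t)" and nz: "u \<noteq> 0" "x c \<noteq> 0"
    and h: "h = HF A x (\<lambda>k. inverse (x k)) (pre @ i # b # p @ j # c # t) j" "h \<noteq> 0"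
    and x': "x' j = h / u" "\<And>k. k \<noteq> j \<Longrightarrow> x' k = x k"
    and xs: "xs j = x c" "xs c = u" "\<And>k. k \<noteq> j \<Longrightarrow> k \<noteq> c \<Longrightarrow> xs k = x k"
  shows "HF A x' (\<lambda>k. inverse (x' k)) (pre @ i # b # p @ j # c # t) i =
    HF A xs (\<lambda>k. inverse (xs k)) (pre @ i # b # p @ c # j # t) i"
proof -
  let ?s = "pre @ i # b # p @ j # c # t" and ?s' = "pre @ i # b # p @ c # j # t"
  define P z B where "P = (\<Prod>k\<in>- set ?s. x k)" and "z = lastz x (x b) p" and "B = BB A pre * A i * A b * BB A p"
  have "j \<notin> set (pre @ i # b # p)" using d by auto
  from HF_inner[OF this, of A x "\<lambda>k. inverse (x k)" c t]
  have h': "h = z * x c + B\<^sup>2 * (PP A x (\<lambda>k. inverse (x k)) P (x c) (B * A j * A c) t)\<^sup>2"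
    unfolding h(1) P_def z_def B_def by (simp add: mult.assoc)
  have *: "PP A x' (\<lambda>k. inverse (x' k)) P z B (j # c # t) = PP A xs (\<lambda>k. inverse (xs k)) P z B (c # j # t)"
    by (rule PP_swap[OF _ _ _ nz h' h(2) x' xs]) (use d in auto)
  have P: "(\<Prod>k\<in>- set ?s. x' k) = P" "(\<Prod>k\<in>- set ?s'. xs k) = P"
    unfolding P_def by (auto intro!: prod.cong x'(2) xs(3))
  have xk: "x' k = x k" "xs k = x k" if "k \<in> set (pre @ b # p)" for k
    using that d x'(2)[of k] xs(3)[of k] by auto
  have b: "x' b = x b" "xs b = x b" using xk by auto
  have i: "i \<notin> set pre" using d by auto
  have lz: "lastz x' (x' b) p = z" "lastz xs (xs b) p = z" "lastz x' 1 pre = lastz x 1 pre" "lastz xs 1 pre = lastz x 1 pre"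
    unfolding z_def lastz_def using xk b by auto
  have "PP A x' (\<lambda>k. inverse (x' k)) P (x' b) (BB A pre * A i * A b) (p @ j # c # t) =
    PP A xs (\<lambda>k. inverse (xs k)) P (xs b) (BB A pre * A i * A b) (p @ c # j # t)"
    unfolding PP_append lz B_def[symmetric] * by (rule PP_cong) (use xk b in auto)
  then show ?thesis
    unfolding HF_inner[OF i] P lz b by simp
qed

text \<open>
  With the \<open>A\<close>-values of \<open>t\<close> equal to \<open>1\<close>, this point makes \<open>PP\<close> equal to \<open>1\<close>, which
  produces zeros of the exchange polynomials at inner indices.
\<close>

fun pt :: "('n \<Rightarrow> rat) \<Rightarrow> rat \<Rightarrow> 'n list \<Rightarrow> 'n \<Rightarrow> rat" where
  "pt x z [] = x"
| "pt x z (c # t) = pt (x(c := z - 1)) (z - 1) t"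

lemma pt_notin: "m \<notin> set t \<Longrightarrow> pt x z t m = x m"
  by (induction t arbitrary: x z) auto

lemma pt_neg: "z < 0 \<Longrightarrow> c \<in> set t \<Longrightarrow> pt x z t c < 0"
proof (induction t arbitrary: x z)
  case (Cons a t)
  show ?case
  proof (cases "c \<in> set t")
    case True
    then show ?thesis using Cons.prems by (simp add: Cons.IH)
  next
    case False
    then show ?thesis using Cons.prems by (simp add: pt_notin)
  qed
qed simp

text \<open>With \<open>B = - 1\<close> and inner value 1 the bracket at \<open>c\<close> is
  \<open>z - 1\<close>, which is just the coordinate chosen at \<open>c\<close>; the quotient is
  again 1. Starting from \<open>z < 0\<close> keeps all these coordinates nonzero.\<close>

lemma pt_PP:
  "distinct t \<Longrightarrow> (\<And>c. c \<in> set t \<Longrightarrow> y c = 1) \<Longrightarrow> z < 0 \<Longrightarrow> PP y (pt x z t) (\<lambda>k. inverse (pt x z t k)) 1 z (- 1) t = 1"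
proof (induction t arbitrary: x z)
  case (Cons c t)
  have c: "pt (x(c := z - 1)) (z - 1) t c = z - 1" using Cons.prems(1) by (simp add: pt_notin)
  have "PP y (pt (x(c := z - 1)) (z - 1) t) (\<lambda>k. inverse (pt (x(c := z - 1)) (z - 1) t k)) 1 (z - 1) (- 1) t = 1"
    using Cons.prems by (intro Cons.IH) auto
  then have q: "PP y (pt (x(c := z - 1)) (z - 1) t) (\<lambda>k. inverse (pt (x(c := z - 1)) (z - 1) t k)) 1 (z - 1) (- 1 * 1) t = 1"
    by simp
  have y: "y c = 1" using Cons.prems by simp
  show ?case unfolding pt.simps PP.simps c y q using Cons.prems by simp
qed simp

lemma lemb_inv [simp]: "lemb (laur_inv k) = inverse (amb_var k)"
  by (simp add: lemb_def)

lemma distinct_split_unique: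
  "distinct (p @ i # t) \<Longrightarrow> p @ i # t = p' @ i # t' \<Longrightarrow> p = p' \<and> t = t'"
  by (metis append_Cons_eq_iff distinct.simps(2) distinct_append not_distinct_conv_prefix)

lemma hat_subst_can:
  assumes d: "distinct s" and x: "x = amb_var(j := emb (Fp s j) / amb_var j)"
  shows "hat_subst (can s) (Hl s i) j = HF amb_A x (\<lambda>k. inverse (x k)) s i"
proof -
  have "emb (Fp s j) \<noteq> 0" using prime_Fp[OF d, of j] by auto
  then have "x k \<noteq> 0" for k by (simp add: x)
  then have "LV amb_A x (Hl s i) = HF amb_A x (\<lambda>k. inverse (x k)) s i" by (rule LV_Hl)
  then show ?thesis
    by (simp add: hat_subst_def laur_eval_amb_const eval_amb_const can_def emb_def x)
qed

text \<open>The clause of \<open>is_hat\<close> for a single pair \<open>i\<close>,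
  \<open>j\<close>, isolated because its proof depends on the positions of both indices.\<close>

definition hat_ok :: "'n::{finite,linorder} list \<Rightarrow> 'n \<Rightarrow> 'n \<Rightarrow> bool" where
  "hat_ok s i j \<longleftrightarrow> (\<exists>Q :: 'n laur. hat_subst (can s) (Hl s i) j = laur_eval amb_const amb_var Q \<and>
     \<not> mpol_to_laur (exch (can s) j) dvd Q)"

text \<open>A multiple of \<open>F_j\<close> in the Laurent ring vanishes at every zero of
  \<open>F_j\<close> with nonzero coordinates; a single such zero at which \<open>Q\<close> does not
  vanish refutes divisibility.\<close>

lemma hat_okI:
  fixes y z :: "'n::{finite,linorder} \<Rightarrow> rat"
  assumes d: "distinct s" and x: "x = amb_var(j := emb (Fp s j) / amb_var j)"
    and Q: "lemb Q = HF amb_A x (\<lambda>k. inverse (x k)) s i"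
    and z: "\<And>k. z k \<noteq> 0" and F: "FF y z s j = 0" and nz: "LV y z Q \<noteq> 0"
  shows "hat_ok s i j"
  unfolding hat_ok_def
proof (intro exI conjI)
  show "hat_subst (can s) (Hl s i) j = laur_eval amb_const amb_var Q"
    unfolding hat_subst_can[OF d x] Q[symmetric] by (simp add: laur_eval_amb_const lemb_def)
  show "\<not> mpol_to_laur (exch (can s) j) dvd Q"
  proof
    assume "mpol_to_laur (exch (can s) j) dvd Q"
    from rhom_dvd[OF rhom_LV[of z y, OF z] this] show False
      using F nz by (simp add: LV_mpol_to_laur z can_def)
  qed
qed

lemma HF_xi_cong:
  assumes d: "distinct s" and n: "\<And>pre b post. s = pre @ i # b # post \<Longrightarrow> j \<notin> set post"
    and xi: "\<And>k. k \<noteq> j \<Longrightarrow> xi k = xi' k"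
  shows "HF A x xi s i = HF A x xi' s i"
proof (cases i s rule: index_cases)
  case (inner pre b post)
  have "PP A x xi (\<Prod>k\<in>- set s. x k) (x b) (BB A pre * A i * A b) post = PP A x xi' (\<Prod>k\<in>- set s. x k) (x b) (BB A pre * A i * A b) post"
    using n[OF inner(1)] by (intro PP_cong xi) auto
  then show ?thesis using inner by (simp add: HF_inner)
qed (simp_all add: HF_notin HF_last)

text \<open>When \<open>X_j\<close> occurs in no denominator of hat \<open>F_i\<close>, the
  substitution of \<open>F_j / X\<close> at a zero of \<open>F_j\<close> amounts to setting
  \<open>X_j\<close> to 0. The inverses passed to \<open>HF\<close> stay those of
  \<open>z\<close>.\<close>

lemma hat_ok_poly:
  fixes y z :: "'n::{finite,linorder} \<Rightarrow> rat"
  assumes d: "distinct s" and n: "\<And>pre b post. s = pre @ i # b # post \<Longrightarrow> j \<notin> set post"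
    and z: "\<And>k. z k \<noteq> 0" and F: "FF y z s j = 0" and nz: "HF y (z(j := 0)) (\<lambda>k. inverse (z k)) s i \<noteq> 0"
  shows "hat_ok s i j"
proof (rule hat_okI[OF d refl _ z F])
  define Q where "Q = HF laur_A (laur_var(j := mpol_to_laur (Fp s j) * laur_inv j)) laur_inv s i"
  let ?x = "amb_var(j := emb (Fp s j) / amb_var j)"
  have "(\<lambda>k. lemb ((laur_var(j := mpol_to_laur (Fp s j) * laur_inv j)) k)) = ?x"
    by (auto simp: rhomD(4)[OF rhom_lemb] divide_inverse)
  then have "lemb Q = HF amb_A ?x (\<lambda>k. inverse (amb_var k)) s i"
    unfolding Q_def by (subst rhom_HF[OF rhom_lemb]) simp
  also have "\<dots> = HF amb_A ?x (\<lambda>k. inverse (?x k)) s i"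
    by (rule HF_xi_cong[OF d n]) auto
  finally show "lemb Q = HF amb_A ?x (\<lambda>k. inverse (?x k)) s i" .
  have "(\<lambda>k. LV y z ((laur_var(j := mpol_to_laur (Fp s j) * laur_inv j)) k)) = z(j := 0)"
    using F z by (auto simp: rhomD(4)[OF rhom_LV[of z y, OF z]] LV_mpol_to_laur)
  then show "LV y z Q \<noteq> 0"
    unfolding Q_def using nz z by (subst LV_HF[of z y, OF z]) simp
qed

lemma PP_one_pos: "0 < PP (\<lambda>_. 1) (\<lambda>_. 1) (\<lambda>_. 1) 1 1 (1::rat) t"
  by (induction t) (auto intro!: mult_pos_pos add_pos_pos)

text \<open>The zero of \<open>F_j\<close> is \<open>A_j = - 1\<close> with everything else 1. The
  case needing its own argument is the one where \<open>j\<close> is the last entry and hat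
  \<open>F_i\<close> has \<open>X_j\<close> in a denominator.\<close>

lemma hat_ok_linear:
  fixes pre :: "'n::{finite,linorder} list"
  assumes d: "distinct (pre @ [j])" and s: "s = pre \<or> s = pre @ [j]" and ij: "i \<noteq> j"
  shows "hat_ok s i j"
proof -
  define y :: "'n \<Rightarrow> rat" where "y = (\<lambda>_. 1)(j := - 1)"
  have ds: "distinct s" and jp: "j \<notin> set pre" using d s by auto
  have y [simp]: "BB y t = (if j \<in> set t then - 1 else 1)" if "distinct t" for t
    using that by (induction t) (auto simp: y_def)
  have F: "FF y (\<lambda>_. 1) s j = 0"
    using s jp d by (auto simp: FF_notin FF_last y_def)
  have yi: "y i = 1" using ij by (simp add: y_def)
  consider (notin) "i \<notin> set s" | (innr) p b post where "s = p @ i # b # post" "i \<notin> set p" "j \<notin> set post"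
    | (b) p b post where "s = p @ i # b # post @ [j]" "i \<notin> set p" | (lst) p where "s = p @ [i]" "i \<notin> set p"
  proof (cases i s rule: index_cases)
    case (inner p b post)
    then show ?thesis
    proof (cases "j \<in> set post")
      case True
      then have "s = pre @ [j]" using s jp inner by auto
      then have "last s = j" by simp
      then have "last (b # post) = j" unfolding inner(1) by simp
      then have "post = butlast post @ [j]" using True by (cases post rule: rev_cases) auto
      then show ?thesis using inner by (intro that(3)[of p b "butlast post"]) auto
    qed (use that in blast)
  qed (use that in blast)+
  then show ?thesis
  proof cases
    case notin
    have "HF y ((\<lambda>_. 1)(j := 0)) (\<lambda>k. inverse 1) s i \<noteq> 0"
      using notin ds s jp ij yi by (auto simp: HF_notin lastz_delta)
    then show ?thesis using notin F by (intro hat_ok_poly[OF ds _ _ F]) auto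
  next
    case (lst p)
    then have j: "j \<notin> set s" using s jp ij by auto
    have "HF y ((\<lambda>_. 1)(j := 0)) (\<lambda>k. inverse 1) s i \<noteq> 0"
      using lst ds j ij yi last_in_set[of p] by (auto simp: HF_last lastz_delta)
    moreover have "j \<notin> set post'" if "s = pre' @ i # b' # post'" for pre' b' post'
      using distinct_split_unique[of p i "[]" pre' "b' # post'"] that lst ds by simp
    ultimately show ?thesis by (intro hat_ok_poly[OF ds _ _ F]) auto
  next
    case (innr p b post)
    have "HF y ((\<lambda>_. 1)(j := 0)) (\<lambda>k. inverse 1) s i \<noteq> 0"
    proof (cases "j \<in> set s")
      case True
      then have "s = pre @ [j]" using s jp by auto
      then have "last s = j" by simp
      then have "last (b # post) = j" unfolding innr(1) by simp
      then have "post = []" "b = j" using innr(3) last_in_set[of post] by (auto split: if_splits)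
      then show ?thesis using innr ds ij True by (auto simp: HF_inner)
    next
      case False
      then show ?thesis using innr ds last_in_set[of p] by (auto simp: HF_inner PP_zero lastz_delta)
    qed
    moreover have "j \<notin> set post'" if "s = pre' @ i # b' # post'" for pre' b' post'
    proof -
      have "pre' = p \<and> b' # post' = b # post"
        using that innr ds by (metis append_Cons_eq_iff distinct.simps(2) distinct_append not_distinct_conv_prefix)
      then show ?thesis using innr by simp
    qed
    ultimately show ?thesis by (intro hat_ok_poly[OF ds _ _ F]) auto
  next
    case (b p b post)
    \<comment> \<open>Since \<open>F_j\<close> is the same with and without the final entry
      \<open>j\<close>, substituting \<open>F_j / X\<close> undoes \<open>HF_append\<close>: the
      result is hat \<open>F_i\<close> of the shortened sequence, a sum of positive terms at the
      chosen point.\<close>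
    let ?s = "p @ i # b # post"
    have s': "s = ?s @ [j]" using b by simp
    have d': "distinct ?s" "j \<notin> set ?s" using ds unfolding s' by auto
    let ?x = "amb_var(j := emb (Fp s j) / amb_var j)"
    have "FF amb_A ?x ?s j = FF amb_A amb_var ?s j" by (rule FF_self[OF d'(1)])
    moreover have "emb (Fp s j) = FF amb_A amb_var ?s j"
      unfolding emb_Fp s' FF_last[OF d'(2)] FF_notin[OF d'(2)] ..
    ultimately have Fj: "emb (Fp s j) = FF amb_A amb_var ?s j" "FF amb_A ?x ?s j = FF amb_A amb_var ?s j" by auto
    have F0: "FF amb_A amb_var ?s j \<noteq> 0" unfolding Fj(1)[symmetric] using prime_Fp[OF ds, of j] by auto
    then have "?x(j := FF amb_A ?x ?s j / ?x j) = amb_var" using Fj by auto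
    then have "lemb (Hl ?s i) = HF amb_A ?x (\<lambda>k. inverse (?x k)) s i"
      using HF_append[OF d', of amb_A ?x] unfolding s' lemb_Hl by simp
    moreover have "LV y (\<lambda>_. 1) (Hl ?s i) \<noteq> 0"
    proof -
      have "PP y (\<lambda>_. 1) (\<lambda>k. inverse 1) (\<Prod>k\<in>- set ?s. 1) 1 (BB y p * y i * y b) post = PP (\<lambda>_. 1) (\<lambda>_. 1) (\<lambda>_. 1) 1 1 1 post"
        using d' ij by (intro PP_cong) (auto simp: y_def)
      then show ?thesis using b(2) PP_one_pos[of post] d'
        by (subst LV_Hl) (auto simp: HF_inner add_nonneg_eq_0_iff)
    qed
    ultimately show ?thesis by (intro hat_okI[OF ds refl _ _ F]) auto
  qed
qed

text \<open>The point has \<open>A_b = - 1\<close>, \<open>z b = - 1\<close>, the coordinates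
  \<open>pt\<close> on \<open>post\<close>, and 1 elsewhere. Then \<open>PP\<close> is 1 and hat
  \<open>F_j\<close> becomes \<open>- 1 + 1\<close>. All coordinates at \<open>b\<close> and
  \<open>post\<close> are negative, which controls the signs of the values for every other index
  \<open>i\<close>.\<close>

lemma hat_ok_inner:
  fixes pre :: "'n::{finite,linorder} list"
  assumes d: "distinct (pre @ j # b # post)" and ij: "i \<noteq> j"
  shows "hat_ok (pre @ j # b # post) i j"
proof -
  let ?s = "pre @ j # b # post"
  define y :: "'n \<Rightarrow> rat" where "y = (\<lambda>_. 1)(b := - 1)"
  define z where "z = pt ((\<lambda>_. 1)(b := - 1)) (- 1) post"
  let ?z = "z(j := 0)" and ?zi = "\<lambda>k. inverse (z k)"
  have yb: "y b = - 1" "\<And>k. k \<noteq> b \<Longrightarrow> y k = 1" by (auto simp: y_def)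
  have By: "BB y t = (if b \<in> set t then - 1 else 1)" if "distinct t" for t
    using that by (induction t) (auto simp: y_def)
  have z1: "z k = 1" if "k \<noteq> b" "k \<notin> set post" for k using that by (simp add: z_def pt_notin)
  have zb: "z b = - 1" using d by (simp add: z_def pt_notin)
  have zn: "z k < 0" if "k \<in> set (b # post)" for k using that zb pt_neg[of "- 1" k post] by (auto simp: z_def)
  have znz: "z k \<noteq> 0" for k using z1[of k] zn[of k] by (cases "k \<in> set (b # post)") auto
  have P: "(\<Prod>k\<in>- set ?s. z k) = 1" "(\<Prod>k\<in>- set ?s. ?z k) = 1" by (intro prod.neutral; simp add: z1)+
  have lzn: "lastz z (- 1) t < 0" if "set t \<subseteq> set post" for t
  proof (cases "t = []")
    case False
    then have "last t \<in> set post" using that by (meson last_in_set subsetD)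
    then show ?thesis using zn[of "last t"] False by (auto simp: lastz_def)
  qed (simp add: lastz_def)
  have lz1: "lastz z 1 t = 1" if "set t \<subseteq> set pre" for t
  proof (cases "t = []")
    case False
    then have "last t \<in> set pre" using that by (meson last_in_set subsetD)
    then show ?thesis using d z1[of "last t"] False by (auto simp: lastz_def)
  qed simp
  have PPp: "PP y z ?zi 1 (- 1) (- 1) post = 1"
    unfolding z_def using d by (intro pt_PP) (auto simp: y_def)
  have jp: "j \<notin> set pre" "b \<notin> set pre" "j \<noteq> b" "j \<notin> set post" using d by auto
  have Bpre: "BB y pre = 1" "y j = 1" using d jp By[of pre] yb by auto
  have F: "FF y z ?s j = 0"
    unfolding FF_inner_HF[OF jp(1), where xi = ?zi, OF right_inverse[OF znz]] HF_inner[OF jp(1)] P zb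
    using PPp lz1[of pre] Bpre yb by simp
  note poly = hat_ok_poly[OF d _ znz F]
  consider "i \<notin> set ?s" | "i \<in> set pre" | "i = b" | "i \<in> set post" using ij by auto
  then show ?thesis
  proof cases
    case 1
    have "(\<Prod>k\<in>- insert i (set ?s). ?z k) = 1" by (intro prod.neutral) (auto simp: z1)
    then have "HF y ?z ?zi ?s i = lastz ?z (?z b) post + BB y ?s"
      using 1 yb(2)[of i] by (simp add: HF_notin del: fun_upd_apply)
    moreover have "BB y ?s = - 1" using By[OF d] by simp
    moreover have "lastz ?z (?z b) post = lastz z (- 1) post" using jp zb by simp
    ultimately have "HF y ?z ?zi ?s i < 0" using lzn[of post] by simp
    then show ?thesis using 1 by (intro poly) auto
  next
    case 2
    then obtain p1 p2 where pre: "pre = p1 @ i # p2" "i \<notin> set p1" by (meson split_list_first)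
    show ?thesis
    proof (cases p2)
      case Nil
      have s: "?s = p1 @ i # j # b # post" using pre Nil by simp
      have "PP y ?z ?zi 1 (- 1) (- 1) post = 1"
        by (rule trans[OF PP_cong PPp]) (use jp in auto)
      moreover have "BB y p1 = 1" "y i = 1" using Bpre(1) By[of p1] d pre yb jp by auto
      ultimately have "HF y ?z ?zi ?s i = 1"
        using pre P(2) jp zb yb Bpre(2) unfolding s by (simp add: HF_inner)
      moreover have "j \<notin> set post'" if s': "?s = pre' @ i # b' # post'" for pre' b' post'
      proof -
        have 1: "distinct (p1 @ i # j # b # post)" using d unfolding s .
        have 2: "p1 @ i # j # b # post = pre' @ i # b' # post'" using s' unfolding s .
        from distinct_split_unique[OF 1 2] show ?thesis using jp by auto
      qed
      ultimately show ?thesis by (intro poly) auto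
    next
      case (Cons b' p3)
      \<comment> \<open>Here hat \<open>F_i\<close> has \<open>X_j\<close> in a denominator. By
        \<open>HF_swap\<close> the substitution yields hat \<open>F_i\<close> of the sequence with
        \<open>j\<close> and \<open>b\<close> interchanged, which is a Laurent polynomial.\<close>
      have s: "?s = p1 @ i # b' # p3 @ j # b # post" using pre Cons by simp
      let ?s' = "p1 @ i # b' # p3 @ b # j # post"
      have d': "distinct (p1 @ i # b' # p3 @ j # b # post)" using d s by simp
      have d2: "distinct ?s'" using d' by auto
      \<comment> \<open>\<open>HF_swap\<close> substitutes hat \<open>F_j / u\<close>, whereas
        \<open>is_hat\<close> prescribes \<open>F_j / X\<close>. As \<open>F_j\<close> is hat
        \<open>F_j\<close> times the squared monomial of \<open>post\<close>, the match is
        \<open>u = X_j / MM\<close> squared, placed at \<open>b\<close>; \<open>wi\<close> holds the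
        inverses.\<close>
      define w where "w = (\<lambda>k. laur_var (swp j b k))(b := laur_var j * (MM laur_inv post)\<^sup>2)"
      define wi where "wi = (\<lambda>k. laur_inv (swp j b k))(b := laur_inv j * (MM laur_var post)\<^sup>2)"
      define Q where "Q = HF laur_A w wi ?s' i"
      have Mi: "MM (\<lambda>k. inverse (x k)) post = inverse (MM x post)" for x :: "'n \<Rightarrow> 'r::field"
        by (induction post) (auto simp: power_inverse)
      have M0: "MM x post \<noteq> 0" if "\<And>k. x k \<noteq> 0" for x :: "'n \<Rightarrow> 'r::field"
        using that by (induction post) auto
      have Lw: "(\<lambda>k. LV y' x (w k)) = (\<lambda>k. x (swp j b k))(b := x j / (MM x post)\<^sup>2)"
         "(\<lambda>k. LV y' x (wi k)) = (\<lambda>k. inverse (((\<lambda>k. x (swp j b k))(b := x j / (MM x post)\<^sup>2)) k))"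
        if x: "\<And>k. x k \<noteq> 0" for x y' :: "'n \<Rightarrow> 'r::field"
        using x by (auto simp: fun_eq_iff w_def wi_def rhomD(4)[OF rhom_LV[of x y', OF x]] rhom_power[OF rhom_LV[of x y', OF x]]
            rhom_MM[OF rhom_LV[of x y', OF x]] Mi divide_inverse power_inverse)
      let ?x = "amb_var(j := emb (Fp ?s j) / amb_var j)"
      let ?xs = "(\<lambda>k. amb_var (swp j b k))(b := amb_var j / (MM amb_var post)\<^sup>2)"
      define h where "h = HF amb_A amb_var (\<lambda>k. inverse (amb_var k)) ?s j"
      have F': "emb (Fp ?s j) = h * (MM amb_var post)\<^sup>2"
        unfolding h_def emb_Fp by (rule FF_inner_HF) (use jp in auto)
      have h0: "h \<noteq> 0" using F' prime_Fp[OF d, of j] by auto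
      have "HF amb_A ?x (\<lambda>k. inverse (?x k)) ?s i = HF amb_A ?xs (\<lambda>k. inverse (?xs k)) ?s' i"
        unfolding s
        by (rule HF_swap[OF d', of "amb_var j / (MM amb_var post)\<^sup>2" amb_var h])
          (use jp(3) M0[of amb_var] h0 F' in \<open>auto simp: h_def s swp_def\<close>)
      also have "\<dots> = lemb Q"
        unfolding Q_def lemb_def by (subst LV_HF) (simp_all add: Lw)
      finally have 1: "lemb Q = HF amb_A ?x (\<lambda>k. inverse (?x k)) ?s i" by simp
      define zs where "zs = (\<lambda>k. z (swp j b k))(b := z j / (MM z post)\<^sup>2)"
      have "LV y z Q = HF y zs (\<lambda>k. inverse (zs k)) ?s' i"
        unfolding Q_def by (subst LV_HF[of z y, OF znz]) (simp add: Lw[of z, OF znz] zs_def)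
      also have "\<dots> = lastz zs 1 p1 * zs b' + (BB y p1)\<^sup>2 * (PP y zs (\<lambda>k. inverse (zs k)) (\<Prod>k\<in>- set ?s'. zs k) (zs b') (BB y p1 * y i * y b') (p3 @ b # j # post))\<^sup>2"
        using pre(2) by (rule HF_inner)
      finally have LQ: "LV y z Q = lastz zs 1 p1 * zs b' + (BB y p1 * PP y zs (\<lambda>k. inverse (zs k)) (\<Prod>k\<in>- set ?s'. zs k) (zs b') (BB y p1 * y i * y b') (p3 @ b # j # post))\<^sup>2"
        by (simp add: power_mult_distrib)
      have zs1: "zs k = 1" if "k \<in> set pre" for k
        using that d z1[of k] by (auto simp: zs_def swp_def)
      have "lastz zs 1 p1 = 1" using zs1[of "last p1"] last_in_set[of p1] by (auto simp: lastz_def pre)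
      moreover have "zs b' = 1" using zs1[of b'] by (simp add: pre Cons)
      \<comment> \<open>The value is 1 plus a square of a rational number.\<close>
      ultimately have "LV y z Q \<noteq> 0" unfolding LQ
        by (metis add_pos_nonneg less_numeral_extra(1,3) mult.right_neutral zero_le_power2)
      with 1 show ?thesis by (intro hat_okI[OF d refl _ znz F]) auto
    qed
  next
    case 3
    \<comment> \<open>The variable before \<open>b\<close> is \<open>X_j\<close>, which is set to 0,
      so only the second summand of hat \<open>F_b\<close> remains; its value is 1.\<close>
    have pz: "lastz ?z 1 (pre @ [j]) = 0" by simp
    show ?thesis
    proof (cases post)
      case Nil
      have s: "?s = (pre @ [j]) @ [b]" using Nil by simp
      have P1: "(\<Prod>k\<in>- insert b (set (pre @ [j])). ?z k) = 1" by (intro prod.neutral) (auto simp: z1 Nil)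
      have B1: "BB y (pre @ [j]) = 1" using Bpre by simp
      have b: "b \<notin> set (pre @ [j])" using jp by auto
      have "HF y ?z ?zi ?s i = 1" unfolding s 3 HF_last[OF b] pz P1 B1 by simp
      moreover have "j \<notin> set post'" if s': "?s = pre' @ i # b' # post'" for pre' b' post'
      proof -
        have 1: "distinct ((pre @ [j]) @ b # [])" using d Nil by simp
        have 2: "(pre @ [j]) @ b # [] = pre' @ b # b' # post'" using s' 3 Nil by simp
        from distinct_split_unique[OF 1 2] show ?thesis by simp
      qed
      ultimately show ?thesis by (intro poly) auto
    next
      case (Cons c t)
      have s: "?s = (pre @ [j]) @ b # c # t" using Cons by simp
      have zc: "z c = - 2" using d Cons by (simp add: z_def pt_notin)
      have "PP y (pt ((\<lambda>_. 1)(b := - 1, c := - 2)) (- 2) t) (\<lambda>k. inverse (pt ((\<lambda>_. 1)(b := - 1, c := - 2)) (- 2) t k)) 1 (- 2) (- 1) t = 1"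
        using d Cons by (intro pt_PP) (auto simp: y_def)
      then have q0: "PP y z ?zi 1 (- 2) (- 1) t = 1" unfolding z_def Cons by simp
      have "PP y ?z ?zi 1 (- 2) (- 1) t = 1"
        by (rule trans[OF PP_cong q0]) (use jp Cons in auto)
      moreover have "?z c = - 2" "y c = 1" using zc jp Cons d yb by auto
      moreover have "BB y (pre @ [j]) = 1" using Bpre by simp
      moreover have b: "b \<notin> set (pre @ [j])" using jp by auto
      ultimately have "HF y ?z ?zi ?s i = 1"
        using P(2) yb(1) unfolding s 3 by (simp only: HF_inner[OF b] pz) simp
      moreover have "j \<notin> set post'" if s': "?s = pre' @ i # b' # post'" for pre' b' post'
      proof -
        have 1: "distinct ((pre @ [j]) @ b # c # t)" using d Cons by simp
        have 2: "(pre @ [j]) @ b # c # t = pre' @ b # b' # post'" using s' 3 Cons by simp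
        from distinct_split_unique[OF 1 2] show ?thesis using jp Cons by simp
      qed
      ultimately show ?thesis by (intro poly) auto
    qed
  next
    case 4
    then obtain t1 t2 where post: "post = t1 @ i # t2" "i \<notin> set t1" by (meson split_list_first)
    have s: "?s = (pre @ j # b # t1) @ i # t2" using post by simp
    have i: "i \<notin> set (pre @ j # b # t1)" using d post by auto
    \<comment> \<open>The variable before \<open>i\<close> belongs to \<open>b\<close> or to
      \<open>post\<close>, hence is negative. For a last \<open>i\<close> both summands are then
      negative; otherwise the next variable is negative too and the product is positive.\<close>
    have "lastz ?z 1 (pre @ j # b # t1) = lastz z (- 1) t1" using jp zb post by simp
    then have neg: "lastz ?z 1 (pre @ j # b # t1) < 0" using lzn[of t1] post by auto
    have n: "j \<notin> set post'" if s': "?s = pre' @ i # b' # post'" for pre' b' post'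
    proof -
      have 1: "distinct ((pre @ j # b # t1) @ i # t2)" using d unfolding s .
      have 2: "(pre @ j # b # t1) @ i # t2 = pre' @ i # b' # post'" using s' unfolding s .
      from distinct_split_unique[OF 1 2] show ?thesis using jp post by auto
    qed
    show ?thesis
    proof (cases t2)
      case Nil
      have s: "?s = (pre @ j # b # t1) @ [i]" using s Nil by simp
      have "(\<Prod>k\<in>- insert i (set (pre @ j # b # t1)). ?z k) = 1"
        by (intro prod.neutral) (auto simp: z1 post Nil)
      moreover have "BB y (pre @ j # b # t1) = - 1" using By[of "pre @ j # b # t1"] d post by auto
      moreover have "y i = 1" using i yb by auto
      ultimately have "HF y ?z ?zi ?s i = lastz ?z 1 (pre @ j # b # t1) - 1"
        unfolding s HF_last[OF i] by simp
      then show ?thesis using neg n by (intro poly) auto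
    next
      case (Cons c t)
      have s: "?s = (pre @ j # b # t1) @ i # c # t" using s Cons by simp
      have "?z c < 0" using zn[of c] jp post Cons by auto
      then have "0 < lastz ?z 1 (pre @ j # b # t1) * ?z c" using neg by (rule mult_neg_neg[rotated])
      then have "HF y ?z ?zi ?s i > 0"
        unfolding s HF_inner[OF i] power_mult_distrib[symmetric] by (rule add_pos_nonneg) simp
      then show ?thesis using n by (intro poly) auto
    qed
  qed
qed

lemma is_hat_can: "distinct s \<Longrightarrow> is_hat (can s) i (Hl s i)"
proof -
  assume d: "distinct s"
  have "hat_ok s i j" if "j \<noteq> i" for j
  proof (cases j s rule: index_cases)
    case notin
    then show ?thesis using hat_ok_linear[of s j s i] d that by auto
  next
    case (last pre)
    then show ?thesis using hat_ok_linear[of pre j s i] d that by auto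
  next
    case (inner pre b post)
    then show ?thesis using hat_ok_inner[of pre j b post i] d that by auto
  qed
  then show ?thesis
    using Hl_monom[OF d, of i] unfolding is_hat_def hat_ok_def by (auto simp: can_def)
qed

section \<open>Exchange polynomials under mutation\<close>

lemma Hl_linear:
  assumes "distinct (pre @ [l])" "s = pre \<or> s = pre @ [l]"
  shows "Hl s l = laur_A l * lastz laur_var 1 pre + BB laur_A pre * (\<Prod>j\<in>- insert l (set pre). laur_var j)"
  using assms by (auto simp: Hl_def HF_notin HF_last)

text \<open>The product of the outside variables contains \<open>X_j\<close>, so its summand is
  dropped.\<close>

lemma set_zero_linear_outside:
  assumes d: "distinct (pre @ [l])" "s = pre \<or> s = pre @ [l]" and j: "j \<notin> set pre" "j \<noteq> l"
  shows "laur_set_zero j (Hl s l) = laur_A l * lastz laur_var 1 pre"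
proof -
  have "- insert l (set pre) = insert j (- insert j (insert l (set pre)))" using j by auto
  then have "(\<Prod>k\<in>- insert l (set pre). laur_var k) = laur_var j * (\<Prod>k\<in>- insert j (insert l (set pre)). laur_var k)"
    by (metis Compl_iff finite insertI1 prod.insert)
  then have "Hl s l = laur_A l * lastz laur_var 1 pre + laur_var j * (BB laur_A pre * (\<Prod>k\<in>- insert j (insert l (set pre)). laur_var k))"
    unfolding Hl_linear[OF d] by (simp add: mult.left_commute)
  then show ?thesis
    using j last_in_set[of pre]
    by (simp only:) (intro laur_set_zero_split free.intros nonneg.intros, auto)
qed

text \<open>Now \<open>X_j\<close> is the last variable \<open>z\<close>, and the summand
  \<open>A_l z\<close> is dropped.\<close>

lemma set_zero_linear_last:
  assumes d: "distinct (pre @ [j, l])" "s = pre @ [j] \<or> s = pre @ [j, l]"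
  shows "laur_set_zero j (Hl s l) = BB laur_A (pre @ [j]) * (\<Prod>k\<in>- set (pre @ [j, l]). laur_var k)"
proof -
  have "- insert l (set (pre @ [j])) = - set (pre @ [j, l])" by auto
  then have "Hl s l = BB laur_A (pre @ [j]) * (\<Prod>k\<in>- set (pre @ [j, l]). laur_var k) + laur_var j * laur_A l"
    using Hl_linear[of "pre @ [j]" l s] d by (simp add: mult.commute add.commute)
  then show ?thesis
    using d by (simp only:) (intro laur_set_zero_split free.intros nonneg.intros, auto)
qed

lemma set_zero_linear_earlier:
  assumes d: "distinct (pre @ [l])" "s = pre \<or> s = pre @ [l]" and j: "j \<in> set pre" "last pre \<noteq> j"
  shows "laur_set_zero j (Hl s l) = Hl s l"
  using j unfolding Hl_linear[OF d] by (intro laur_set_zero_free free.intros) auto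

text \<open>\<open>X_b\<close> occurs in the product with \<open>z\<close> and, if
  \<open>post\<close> is nonempty, in the outermost bracket of \<open>PP\<close>. At
  \<open>X_b = 0\<close> that bracket reduces to its second term, so \<open>PP\<close> becomes
  \<open>B1 * q\<^sup>2 / X_c\<close>, with \<open>B1\<close> and \<open>q\<close> as in the
  proof.\<close>

lemma set_zero_inner_next:
  fixes pre :: "'n::{finite,linorder} list"
  assumes d: "distinct (pre @ l # b # post)"
  defines "P \<equiv> \<Prod>k\<in>- set (pre @ l # b # post). laur_var k"
  shows "laur_set_zero b (Hl (pre @ l # b # post) l) = (BB laur_A pre)\<^sup>2 *
    (case post of [] \<Rightarrow> P | c # t \<Rightarrow> BB laur_A pre * laur_A l * laur_A b *
       (PP laur_A laur_var laur_inv P (laur_var c) (BB laur_A pre * laur_A l * laur_A b * laur_A c) t)\<^sup>2 * laur_inv c)\<^sup>2"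
proof -
  let ?B = "BB laur_A pre"
  define z :: "'n laur" where "z = lastz laur_var 1 pre"
  have l: "l \<notin> set pre" using d by auto
  have Pf: "expo_in {0} b P" "expo_in {0..} b P" unfolding P_def by (auto intro!: free.intros nonneg.intros)
  have zf: "expo_in {0} b z" "expo_in {0..} b z"
    unfolding z_def using d last_in_set[of pre] by (auto intro!: free.intros nonneg.intros)
  show ?thesis
  proof (cases post)
    case Nil
    have "Hl (pre @ l # b # post) l = ?B\<^sup>2 * P\<^sup>2 + laur_var b * z"
      unfolding Hl_def HF_inner[OF l] P_def Nil z_def by (simp add: mult.commute add.commute)
    then show ?thesis using Pf zf unfolding Nil
      by (simp only: list.case) (intro laur_set_zero_split free.intros nonneg.intros)
  next
    case (Cons c t)
    define B1 where "B1 = ?B * laur_A l * laur_A b"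
    define q where "q = PP laur_A laur_var laur_inv P (laur_var c) (B1 * laur_A c) t"
    have bc: "b \<noteq> c" "b \<notin> set t" using d Cons by auto
    have B1f: "expo_in {0} b B1" "expo_in {0..} b B1" unfolding B1_def by (auto intro!: free.intros nonneg.intros)
    have qf: "expo_in {0} b q" "expo_in {0..} b q"
      unfolding q_def using bc Pf B1f by (auto intro!: free.intros nonneg.intros)
    have cf: "expo_in {0} b (laur_inv c)" "expo_in {0..} b (laur_inv c)"
      using bc by (auto intro!: expo_in_inv)
    have vf: "expo_in {0..} b (laur_var b)" by (rule expo_in_var) simp
    have 2: "expo_in {0..} b (2 :: 'n laur)"
      using nonneg.intros(8)[OF nonneg.intros(10) nonneg.intros(10), of b] by (simp only: one_add_one)
    have "Hl (pre @ l # b # c # t) l = z * laur_var b + ?B\<^sup>2 * ((laur_A c * laur_var b + B1 * q) * q * laur_inv c)\<^sup>2"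
      unfolding Hl_def HF_inner[OF l] Cons PP.simps q_def P_def B1_def z_def ..
    also have "\<dots> = ?B\<^sup>2 * (B1 * q\<^sup>2 * laur_inv c)\<^sup>2 +
      laur_var b * (z + ?B\<^sup>2 * (laur_A c * q * laur_inv c * (laur_A c * laur_var b * q * laur_inv c + 2 * (B1 * q * q * laur_inv c))))"
      by (simp add: power2_eq_square algebra_simps)
    finally have H: "Hl (pre @ l # b # c # t) l = \<dots>" .
    show ?thesis unfolding Cons H list.case
      unfolding B1_def[symmetric] q_def[symmetric]
      by (intro laur_set_zero_split free.intros nonneg.intros B1f qf cf vf 2 zf)
  qed
qed

lemma set_zero_inner_last:
  fixes pre :: "'n::{finite,linorder} list"
  assumes d: "distinct (pre @ j # l # b # post)"
  shows "laur_set_zero j (Hl (pre @ j # l # b # post) l) = (BB laur_A (pre @ [j]))\<^sup>2 *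
     (PP laur_A laur_var laur_inv (\<Prod>k\<in>- set (pre @ j # l # b # post). laur_var k) (laur_var b)
        (BB laur_A (pre @ [j]) * laur_A l * laur_A b) post)\<^sup>2"
proof -
  have l: "l \<notin> set (pre @ [j])" using d by auto
  have s: "pre @ j # l # b # post = (pre @ [j]) @ l # b # post" by simp
  have "Hl (pre @ j # l # b # post) l = (BB laur_A (pre @ [j]))\<^sup>2 *
     (PP laur_A laur_var laur_inv (\<Prod>k\<in>- set (pre @ j # l # b # post). laur_var k) (laur_var b)
        (BB laur_A (pre @ [j]) * laur_A l * laur_A b) post)\<^sup>2 + laur_var j * laur_var b"
    unfolding Hl_def s HF_inner[OF l] by (simp add: add.commute)
  then show ?thesis using d
    by (simp only:) (intro laur_set_zero_split free.intros nonneg.intros, auto)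
qed

lemma set_zero_inner_earlier:
  fixes pre :: "'n::{finite,linorder} list"
  assumes d: "distinct (pre @ l # b # post)" and j: "j \<in> set pre" "last pre \<noteq> j"
  shows "laur_set_zero j (Hl (pre @ l # b # post) l) = Hl (pre @ l # b # post) l"
proof -
  have l: "l \<notin> set pre" and jb: "b \<noteq> j" "j \<notin> set post" using d j by auto
  show ?thesis unfolding Hl_def HF_inner[OF l]
    using jb j by (intro laur_set_zero_free free.intros) auto
qed

lemma not_involvesI: "EV mpol_A (mpol_var(i := 0)) p = p \<Longrightarrow> \<not> involves p i"
  by (simp add: not_involves_iff sub0_def)

text \<open>Evaluation at a point with nonzero coordinates is a homomorphism on the Laurent ring, so
  a unit cannot vanish there.\<close>

lemma nonunitI:
  fixes p :: "'n::{finite,linorder} mpol" and z :: "'n \<Rightarrow> rat"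
  assumes "EV y z p = 0" "\<And>k. z k \<noteq> 0" shows "\<not> mpol_to_laur p dvd 1"
proof
  assume "mpol_to_laur p dvd 1"
  from rhom_dvd[OF rhom_LV[of z y, OF assms(2)] this] show False
    using assms by (simp add: LV_mpol_to_laur rhomD(2)[OF rhom_LV[of z y, OF assms(2)]])
qed

lemma prime_nonunit: "prime_elem F \<Longrightarrow> (\<And>k. \<not> mpol_var k dvd F) \<Longrightarrow> \<not> mpol_to_laur F dvd 1"
  for F :: "'n::{finite,linorder} mpol"
  using mpol_to_laur_dvdD[of F 1] prime_elem_not_unit[of F] by (auto simp: rhomD(2))

text \<open>
  How \<open>F\<^sub>j\<close> changes under mutation at \<open>l\<close>: substituting for \<open>X\<^sub>l\<close> turns \<open>F\<^sub>j\<close> into a power of \<open>p\<close>, times a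
  monomial, times the exchange polynomial of \<open>s'\<close> with index \<open>\<sigma> j\<close>.
\<close>

definition exch_rel :: "'n::{finite,linorder} list \<Rightarrow> 'n \<Rightarrow> ('n \<Rightarrow> 'n) \<Rightarrow> 'n list \<Rightarrow> 'n \<Rightarrow> bool" where
  "exch_rel s l \<sigma> s' j \<longleftrightarrow> involves (Fp s j) l \<and> involves (Fp s' (\<sigma> j)) (\<sigma> l) \<and>
     (\<exists>p m u. \<not> involves p l \<and> \<not> involves p j \<and> p \<noteq> 0 \<and>
       (p = 1 \<or> \<not> mpol_to_laur p dvd 1 \<and> mpol_to_laur p dvd laur_set_zero j (Hl s l)) \<and> is_mono j u \<and>
       FF amb_A (amb_var(l := lemb (laur_set_zero j (Hl s l)) / amb_var l)) s j =
         emb p ^ m * (u * FF amb_A (\<lambda>k. amb_var (\<sigma> k)) s' (\<sigma> j)))"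

lemma exch_relI:
  assumes "involves (Fp s j) l" "involves (Fp s' (\<sigma> j)) (\<sigma> l)" "laur_set_zero j (Hl s l) = Q"
    "\<not> involves p l" "\<not> involves p j" "p \<noteq> 0" "p = 1 \<or> \<not> mpol_to_laur p dvd 1 \<and> mpol_to_laur p dvd Q" "is_mono j u"
    "FF amb_A (amb_var(l := lemb Q / amb_var l)) s j = emb p ^ m * (u * FF amb_A (\<lambda>k. amb_var (\<sigma> k)) s' (\<sigma> j))"
  shows "exch_rel s l \<sigma> s' j"
  using assms unfolding exch_rel_def by blast

lemma one_not_involves [simp]: "\<not> involves 1 (i :: 'n::{finite,linorder})"
  by (simp add: not_involves_iff rhomD(2))

lemma BB_not_involves [simp]: "\<not> involves (BB mpol_A t) i"
  by (intro not_involvesI) (simp add: rhom_BB)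

lemma BB_nonzero [simp]: "BB mpol_A t \<noteq> 0"
proof -
  have "BB amb_A t \<noteq> 0" by (induction t) auto
  then show ?thesis using rhom_BB[OF rhom_emb, of mpol_A t] by (metis (no_types, lifting) BB_def emb_0_1(1) emb_A map_eq_conv)
qed

lemma emb_BB [simp]: "emb (BB mpol_A t) = BB amb_A t"
  by (simp add: rhom_BB)

lemma mtl_BB [simp]: "mpol_to_laur (BB mpol_A t) = BB laur_A t"
  by (simp add: rhom_BB)

lemma lemb_BB [simp]: "lemb (BB laur_A t) = BB amb_A t"
  by (simp add: rhom_BB)

lemma lemb_lastz [simp]: "lemb (lastz laur_var 1 t) = lastz amb_var 1 t"
  by (simp add: rhom_lastz rhomD(2))

lemma lemb_prod_var [simp]: "lemb (\<Prod>k\<in>S. laur_var k) = (\<Prod>k\<in>S. amb_var k)"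
  by (simp add: rhom_prod)

lemma lemb_PP [simp]: "lemb (PP laur_A laur_var laur_inv P z B t) = PP amb_A amb_var (\<lambda>k. inverse (amb_var k)) (lemb P) (lemb z) (lemb B) t"
  by (simp add: rhom_PP)

lemma EV_BB_zero: "a \<in> set t \<Longrightarrow> EV ((\<lambda>_. 1)(a := 0)) z (BB mpol_A t) = (0 :: 'r::comm_ring_1)"
proof -
  have "a \<in> set t \<Longrightarrow> BB ((\<lambda>_. 1)(a := 0)) t = (0 :: 'r)" by (induction t) auto
  then show "a \<in> set t \<Longrightarrow> ?thesis" by (simp add: rhom_BB del: fun_upd_apply)
qed

lemma BB_one_or_nonunit:
  fixes t :: "'n::{finite,linorder} list"
  assumes "BB laur_A t dvd Q"
  shows "BB mpol_A t = 1 \<or> \<not> mpol_to_laur (BB mpol_A t) dvd 1 \<and> mpol_to_laur (BB mpol_A t) dvd Q"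
proof (cases t)
  case (Cons a u)
  then have "EV ((\<lambda>_. 1)(a := 0)) (\<lambda>_. 1 :: rat) (BB mpol_A t) = 0" by (intro EV_BB_zero) simp
  then have "\<not> mpol_to_laur (BB mpol_A t) dvd 1" by (rule nonunitI) simp
  then show ?thesis using assms by simp
qed simp

lemma compl_insert_prod:
  fixes x :: "'n::finite \<Rightarrow> 'r::comm_ring_1"
  shows "l \<notin> S \<Longrightarrow> (\<Prod>k\<in>- S. x k) = x l * (\<Prod>k\<in>- insert l S. x k)"
proof -
  assume "l \<notin> S"
  then have "- S = insert l (- insert l S)" by auto
  then show ?thesis by (metis Compl_iff finite insertI1 prod.insert)
qed

lemma compl_insert_prod_upd:
  fixes x :: "'n::finite \<Rightarrow> 'r::comm_ring_1"
  shows "l \<notin> S \<Longrightarrow> (\<Prod>k\<in>- S. (x(l := v)) k) = v * (\<Prod>k\<in>- insert l S. x k)"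
  by (subst compl_insert_prod[of l]) (auto intro!: arg_cong2[where f = "(*)"] prod.cong)

lemma mpol_A_nonzero [simp]: "mpol_A i \<noteq> 0"
  by (metis amb_A_nonzero emb_0_1(1) emb_A)

lemma mpol_A_not_involves [simp]: "\<not> involves (mpol_A i) k"
  by (intro not_involvesI) simp

lemma mpol_A_nonunit: "\<not> mpol_to_laur (mpol_A (i :: 'n::{finite,linorder})) dvd 1"
  by (rule nonunitI[where y = "\<lambda>_. 0" and z = "\<lambda>_. 1"]) simp_all

text \<open>Substituting \<open>A_l z / X_l\<close> into \<open>F_j\<close> leaves the monomial
  \<open>z / X_l\<close> as the only extra factor, so nothing is stripped.\<close>

lemma exch_rel_append_outside:
  assumes d: "distinct s" and l: "l \<notin> set s" and j: "j \<notin> set s" "j \<noteq> l"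
  shows "exch_rel s l (\<lambda>k. k) (s @ [l]) j"
proof (rule exch_relI[where p = 1 and m = 0 and u = "lastz amb_var 1 s / amb_var l"])
  show "involves (Fp s j) l" by (rule involves_Fp_linear[of s]) (use d l j in auto)
  show "involves (Fp (s @ [l]) j) l" by (rule involves_Fp_linear[of "s @ [l]"]) (use d l j in auto)
  show "laur_set_zero j (Hl s l) = laur_A l * lastz laur_var 1 s"
    by (rule set_zero_linear_outside) (use d l j in auto)
  show "is_mono j (lastz amb_var 1 s / amb_var l)"
    using j last_in_set[of s] by (auto intro!: is_mono_intros)
  have "l \<notin> insert j (set s)" using l j by auto
  then have P: "(\<Prod>k\<in>- insert j (set s). (amb_var(l := v)) k) = v * (\<Prod>k\<in>- insert j (set (s @ [l])). amb_var k)" for v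
    by (subst compl_insert_prod_upd) (auto simp: insert_commute)
  show "FF amb_A (amb_var(l := lemb (laur_A l * lastz laur_var 1 s) / amb_var l)) s j =
      emb 1 ^ 0 * (lastz amb_var 1 s / amb_var l * FF amb_A (\<lambda>k. amb_var k) (s @ [l]) j)"
    using l j unfolding FF_notin[OF j(1)] P by (simp add: FF_notin rhomD(4)) (simp add: field_simps)
qed auto

text \<open>\<open>F_j\<close> passes from the linear to the inner kind. Both summands acquire the
  factor \<open>A_j\<close>, which the product of the \<open>A_i\<close> over
  \<open>pre @ [j]\<close> in hat \<open>F_l\<close> also contains.\<close>

lemma exch_rel_append_last:
  assumes d: "distinct (pre @ [j])" and l: "l \<notin> set (pre @ [j])"
  shows "exch_rel (pre @ [j]) l (\<lambda>k. k) (pre @ [j, l]) j"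
proof (rule exch_relI[where p = "mpol_A j" and m = 1 and u = "1 / amb_var l"])
  have d': "distinct (pre @ j # l # [])" using d l by auto
  show "involves (Fp (pre @ [j]) j) l" by (rule involves_Fp_linear[of pre]) (use d l in auto)
  show "involves (Fp (pre @ [j, l]) j) l" by (rule involves_Fp_inner[OF d']) (use d l in auto)
  show "laur_set_zero j (Hl (pre @ [j]) l) = BB laur_A (pre @ [j]) * (\<Prod>k\<in>- set (pre @ [j, l]). laur_var k)"
    by (rule set_zero_linear_last) (use d l in auto)
  show "is_mono j (1 / amb_var l)" using l by (auto intro!: is_mono_intros)
  show "mpol_A j = 1 \<or> \<not> mpol_to_laur (mpol_A j) dvd 1 \<and> mpol_to_laur (mpol_A j) dvd BB laur_A (pre @ [j]) * (\<Prod>k\<in>- set (pre @ [j, l]). laur_var k)"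
    using mpol_A_nonunit by auto
  have j: "j \<notin> set pre" and lj: "l \<notin> insert j (set pre)" using d l by auto
  have P: "(\<Prod>k\<in>- insert j (set pre). (amb_var(l := v)) k) = v * (\<Prod>k\<in>- set (pre @ [j, l]). amb_var k)" for v
    using lj by (subst compl_insert_prod_upd) (auto simp: insert_commute)
  show "FF amb_A (amb_var(l := lemb (BB laur_A (pre @ [j]) * (\<Prod>k\<in>- set (pre @ [j, l]). laur_var k)) / amb_var l)) (pre @ [j]) j =
      emb (mpol_A j) ^ 1 * (1 / amb_var l * FF amb_A (\<lambda>k. amb_var k) (pre @ [j, l]) j)"
    using lj unfolding FF_last[OF j] P FF_inner[OF j] by (simp add: rhomD(4)) (simp add: field_simps power2_eq_square)
qed auto

text \<open>\<open>F_l\<close> does not involve \<open>X_j\<close>, so the substitution is the one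
  of \<open>FF_append\<close> and only a power of \<open>X_l\<close> splits off.\<close>

lemma exch_rel_append_inner:
  assumes d: "distinct (pre @ j # b # post)" and l: "l \<notin> set (pre @ j # b # post)"
  shows "exch_rel (pre @ j # b # post) l (\<lambda>k. k) (pre @ j # b # post @ [l]) j"
proof (rule exch_relI[where p = 1 and m = 0 and u = "1 / amb_var l ^ (2 * 2 ^ length post)"])
  let ?s = "pre @ j # b # post"
  have d': "distinct (pre @ j # b # post @ [l])" using d l by auto
  show "involves (Fp ?s j) l" by (rule involves_Fp_inner[OF d]) (use l in auto)
  show "involves (Fp (pre @ j # b # post @ [l]) j) l" by (rule involves_Fp_inner[OF d']) (use l in auto)
  have "last ?s \<noteq> j" using d last_in_set[of "b # post"] by auto
  then show "laur_set_zero j (Hl ?s l) = Hl ?s l"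
    by (intro set_zero_linear_earlier[of ?s]) (use d l in auto)
  show "is_mono j (1 / amb_var l ^ (2 * 2 ^ length post))" using l by (auto intro!: is_mono_intros)
  have "lemb (Hl ?s l) = FF amb_A amb_var ?s l"
    unfolding lemb_Hl using l by (simp add: HF_notin FF_notin)
  then show "FF amb_A (amb_var(l := lemb (Hl ?s l) / amb_var l)) ?s j =
      emb 1 ^ 0 * (1 / amb_var l ^ (2 * 2 ^ length post) * FF amb_A (\<lambda>k. amb_var k) (pre @ j # b # post @ [l]) j)"
    using FF_append[OF d l, of amb_var amb_A] by simp
qed auto

text \<open>Both summands of \<open>F_j\<close> contain \<open>A_l\<close> after the substitution of
  \<open>A_l z / X_l\<close>; it is the factor stripped.\<close>

lemma exch_rel_butlast_outside:
  assumes d: "distinct (pre @ [l])" and j: "j \<notin> set (pre @ [l])"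
  shows "exch_rel (pre @ [l]) l (\<lambda>k. k) pre j"
proof (rule exch_relI[where p = "mpol_A l" and m = 1 and u = "1 / amb_var l"])
  have d': "distinct (pre @ [j])" using d j by auto
  show "involves (Fp (pre @ [l]) j) l" by (rule involves_Fp_linear[of "pre @ [l]"]) (use d j in auto)
  show "involves (Fp pre j) l" by (rule involves_Fp_linear[of pre]) (use d j in auto)
  show "laur_set_zero j (Hl (pre @ [l]) l) = laur_A l * lastz laur_var 1 pre"
    by (rule set_zero_linear_outside) (use d j in auto)
  show "is_mono j (1 / amb_var l)" using j by (auto intro!: is_mono_intros)
  show "mpol_A l = 1 \<or> \<not> mpol_to_laur (mpol_A l) dvd 1 \<and> mpol_to_laur (mpol_A l) dvd laur_A l * lastz laur_var 1 pre"
    using mpol_A_nonunit by auto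
  have jp: "j \<notin> set pre" and lj: "l \<notin> insert j (set pre)" using d j by auto
  have P: "(\<Prod>k\<in>- insert j (set pre). amb_var k) = amb_var l * (\<Prod>k\<in>- insert j (set (pre @ [l])). amb_var k)"
    using lj by (subst compl_insert_prod[of l]) (auto simp: insert_commute)
  have P': "(\<Prod>k\<in>- insert j (set (pre @ [l])). (amb_var(l := v)) k) = (\<Prod>k\<in>- insert j (set (pre @ [l])). amb_var k)" for v
    by (intro prod.cong) auto
  show "FF amb_A (amb_var(l := lemb (laur_A l * lastz laur_var 1 pre) / amb_var l)) (pre @ [l]) j =
      emb (mpol_A l) ^ 1 * (1 / amb_var l * FF amb_A (\<lambda>k. amb_var k) pre j)"
    unfolding FF_notin[OF jp] FF_notin[OF j] P P' by (simp add: rhomD(4)) (simp add: field_simps)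
qed auto

text \<open>Converse of the passage from linear to inner: the product of the \<open>A_i\<close> over
  \<open>pre\<close> is stripped, and the product of the outside variables is a monomial.\<close>

lemma exch_rel_butlast_last:
  assumes d: "distinct (pre @ [j, l])"
  shows "exch_rel (pre @ [j, l]) l (\<lambda>k. k) (pre @ [j]) j"
proof (rule exch_relI[where p = "BB mpol_A pre" and m = 1 and u = "(\<Prod>k\<in>- set (pre @ [j, l]). amb_var k) / amb_var l"])
  let ?Q = "BB laur_A (pre @ [j]) * (\<Prod>k\<in>- set (pre @ [j, l]). laur_var k)"
  show "involves (Fp (pre @ [j, l]) j) l" by (rule involves_Fp_inner[OF d]) (use d in auto)
  show "involves (Fp (pre @ [j]) j) l" by (rule involves_Fp_linear[of pre]) (use d in auto)
  show "laur_set_zero j (Hl (pre @ [j, l]) l) = ?Q" by (rule set_zero_linear_last) (use d in auto)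
  show "is_mono j ((\<Prod>k\<in>- set (pre @ [j, l]). amb_var k) / amb_var l)" using d by (auto intro!: is_mono_intros)
  show "BB mpol_A pre = 1 \<or> \<not> mpol_to_laur (BB mpol_A pre) dvd 1 \<and> mpol_to_laur (BB mpol_A pre) dvd ?Q"
    by (rule BB_one_or_nonunit) (simp add: mult.assoc)
  have j: "j \<notin> set pre" and lj: "l \<notin> insert j (set pre)" using d by auto
  have P: "(\<Prod>k\<in>- insert j (set pre). amb_var k) = amb_var l * (\<Prod>k\<in>- set (pre @ [j, l]). amb_var k)"
    using lj by (subst compl_insert_prod[of l]) (auto simp: insert_commute)
  have P': "(\<Prod>k\<in>- set (pre @ [j, l]). (amb_var(l := v)) k) = (\<Prod>k\<in>- set (pre @ [j, l]). amb_var k)" for v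
    by (intro prod.cong) auto
  show "FF amb_A (amb_var(l := lemb ?Q / amb_var l)) (pre @ [j, l]) j =
      emb (BB mpol_A pre) ^ 1 * ((\<Prod>k\<in>- set (pre @ [j, l]). amb_var k) / amb_var l * FF amb_A (\<lambda>k. amb_var k) (pre @ [j]) j)"
    using lj unfolding FF_last[OF j] P FF_inner[OF j] P' by (simp add: rhomD(4)) (simp add: field_simps power2_eq_square)
qed auto

lemma FF_notin_upd: "l \<notin> set s \<Longrightarrow> j \<in> set s \<Longrightarrow> last s \<noteq> j \<Longrightarrow> FF A (x(j := v)) s l = FF A x s l"
  by (simp add: FF_notin del: fun_upd_apply)

text \<open>\<open>FF_append\<close> read backwards. Its power of the variable at \<open>l\<close>
  is now a power of \<open>F_l / X_l\<close>, so \<open>F_l\<close> itself is stripped, as often as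
  the exponent \<open>?m\<close> says.\<close>

lemma exch_rel_butlast_inner:
  assumes d: "distinct (pre @ j # b # post @ [l])"
  shows "exch_rel (pre @ j # b # post @ [l]) l (\<lambda>k. k) (pre @ j # b # post) j"
proof -
  let ?s = "pre @ j # b # post @ [l]" and ?s' = "pre @ j # b # post"
  have s: "?s = ?s' @ [l]" by simp
  have d': "distinct ?s'" and l: "l \<notin> set ?s'" using d by auto
  let ?m = "2 * 2 ^ length post :: nat"
  have last: "last ?s' \<noteq> j" using d last_in_set[of "b # post"] by auto
  have W: "Fp ?s l = Fp ?s' l" unfolding Fp_def s FF_last[OF l] FF_notin[OF l] ..
  have Hl: "Hl ?s l = mpol_to_laur (Fp ?s l)"
    unfolding Hl_def mpol_to_laur_Fp s HF_last[OF l] FF_last[OF l] ..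
  show ?thesis
  proof (rule exch_relI[where p = "Fp ?s l" and m = ?m and u = "1 / amb_var l ^ ?m"])
    show "involves (Fp ?s j) l" by (rule involves_Fp_inner[OF d]) (use l in auto)
    show "involves (Fp ?s' j) l" by (rule involves_Fp_inner[OF d']) (use l in auto)
    show "laur_set_zero j (Hl ?s l) = Hl ?s l"
      by (rule set_zero_linear_earlier[of ?s']) (use d last in auto)
    show "is_mono j (1 / amb_var l ^ ?m)" using l by (auto intro!: is_mono_intros)
    show "\<not> involves (Fp ?s l) l" by (rule not_involves_self[OF d])
    show "Fp ?s l \<noteq> 0" using prime_Fp[OF d, of l] by auto
    then have W0: "FF amb_A amb_var ?s' l \<noteq> 0" unfolding W by (simp flip: emb_Fp)
    show "Fp ?s l = 1 \<or> \<not> mpol_to_laur (Fp ?s l) dvd 1 \<and> mpol_to_laur (Fp ?s l) dvd Hl ?s l"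
      unfolding Hl using prime_nonunit[OF prime_Fp[OF d] not_var_dvd_Fp[OF d]] by auto
    have "FF mpol_A (mpol_var(j := 0)) ?s' l = FF mpol_A mpol_var ?s' l"
      by (rule FF_notin_upd) (use l last in auto)
    then have "sub0 j (Fp ?s' l) = Fp ?s' l"
      by (simp only: sub0_def EV_Fp) (simp add: Fp_def)
    then show "\<not> involves (Fp ?s l) j" unfolding W by (simp add: not_involves_iff)
    define x where "x = amb_var(l := FF amb_A amb_var ?s' l / amb_var l)"
    have x: "x k \<noteq> 0" for k using W0 by (simp add: x_def)
    have Fx: "FF amb_A x ?s' l = FF amb_A amb_var ?s' l" unfolding x_def by (rule FF_self[OF d'])
    \<comment> \<open>Exchanging the variable at \<open>l\<close> once more returns to the formal
      variables.\<close>
    have "x(l := FF amb_A x ?s' l / x l) = amb_var" using W0 unfolding Fx by (auto simp: x_def)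
    then have "FF amb_A x ?s j = x l ^ ?m * FF amb_A amb_var ?s' j"
      using FF_append[OF d' l, of x amb_A, OF x] by simp
    also have "x l = emb (Fp ?s l) / amb_var l" unfolding W by (simp add: x_def emb_Fp)
    also have "x = amb_var(l := lemb (Hl ?s l) / amb_var l)" unfolding Hl W by (simp add: x_def emb_Fp)
    finally show "FF amb_A (amb_var(l := lemb (Hl ?s l) / amb_var l)) ?s j =
      emb (Fp ?s l) ^ ?m * (1 / amb_var l ^ ?m * FF amb_A (\<lambda>k. amb_var k) ?s' j)"
      by (simp add: power_divide del: fun_upd_apply)
  qed
qed

lemma not_involves_add: "\<not> involves p i \<Longrightarrow> \<not> involves q i \<Longrightarrow> \<not> involves (p + q) i"
  and not_involves_mult: "\<not> involves p i \<Longrightarrow> \<not> involves q i \<Longrightarrow> \<not> involves (p * q) i"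
  and not_involves_power: "\<not> involves p i \<Longrightarrow> \<not> involves (p ^ n) i"
  and not_involves_var: "k \<noteq> i \<Longrightarrow> \<not> involves (mpol_var k) i"
  for p q :: "'n::{finite,linorder} mpol"
  by (simp_all add: not_involves_iff rhomD(3,4) rhom_power) (simp add: sub0_def)

lemma not_involves_prod: "(\<And>k. k \<in> S \<Longrightarrow> \<not> involves (f k) i) \<Longrightarrow> \<not> involves (prod f S) i"
  for f :: "'a \<Rightarrow> 'n::{finite,linorder} mpol"
  by (induction S rule: infinite_finite_induct) (simp_all add: not_involves_mult)

lemma not_involves_MM: "(i :: 'n::{finite,linorder}) \<notin> set t \<Longrightarrow> \<not> involves (MM mpol_var t) i"
proof (induction t)
  case (Cons c t)
  then show ?case unfolding MM.simps
    by (intro not_involves_mult not_involves_power not_involves_var) auto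
qed simp

lemma not_involves_NN:
  "\<not> involves P i \<Longrightarrow> \<not> involves z i \<Longrightarrow> \<not> involves B i \<Longrightarrow> i \<notin> set t \<Longrightarrow>
    \<not> involves (NN mpol_A mpol_var P z B t) i"
proof (induction t arbitrary: z B)
  case (Cons c t)
  have "\<not> involves (NN mpol_A mpol_var P (mpol_var c) (B * mpol_A c) t) i"
    by (intro Cons.IH not_involves_var not_involves_mult mpol_A_not_involves) (use Cons.prems in auto)
  moreover have "\<not> involves (MM mpol_var t) i" using Cons.prems by (intro not_involves_MM) auto
  ultimately show ?case using Cons.prems(1-3)
    by (simp add: not_involves_mult not_involves_add)
qed simp

lemma NN_amb:
  "NN amb_A amb_var P z B t = PP amb_A amb_var (\<lambda>k. inverse (amb_var k)) P z B t * MM amb_var t"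
  by (rule NN_PP) simp

lemma NN_laur: "NN laur_A laur_var P z B t = PP laur_A laur_var laur_inv P z B t * MM laur_var t"
  by (rule NN_PP) simp

lemma NN_mpol_nonzero: "NN mpol_A mpol_var (\<Prod>k\<in>S. mpol_var k) (mpol_var c) (BB mpol_A r) t \<noteq> 0"
proof
  assume *: "NN mpol_A mpol_var (\<Prod>k\<in>S. mpol_var k) (mpol_var c) (BB mpol_A r) t = 0"
  have "EV (\<lambda>_. 1 :: int) (\<lambda>_. 1) (NN mpol_A mpol_var (\<Prod>k\<in>S. mpol_var k) (mpol_var c) (BB mpol_A r) t) > 0"
    by (simp add: rhom_NN rhom_prod rhom_BB) (rule NN_pos; simp)
  then show False unfolding * by (simp add: rhomD(1))
qed

text \<open>Label \<open>b\<close> now carries the entry \<open>l\<close> of the new sequence, hence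
  the index \<open>swp l b b\<close> on the right. The product of the \<open>A_i\<close> over
  \<open>pre\<close> is stripped, and the product of the outside variables is a monomial.\<close>

lemma exch_rel_swap_next_last:
  assumes d: "distinct (pre @ [l, b])"
  shows "exch_rel (pre @ [l, b]) l (swp l b) (pre @ [b, l]) b"
proof -
  let ?P = "\<Prod>k\<in>- set (pre @ [l, b]). amb_var k"
  let ?Q = "(BB laur_A pre)\<^sup>2 * (\<Prod>k\<in>- set (pre @ [l, b]). laur_var k)\<^sup>2"
  have s: "pre @ [l, b] = (pre @ [l]) @ [b]" "pre @ [b, l] = (pre @ [b]) @ [l]" by simp_all
  have b: "b \<notin> set (pre @ [l])" "l \<notin> set (pre @ [b])" using d by auto
  show ?thesis
  proof (rule exch_relI[where p = "BB mpol_A pre" and m = 1 and u = "?P / amb_var l"])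
    show "involves (Fp (pre @ [l, b]) b) l" by (rule involves_Fp_linear[of "pre @ [l]"]) (use d in auto)
    show "involves (Fp (pre @ [b, l]) (swp l b b)) (swp l b l)"
      using involves_Fp_linear[of "pre @ [b]" l "pre @ [b, l]" b] d by auto
    show "laur_set_zero b (Hl (pre @ [l, b]) l) = ?Q" using set_zero_inner_next[OF d] by simp
    show "is_mono b (?P / amb_var l)" using d by (auto intro!: is_mono_intros)
    show "BB mpol_A pre = 1 \<or> \<not> mpol_to_laur (BB mpol_A pre) dvd 1 \<and> mpol_to_laur (BB mpol_A pre) dvd ?Q"
      by (rule BB_one_or_nonunit) (simp add: power2_eq_square mult.assoc)
    have P1: "(\<Prod>k\<in>- insert b (set (pre @ [l])). (amb_var(l := v)) k) = ?P" for v
      by (intro prod.cong) auto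
    have P2: "(\<Prod>k\<in>- insert l (set (pre @ [b])). amb_var (swp l b k)) = ?P"
      by (intro prod.cong) auto
    have Q: "lemb ?Q = (BB amb_A pre)\<^sup>2 * ?P\<^sup>2"
      unfolding rhomD(4)[OF rhom_lemb] rhom_power[OF rhom_lemb] lemb_BB lemb_prod_var ..
    have "FF amb_A (amb_var(l := v)) (pre @ [l, b]) b = amb_A b * v + BB amb_A (pre @ [l]) * ?P" for v
      using FF_last[OF b(1), of amb_A "amb_var(l := v)"] unfolding P1 by simp
    then have "FF amb_A (amb_var(l := lemb ?Q / amb_var l)) (pre @ [l, b]) b =
        amb_A b * ((BB amb_A pre)\<^sup>2 * ?P\<^sup>2 / amb_var l) + BB amb_A (pre @ [l]) * ?P"
      unfolding Q .
    moreover have "FF amb_A (\<lambda>k. amb_var (swp l b k)) (pre @ [b, l]) (swp l b b) =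
        amb_A l * amb_var l + BB amb_A (pre @ [b]) * ?P"
      unfolding s(2) swp_simps FF_last[OF b(2)] P2 by simp
    ultimately show "FF amb_A (amb_var(l := lemb ?Q / amb_var l)) (pre @ [l, b]) b =
        emb (BB mpol_A pre) ^ 1 * (?P / amb_var l * FF amb_A (\<lambda>k. amb_var (swp l b k)) (pre @ [b, l]) (swp l b b))"
      by (simp only: emb_BB) (simp add: field_simps power2_eq_square)
  qed auto
qed

text \<open>After the substitution both summands contain the square of \<open>p\<close>, the product
  of the \<open>A_i\<close> over \<open>pre\<close>, of \<open>A_l\<close> and of \<open>NN\<close>
  for the tail \<open>t\<close>. A power of \<open>q\<close> would be a Laurent polynomial; taking
  \<open>NN\<close> instead makes \<open>p\<close> a polynomial, at the price of the monomial
  \<open>M\<close>.\<close>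

lemma exch_rel_swap_next_inner:
  assumes d: "distinct (pre @ l # b # c # t)"
  shows "exch_rel (pre @ l # b # c # t) l (swp l b) (pre @ b # l # c # t) b"
proof -
  let ?s = "pre @ l # b # c # t" and ?s' = "pre @ b # l # c # t"
  let ?BA = "pre @ [l, b, c]"
  define P where "P = (\<Prod>k\<in>- set ?s. amb_var k)"
  define pn where "pn = NN mpol_A mpol_var (\<Prod>k\<in>- set ?s. mpol_var k) (mpol_var c) (BB mpol_A ?BA) t"
  define p where "p = BB mpol_A pre * mpol_A l * pn"
  define ql where "ql = PP laur_A laur_var laur_inv (\<Prod>k\<in>- set ?s. laur_var k) (laur_var c) (BB laur_A ?BA) t"
  define q where "q = PP amb_A amb_var (\<lambda>k. inverse (amb_var k)) P (amb_var c) (BB amb_A ?BA) t"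
  define M where "M = MM amb_var t"
  let ?B = "BB amb_A pre"
  define Q where "Q = (BB laur_A pre)\<^sup>2 * (BB laur_A pre * laur_A l * laur_A b * ql\<^sup>2 * laur_inv c)\<^sup>2"
  have lq: "lemb ql = q" unfolding ql_def q_def P_def by (simp del: BB_simps)
  have Q: "lemb Q = ?B\<^sup>2 * (?B * amb_A l * amb_A b * q\<^sup>2 / amb_var c)\<^sup>2"
    unfolding Q_def by (simp add: rhomD(4) rhom_power lq divide_inverse)
  have M0: "M \<noteq> 0" unfolding M_def by (induction t) auto
  have pn: "emb pn = q * M"
    unfolding pn_def q_def M_def P_def by (simp add: rhom_NN rhom_prod NN_amb del: BB_simps)
  have s: "?s = (pre @ [l]) @ b # c # t" "?s' = (pre @ [b]) @ l # c # t" by simp_all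
  have b: "b \<notin> set (pre @ [l])" "l \<notin> set (pre @ [b])" using d by auto
  have lc: "l \<noteq> c" "b \<noteq> c" "l \<notin> set t" "b \<notin> set t" using d by auto
  show ?thesis
  proof (rule exch_relI[where p = p and m = 2 and u = "1 / (M\<^sup>2 * amb_var l * amb_var c)"])
    show "involves (Fp ?s b) l" unfolding s(1) by (rule involves_Fp_inner) (use d in auto)
    show "involves (Fp ?s' (swp l b b)) (swp l b l)"
      unfolding s(2) swp_simps by (rule involves_Fp_inner) (use d in auto)
    show "laur_set_zero b (Hl ?s l) = Q"
      unfolding set_zero_inner_next[OF d] Q_def ql_def by (simp add: mult.assoc)
    show "is_mono b (1 / (M\<^sup>2 * amb_var l * amb_var c))"
      unfolding M_def using d by (auto intro!: is_mono_intros)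
    have ni: "\<not> involves pn i" if "i \<in> set ?s" "i \<noteq> c" "i \<notin> set t" for i
      unfolding pn_def
      by (intro not_involves_NN not_involves_prod not_involves_var BB_not_involves) (use that in auto)
    show "\<not> involves p l" "\<not> involves p b"
      unfolding p_def using ni lc by (simp_all add: not_involves_mult)
    show "p \<noteq> 0" unfolding p_def pn_def by (simp add: NN_mpol_nonzero del: BB_simps)
    have "EV ((\<lambda>_. 1)(l := 0)) (\<lambda>_. 1 :: rat) p = 0" unfolding p_def by (simp add: rhomD(4))
    then have "\<not> mpol_to_laur p dvd 1" by (rule nonunitI) simp
    moreover have "Q = mpol_to_laur p * (BB laur_A pre * (BB laur_A pre)\<^sup>2 * laur_A l * (laur_A b)\<^sup>2 * ql ^ 3 * (laur_inv c)\<^sup>2 * MM laur_inv t)"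
    proof -
      have "mpol_to_laur p = BB laur_A pre * laur_A l * (ql * MM laur_var t)"
        unfolding p_def pn_def ql_def by (simp add: rhomD(4) rhom_NN rhom_prod NN_laur del: BB_simps)
      moreover have "MM laur_var t * MM laur_inv t = 1" using MM_laur_var_inv[of t] by (simp add: mult.commute)
      ultimately show ?thesis unfolding Q_def by algebra
    qed
    ultimately show "p = 1 \<or> \<not> mpol_to_laur p dvd 1 \<and> mpol_to_laur p dvd Q" by auto
    have P1: "(\<Prod>k\<in>- set ((pre @ [l]) @ b # c # t). (amb_var(l := v)) k) = P" for v
      unfolding P_def by (intro prod.cong) auto
    have P2: "(\<Prod>k\<in>- set ((pre @ [b]) @ l # c # t). amb_var (swp l b k)) = P"
      unfolding P_def by (intro prod.cong) auto
    have x1: "(amb_var(l := v)) c = amb_var c" "lastz (amb_var(l := v)) 1 (pre @ [l]) = v" "MM (amb_var(l := v)) t = M" for v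
      using lc by (simp_all add: M_def)
    have x1': "NN amb_A (amb_var(l := v)) P (amb_var c) (BB amb_A (pre @ [l]) * amb_A b * amb_A c) t = q * M" for v
      unfolding q_def M_def NN_amb[symmetric] using lc by (intro NN_cong) (auto simp: mult.assoc)
    have x2: "amb_var (swp l b c) = amb_var c" "lastz (\<lambda>k. amb_var (swp l b k)) 1 (pre @ [b]) = amb_var l"
      using lc by (auto simp: swp_def)
    have x2': "MM (\<lambda>k. amb_var (swp l b k)) t = M"
      unfolding M_def by (rule MM_cong) (use lc in \<open>auto simp: swp_def\<close>)
    have x3: "NN amb_A (\<lambda>k. amb_var (swp l b k)) P (amb_var c) (BB amb_A (pre @ [b]) * amb_A l * amb_A c) t = q * M"
      unfolding q_def M_def NN_amb[symmetric] using lc by (intro NN_cong) (auto simp: swp_def)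
    have "FF amb_A (amb_var(l := lemb Q / amb_var l)) ?s b =
        lemb Q / amb_var l * amb_var c * M\<^sup>2 + (BB amb_A (pre @ [l]))\<^sup>2 * (q * M)\<^sup>2"
      unfolding s(1) FF_inner[OF b(1)] P1 x1 x1' ..
    moreover have "FF amb_A (\<lambda>k. amb_var (swp l b k)) ?s' (swp l b b) =
        amb_var l * amb_var c * M\<^sup>2 + (BB amb_A (pre @ [b]))\<^sup>2 * (q * M)\<^sup>2"
      unfolding s(2) swp_simps FF_inner[OF b(2)] P2 x2 x2' x3 ..
    moreover have "emb p = ?B * amb_A l * (q * M)" unfolding p_def by (simp add: rhomD(4) pn)
    ultimately show "FF amb_A (amb_var(l := lemb Q / amb_var l)) ?s b =
        emb p ^ 2 * (1 / (M\<^sup>2 * amb_var l * amb_var c) * FF amb_A (\<lambda>k. amb_var (swp l b k)) ?s' (swp l b b))"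
      unfolding Q using M0 by (simp add: field_simps power2_eq_square)
  qed
qed

text \<open>Here \<open>z\<close> of hat \<open>F_l\<close> is \<open>X_j\<close>, so hat
  \<open>F_l\<close> at \<open>X_j = 0\<close> is a square. Its root, made polynomial by the
  monomial \<open>M\<close>, is the factor \<open>p\<close>, and it is stripped twice.\<close>

lemma exch_rel_swap_prev:
  assumes d: "distinct (pre @ j # l # b # post)"
  shows "exch_rel (pre @ j # l # b # post) l (swp l b) (pre @ j # b # l # post) j"
proof -
  let ?s = "pre @ j # l # b # post" and ?s' = "pre @ j # b # l # post"
  let ?BA = "pre @ [j, l, b]"
  define P where "P = (\<Prod>k\<in>- set ?s. amb_var k)"
  define pn where "pn = NN mpol_A mpol_var (\<Prod>k\<in>- set ?s. mpol_var k) (mpol_var b) (BB mpol_A ?BA) post"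
  define p where "p = BB mpol_A (pre @ [j]) * pn"
  define ql where "ql = PP laur_A laur_var laur_inv (\<Prod>k\<in>- set ?s. laur_var k) (laur_var b) (BB laur_A ?BA) post"
  define q where "q = PP amb_A amb_var (\<lambda>k. inverse (amb_var k)) P (amb_var b) (BB amb_A ?BA) post"
  define M where "M = MM amb_var post"
  let ?B = "BB amb_A (pre @ [j])"
  define Q where "Q = (BB laur_A (pre @ [j]))\<^sup>2 * ql\<^sup>2"
  have lq: "lemb ql = q" unfolding ql_def q_def P_def by (simp del: BB_simps)
  have Q: "lemb Q = ?B\<^sup>2 * q\<^sup>2"
    unfolding Q_def by (simp add: rhomD(4) rhom_power lq del: BB_simps)
  have M0: "M \<noteq> 0" unfolding M_def by (induction post) auto
  have pn: "emb pn = q * M"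
    unfolding pn_def q_def M_def P_def by (simp add: rhom_NN rhom_prod NN_amb del: BB_simps)
  have j: "j \<notin> set pre" and jn: "j \<noteq> l" "j \<noteq> b" "l \<noteq> b" "l \<notin> set post" "b \<notin> set post" "j \<notin> set post" "l \<notin> set pre" "b \<notin> set pre"
    using d by auto
  have d': "distinct ?s'" using d by auto
  show ?thesis
  proof (rule exch_relI[where p = p and m = 2 and u = "1 / (M\<^sup>2 * (amb_var l)\<^sup>2)"])
    show "involves (Fp ?s j) l" by (rule involves_Fp_inner[OF d]) (use d in auto)
    show "involves (Fp ?s' (swp l b j)) (swp l b l)"
      using involves_Fp_inner[OF d', of b] jn by simp
    show "laur_set_zero j (Hl ?s l) = Q"
      unfolding set_zero_inner_last[OF d] Q_def ql_def by (simp add: mult.assoc)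
    show "is_mono j (1 / (M\<^sup>2 * (amb_var l)\<^sup>2))"
      unfolding M_def using jn by (auto intro!: is_mono_intros)
    have ni: "\<not> involves pn i" if "i \<in> set ?s" "i \<noteq> b" "i \<notin> set post" for i
      unfolding pn_def
      by (intro not_involves_NN not_involves_prod not_involves_var BB_not_involves) (use that in auto)
    show "\<not> involves p l" "\<not> involves p j"
      unfolding p_def using ni jn by (simp_all add: not_involves_mult)
    show "p \<noteq> 0" unfolding p_def pn_def by (simp add: NN_mpol_nonzero del: BB_simps)
    have "EV ((\<lambda>_. 1)(j := 0)) (\<lambda>_. 1 :: rat) p = 0"
      unfolding p_def using EV_BB_zero[of j "pre @ [j]" "\<lambda>_. 1 :: rat"] by (simp add: rhomD(4) del: BB_simps)
    then have "\<not> mpol_to_laur p dvd 1" by (rule nonunitI) simp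
    moreover have "Q = mpol_to_laur p * (BB laur_A (pre @ [j]) * ql * MM laur_inv post)"
    proof -
      have "mpol_to_laur p = BB laur_A (pre @ [j]) * (ql * MM laur_var post)"
        unfolding p_def pn_def ql_def by (simp add: rhomD(4) rhom_NN rhom_prod NN_laur del: BB_simps)
      moreover have "MM laur_var post * MM laur_inv post = 1" using MM_laur_var_inv[of post] by (simp add: mult.commute)
      ultimately show ?thesis unfolding Q_def by algebra
    qed
    ultimately show "p = 1 \<or> \<not> mpol_to_laur p dvd 1 \<and> mpol_to_laur p dvd Q" by auto
    define v where "v = lemb Q / amb_var l"
    let ?x = "amb_var(l := v)" and ?w = "\<lambda>k. amb_var (swp l b k)"
    have P1: "(\<Prod>k\<in>- set ?s. ?x k) = P" unfolding P_def by (intro prod.cong) auto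
    have P2: "(\<Prod>k\<in>- set ?s'. ?w k) = P" unfolding P_def by (intro prod.cong) auto
    have lz: "lastz ?x 1 pre = lastz amb_var 1 pre" "lastz ?w 1 pre = lastz amb_var 1 pre"
      using jn last_in_set[of pre] by (auto simp: lastz_def swp_def)
    have Mw: "MM ?w post = M" "MM ?x post = M"
      unfolding M_def by (intro MM_cong; use jn in \<open>auto simp: swp_def\<close>)+
    have MM: "MM ?x (b # post) = amb_var b * M\<^sup>2" "MM ?w (l # post) = amb_var b * M\<^sup>2"
      unfolding MM.simps Mw using jn by auto
    have NN1: "NN amb_A ?x P (?x l) (BB amb_A pre * amb_A j * amb_A l) (b # post) =
        (amb_A b * v * M + ?B * amb_A l * (q * M)) * (q * M)"
    proof -
      have "NN amb_A ?x P (?x b) (BB amb_A pre * amb_A j * amb_A l * amb_A b) post = q * M"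
        unfolding q_def M_def NN_amb[symmetric] using jn by (intro NN_cong) (auto simp: mult.assoc)
      moreover have "MM ?x post = M" unfolding M_def using jn by simp
      ultimately show ?thesis unfolding NN.simps by (simp only: fun_upd_same) simp
    qed
    have NN2: "NN amb_A ?w P (?w b) (BB amb_A pre * amb_A j * amb_A b) (l # post) =
        (amb_A l * amb_var l * M + ?B * amb_A b * (q * M)) * (q * M)"
    proof -
      have "NN amb_A ?w P (?w l) (BB amb_A pre * amb_A j * amb_A b * amb_A l) post = q * M"
        unfolding q_def M_def NN_amb[symmetric] using jn by (intro NN_cong) (auto simp: swp_def mult.assoc)
      moreover have "MM ?w post = M" unfolding M_def using jn by (intro MM_cong) (auto simp: swp_def)
      ultimately show ?thesis unfolding NN.simps by simp
    qed
    let ?z = "lastz amb_var 1 pre"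
    have F1: "FF amb_A ?x ?s j = ?z * v * (amb_var b * M\<^sup>2)\<^sup>2 +
        (BB amb_A pre)\<^sup>2 * ((amb_A b * v * M + ?B * amb_A l * (q * M)) * (q * M))\<^sup>2"
      unfolding FF_inner[OF j] P1 lz MM NN1 by simp
    have F2: "FF amb_A ?w ?s' (swp l b j) = ?z * amb_var l * (amb_var b * M\<^sup>2)\<^sup>2 +
        (BB amb_A pre)\<^sup>2 * ((amb_A l * amb_var l * M + ?B * amb_A b * (q * M)) * (q * M))\<^sup>2"
      unfolding swp_simps(3)[OF jn(1,2)] FF_inner[OF j] P2 lz MM NN2 by simp
    have p: "emb p = ?B * (q * M)" unfolding p_def by (simp add: rhomD(4) pn del: BB_simps)
    have v: "v = (?B * q)\<^sup>2 / amb_var l" unfolding v_def Q by (simp add: power_mult_distrib)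
    \<comment> \<open>The same identity with all blocks replaced by arbitrary field elements, so
      that clearing denominators does not open the blocks.\<close>
    have *: "z * v * m + c * ((Ab * v * M + B * Al * (q * M)) * (q * M))\<^sup>2 =
        (B * (q * M))\<^sup>2 * (1 / (M\<^sup>2 * x\<^sup>2) * (z * x * m + c * ((Al * x * M + B * Ab * (q * M)) * (q * M))\<^sup>2))"
      if "v = (B * q)\<^sup>2 / x" "x \<noteq> 0" "M \<noteq> 0" for z v m c Ab Al B q M x :: "'a ambient"
      using that(2,3) unfolding that(1) by (simp add: field_simps power2_eq_square)
    show "FF amb_A (amb_var(l := lemb Q / amb_var l)) ?s j =
        emb p ^ 2 * (1 / (M\<^sup>2 * (amb_var l)\<^sup>2) * FF amb_A (\<lambda>k. amb_var (swp l b k)) ?s' (swp l b j))"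
      unfolding v_def[symmetric] F1 F2 p by (rule *[OF v amb_var_nonzero M0])
  qed
qed

text \<open>By \<open>HF_swap\<close>, hat \<open>F_j\<close> takes the form required for the new
  sequence; the difference lies in the squares of \<open>MM\<close>. There \<open>X_l\<close> occurs
  with exponent \<open>m\<close>, so the substitution splits off \<open>F_l\<close> to the power
  \<open>m\<close> and a monomial.\<close>

lemma exch_rel_swap_earlier:
  assumes d: "distinct (pre @ j # c # p @ l # b # post)"
  shows "exch_rel (pre @ j # c # p @ l # b # post) l (swp l b) (pre @ j # c # p @ b # l # post) j"
proof -
  let ?s = "pre @ j # c # p @ l # b # post" and ?s' = "pre @ j # c # p @ b # l # post"
  let ?pre = "pre @ j # c # p"
  define M where "M = MM amb_var post"
  define m :: nat where "m = 2 * 2 ^ length p"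
  have s: "?s = ?pre @ l # b # post" by simp
  have d': "distinct ?s'" using d by auto
  have dl: "distinct (?pre @ l # b # post)" using d by simp
  have l: "l \<notin> set ?pre" using d by auto
  have j: "j \<in> set ?pre" "last ?pre \<noteq> j" using d last_in_set[of p] by auto
  have jn: "j \<notin> set pre" "j \<noteq> l" "j \<noteq> b" "j \<notin> set post" "l \<noteq> b" "l \<notin> set post" "b \<notin> set post" "l \<notin> set p" "b \<notin> set p" using d by auto
  have M0: "M \<noteq> 0" unfolding M_def by (induction post) auto
  obtain a where a: "Hl ?s l = laur_monom a * mpol_to_laur (Fp ?s l)"
    using Hl_monom[OF d] by blast
  have h: "emb (Fp ?s l) = lemb (Hl ?s l) * M\<^sup>2"
    unfolding emb_Fp lemb_Hl M_def s by (rule FF_inner_HF[OF l]) simp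
  have F0: "Fp ?s l \<noteq> 0" using prime_Fp[OF d, of l] by auto
  have h0: "lemb (Hl ?s l) \<noteq> 0" using h F0 by (metis emb_eq_0 mult_zero_left)
  show ?thesis
  proof (rule exch_relI[where p = "Fp ?s l" and m = m and u = "(1 / (M\<^sup>2 * (amb_var l)\<^sup>2)) ^ m"])
    show "involves (Fp ?s j) l" by (rule involves_Fp_inner[OF d]) (use d in auto)
    show "involves (Fp ?s' (swp l b j)) (swp l b l)"
      using involves_Fp_inner[OF d', of b] jn d by auto
    show "laur_set_zero j (Hl ?s l) = Hl ?s l"
      unfolding s by (rule set_zero_inner_earlier[OF dl j])
    show "is_mono j ((1 / (M\<^sup>2 * (amb_var l)\<^sup>2)) ^ m)"
      unfolding M_def using jn by (auto intro!: is_mono_intros)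
    show "\<not> involves (Fp ?s l) l" by (rule not_involves_self[OF d])
    have "FF mpol_A (mpol_var(j := 0)) (?pre @ l # b # post) l = FF mpol_A mpol_var (?pre @ l # b # post) l"
    proof -
      have lz: "lastz (mpol_var(j := 0)) 1 ?pre = lastz mpol_var 1 ?pre" by (rule lastz_upd) (use j(2) in simp)
      show ?thesis unfolding FF_inner[OF l] lz using j(1) jn by simp
    qed
    then have "sub0 j (Fp ?s l) = Fp ?s l" unfolding s by (simp only: sub0_def EV_Fp) (simp only: Fp_def)
    then show "\<not> involves (Fp ?s l) j" by (simp add: not_involves_iff)
    show "Fp ?s l \<noteq> 0" by (rule F0)
    show "Fp ?s l = 1 \<or> \<not> mpol_to_laur (Fp ?s l) dvd 1 \<and> mpol_to_laur (Fp ?s l) dvd Hl ?s l"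
      unfolding a using prime_nonunit[OF prime_Fp[OF d] not_var_dvd_Fp[OF d]] by auto
    define v where "v = lemb (Hl ?s l) / amb_var l"
    let ?x = "amb_var(l := v)" and ?w = "\<lambda>k. amb_var (swp l b k)"
    have x0: "?x k \<noteq> 0" for k using h0 by (simp add: v_def)
    have H: "HF amb_A ?x (\<lambda>k. inverse (?x k)) ?s j = HF amb_A ?w (\<lambda>k. inverse (?w k)) ?s' j"
      by (rule HF_swap[OF d, of "amb_var l" amb_var "lemb (Hl ?s l)"])
        (use h0 jn in \<open>auto simp: lemb_Hl v_def swp_def\<close>)
    have Mp: "MM ?x p = MM amb_var p" "MM ?w p = MM amb_var p" "MM ?x post = M" "MM ?w post = M"
      unfolding M_def using jn by (auto intro!: MM_cong simp: swp_def)
    have M1: "MM ?x (p @ l # b # post) = MM amb_var p * (v * (amb_var b * M\<^sup>2)\<^sup>2) ^ (2 ^ length p)"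
      unfolding MM_append MM.simps Mp using jn by simp
    have M2: "MM ?w (p @ b # l # post) = MM amb_var p * (amb_var l * (amb_var b * M\<^sup>2)\<^sup>2) ^ (2 ^ length p)"
      unfolding MM_append MM.simps Mp using jn by simp
    have "FF amb_A ?x ?s j = HF amb_A ?x (\<lambda>k. inverse (?x k)) ?s j * (MM ?x (p @ l # b # post))\<^sup>2"
      by (rule FF_inner_HF[OF jn(1)]) (rule right_inverse[OF x0])
    moreover have "FF amb_A ?w ?s' j = HF amb_A ?w (\<lambda>k. inverse (?w k)) ?s' j * (MM ?w (p @ b # l # post))\<^sup>2"
      by (rule FF_inner_HF[OF jn(1)]) simp
    moreover have "(MM ?x (p @ l # b # post))\<^sup>2 = emb (Fp ?s l) ^ m * ((1 / (M\<^sup>2 * (amb_var l)\<^sup>2)) ^ m * (MM ?w (p @ b # l # post))\<^sup>2)"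
    proof -
      have "v = emb (Fp ?s l) * (1 / (M\<^sup>2 * (amb_var l)\<^sup>2)) * amb_var l"
        unfolding v_def h using M0 by (simp add: field_simps power2_eq_square)
      then have e: "(v * (amb_var b * M\<^sup>2)\<^sup>2) ^ (2 ^ length p) =
        (emb (Fp ?s l) * (1 / (M\<^sup>2 * (amb_var l)\<^sup>2))) ^ (2 ^ length p) * (amb_var l * (amb_var b * M\<^sup>2)\<^sup>2) ^ (2 ^ length p)"
        by (simp add: power_mult_distrib[symmetric] mult.assoc)
      have gen: "(a * ((F * c) ^ K * y))\<^sup>2 = F ^ (2 * K) * (c ^ (2 * K) * (a * y)\<^sup>2)" for a F c y :: "'a ambient" and K
        unfolding power_even_eq power_mult_distrib by (simp only: mult_ac)
      show ?thesis unfolding M1 M2 m_def e by (rule gen)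
    qed
    ultimately show "FF amb_A (amb_var(l := lemb (Hl ?s l) / amb_var l)) ?s j =
      emb (Fp ?s l) ^ m * ((1 / (M\<^sup>2 * (amb_var l)\<^sup>2)) ^ m * FF amb_A (\<lambda>k. amb_var (swp l b k)) ?s' (swp l b j))"
      unfolding v_def[symmetric] swp_simps(3)[OF jn(2,3)] H by (simp only: mult_ac)
  qed
qed

section \<open>Mutations of the generated seed\<close>

definition ren :: "('n \<Rightarrow> 'n) \<Rightarrow> 'n::{finite,linorder} mpol \<Rightarrow> 'n mpol" where
  "ren \<sigma> = EV mpol_A (\<lambda>k. mpol_var (\<sigma> k))"

text \<open>
  Mutation keeps labels, but exchanging two neighbours of the sequence interchanges the labels of their
  variables, hence the relabelling \<open>\<sigma>\<close>.
\<close>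

definition canp :: "('n \<Rightarrow> 'n) \<Rightarrow> 'n::{finite,linorder} list \<Rightarrow> 'n seed" where
  "canp \<sigma> s = \<lparr>cluster = (\<lambda>k. clu s (\<sigma> k)), exch = (\<lambda>j. ren \<sigma> (Fp s (\<sigma> j)))\<rparr>"

lemma rhom_ren [simp]: "rhom (ren \<sigma>)"
  by (simp add: ren_def)

lemma ren_Fp: "ren \<sigma> (Fp s i) = FF mpol_A (\<lambda>k. mpol_var (\<sigma> k)) s i"
  by (simp add: ren_def)

lemma ren_id [simp]: "ren (\<lambda>k. k) p = p"
  by (simp add: ren_def)

lemma canp_id: "canp (\<lambda>k. k) s = can s"
  by (simp add: canp_def can_def)

lemma EV_ren: "EV y x (ren \<sigma> p) = EV y (\<lambda>k. x (\<sigma> k)) p"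
  by (simp add: ren_def EV_compose_EV)

lemma invol_prime:
  fixes h :: "'a::comm_ring_1 \<Rightarrow> 'a"
  assumes h: "rhom h" "\<And>p. h (h p) = p" and p: "prime_elem p"
  shows "prime_elem (h p)"
proof (rule prime_elemI)
  have dvd: "h a dvd b \<Longrightarrow> a dvd h b" for a b using rhom_dvd[OF h(1), of "h a" b] h(2) by simp
  show "h p \<noteq> 0" using p h(2)[of p] rhomD(1)[OF h(1)] by auto
  show "\<not> h p dvd 1" using dvd[of p 1] p rhomD(2)[OF h(1)] prime_elem_not_unit by auto
  fix a b assume "h p dvd a * b"
  then have "p dvd h a * h b" using dvd rhomD(4)[OF h(1)] by metis
  then have "p dvd h a \<or> p dvd h b" using p prime_elem_dvd_multD by blast
  then show "h p dvd a \<or> h p dvd b" using rhom_dvd[OF h(1)] h(2) by metis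
qed

lemma invol_irreducible:
  fixes h :: "'a::comm_ring_1 \<Rightarrow> 'a"
  assumes h: "rhom h" "\<And>p. h (h p) = p" and p: "irreducible p"
  shows "irreducible (h p)"
proof (rule irreducibleI)
  have u: "h a dvd 1 \<Longrightarrow> a dvd 1" for a using rhom_dvd[OF h(1), of "h a" 1] h(2) rhomD(2)[OF h(1)] by simp
  show "h p \<noteq> 0" using p h(2)[of p] rhomD(1)[OF h(1)] by (auto simp: irreducible_def)
  show "\<not> h p dvd 1" using u p by (auto simp: irreducible_def)
  fix a b assume "h p = a * b"
  then have "p = h a * h b" using h(2) rhomD(4)[OF h(1)] by metis
  then have "h a dvd 1 \<or> h b dvd 1" using p by (auto simp: irreducible_def)
  then show "a dvd 1 \<or> b dvd 1" using u by blast
qed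

context
  fixes \<sigma> :: "'n::{finite,linorder} \<Rightarrow> 'n"
  assumes \<sigma>: "\<And>k. \<sigma> (\<sigma> k) = k"
begin

lemma ren_ren: "ren \<sigma> (ren \<sigma> p) = p"
  by (simp add: ren_def EV_compose_EV \<sigma>)

lemma sub0_ren: "sub0 l (ren \<sigma> p) = ren \<sigma> (sub0 (\<sigma> l) p)"
proof -
  have "(mpol_var(l := 0)) (\<sigma> k) = EV mpol_A (\<lambda>k. mpol_var (\<sigma> k)) ((mpol_var(\<sigma> l := 0)) k)" for k
    using \<sigma>[of k] \<sigma>[of l] by (auto simp: rhomD(1))
  then show ?thesis unfolding sub0_def ren_def EV_compose_EV by simp
qed

lemma involves_ren: "involves (ren \<sigma> p) l \<longleftrightarrow> involves p (\<sigma> l)"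
  using not_involves_iff[of "ren \<sigma> p" l] not_involves_iff[of p "\<sigma> l"] ren_ren unfolding sub0_ren by metis

lemma var_dvd_ren: "mpol_var l dvd ren \<sigma> p \<longleftrightarrow> mpol_var (\<sigma> l) dvd p"
  unfolding var_dvd_iff sub0_ren by (metis ren_ren rhomD(1) rhom_ren)

lemma prime_ren: "prime_elem p \<Longrightarrow> prime_elem (ren \<sigma> p)"
  by (rule invol_prime) (auto simp: ren_ren)

end

text \<open>A polynomial substitution that is its own inverse takes a basis to a basis. It is
  applied to permutations of the cluster and to changes of sign.\<close>

lemma frpol_subst_basis:
  fixes q :: "'n::{finite,linorder} \<Rightarrow> 'n frpol"
  assumes x: "alg_independent x" "generates_ambient x"
    and q: "\<And>k. mpol_eval (Poly_Mapping.single 0) q (q k) = Poly_Mapping.single (Poly_Mapping.single k 1) 1"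
  shows "alg_independent (\<lambda>k. mpol_eval amb_scalar x (q k))" "generates_ambient (\<lambda>k. mpol_eval amb_scalar x (q k))"
proof -
  let ?S = "mpol_eval (Poly_Mapping.single 0) q" and ?y = "\<lambda>k. mpol_eval amb_scalar x (q k)"
  have S: "rhom ?S" using rhom_single0 by (rule rhom_mpol_eval)
  have E: "rhom (mpol_eval amb_scalar z)" for z by simp
  have ev: "mpol_eval amb_scalar ?y p = mpol_eval amb_scalar x (?S p)" for p
  proof (induction p rule: poly_induct)
    case (const c)
    show ?case by (simp add: mpol_eval_single rhom_single0)
  next
    case (var i)
    show ?case by (simp add: mpol_eval_single rhom_single0 prod_power_single rhomD(2)[OF rhom_amb_scalar])
  qed (simp_all add: rhomD[OF E] rhomD[OF S])
  have SS: "?S (?S p) = p" for p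
  proof (induction p rule: poly_induct)
    case (const c)
    show ?case by (simp add: mpol_eval_single rhom_single0)
  next
    case (var i)
    have "?S (Poly_Mapping.single (Poly_Mapping.single i 1) 1) = q i"
      by (simp add: mpol_eval_single rhom_single0 prod_power_single)
    then show ?case by (simp only: q)
  qed (simp_all add: rhomD[OF S])
  show "alg_independent ?y"
    unfolding alg_independent_def ev
  proof (intro allI impI)
    fix p assume "mpol_eval amb_scalar x (?S p) = 0"
    then have "?S p = 0" using x(1) by (simp add: alg_independent_def)
    then show "p = 0" using SS[of p] rhomD(1)[OF S] by simp
  qed
  show "generates_ambient ?y"
    unfolding generates_ambient_def ev
  proof
    fix y
    obtain p d where "mpol_eval amb_scalar x d \<noteq> 0" "y = mpol_eval amb_scalar x p / mpol_eval amb_scalar x d"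
      using x(2) unfolding generates_ambient_def by blast
    then show "\<exists>p d. mpol_eval amb_scalar x (?S d) \<noteq> 0 \<and> y = mpol_eval amb_scalar x (?S p) / mpol_eval amb_scalar x (?S d)"
      by (intro exI[of _ "?S p"] exI[of _ "?S d"]) (simp add: SS)
  qed
qed

lemma is_seed_canp:
  assumes d: "distinct s" and \<sigma>: "\<And>k. \<sigma> (\<sigma> k) = k"
  shows "is_seed (canp \<sigma> s)"
proof -
  let ?q = "\<lambda>k. Poly_Mapping.single (Poly_Mapping.single (\<sigma> k) 1) 1 :: 'a frpol"
  have "mpol_eval (Poly_Mapping.single 0) ?q (?q k) = Poly_Mapping.single (Poly_Mapping.single k 1) 1" for k
    using \<sigma>[of k] by (subst mpol_eval_single) (simp_all add: rhom_single0 prod_power_single)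
  from frpol_subst_basis[of "clu s" ?q, OF _ _ this] clu_basis[OF d]
  have "alg_independent (\<lambda>k. clu s (\<sigma> k))" "generates_ambient (\<lambda>k. clu s (\<sigma> k))"
    by (simp_all only: frpol_eval_var)
  moreover have "irreducible (ren \<sigma> (Fp s i))" for i
    by (intro prime_elem_irreducible prime_ren \<sigma> prime_Fp d)
  ultimately show ?thesis
    using not_involves_self[OF d] not_var_dvd_Fp[OF d]
    by (simp add: is_seed_def canp_def involves_ren[OF \<sigma>] var_dvd_ren[OF \<sigma>])
qed

lemma lemb_mut_G:
  fixes l :: "'n::{finite,linorder}"
  shows "lemb (mut_G (can s) l P j) = FF amb_A (amb_var(l := lemb (laur_set_zero j P) / amb_var l)) s j"
proof -
  have "(\<lambda>k. lemb ((laur_var(l := laur_set_zero j P * laur_monom (Poly_Mapping.single l (- 1)))) k)) =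
    amb_var(l := lemb (laur_set_zero j P) / amb_var l)"
    by (auto simp: rhomD(4) divide_inverse simp flip: laur_inv_def)
  moreover have "(\<lambda>i::'n. lemb (laur_const (indetA i))) = amb_A"
    by (simp add: fun_eq_iff flip: laur_A_def)
  ultimately show ?thesis
    by (simp only: mut_G_def can_def seed.simps mpol_eval_conv_EV[OF rhom_laur_const] rhom_EV_compose[OF rhom_lemb])
      (simp only: EV_Fp)
qed

text \<open>From the cluster equations and one factorisation per index, the first part verifies that
  \<open>canp \<sigma> s'\<close> is a mutation, and the second that any other mutation differs from
  it by signs of exchange polynomials.\<close>

lemma mutation_can:
  fixes \<sigma> :: "'n::{finite,linorder} \<Rightarrow> 'n"
  assumes d: "distinct s" "distinct s'" and \<sigma>: "\<And>k. \<sigma> (\<sigma> k) = k"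
    and cl: "\<And>j. j \<noteq> l \<Longrightarrow> clu s' (\<sigma> j) = clu s j"
    and cll: "clu s' (\<sigma> l) = HF amb_A (clu s) (\<lambda>k. inverse (clu s k)) s l / clu s l"
    and ex: "\<And>j. exch_rel s l \<sigma> s' j \<or> \<not> involves (Fp s j) l \<and> FF mpol_A mpol_var s j = FF mpol_A (\<lambda>k. mpol_var (\<sigma> k)) s' (\<sigma> j)"
  shows "is_mutation l (can s) (canp \<sigma> s')"
    and "is_mutation l (can s) T \<Longrightarrow> cluster T = cluster (canp \<sigma> s') \<and>
      (\<forall>j. exch T j = exch (canp \<sigma> s') j \<or> exch T j = - exch (canp \<sigma> s') j)"
proof -
  have hat: "is_hat (can s) l (Hl s l)" by (rule is_hat_can[OF d(1)])
  have cluster_l: "laur_eval amb_const (cluster (can s)) (Hl s l) / cluster (can s) l = clu s' (\<sigma> l)"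
    unfolding cll laur_eval_amb_const by (simp add: can_def LV_Hl clu_nonzero[OF d(1)])
  define F' where "F' j = ren \<sigma> (Fp s' (\<sigma> j))" for j
  have F'prime: "prime_elem (F' j)" and F'var: "\<not> mpol_var k dvd F' j" for j k
    unfolding F'_def using prime_ren[OF \<sigma>] prime_Fp[OF d(2)] not_var_dvd_Fp[OF d(2)] var_dvd_ren[OF \<sigma>] by auto
  \<comment> \<open>The field identity in \<open>exch_rel\<close> pulled back to the Laurent ring by
    injectivity of \<open>lemb\<close>.\<close>
  have inv: "\<exists>p m e. involves (F' j) l \<and> \<not> involves p l \<and> \<not> involves p j \<and> p \<noteq> 0 \<and>
       (p = 1 \<or> \<not> mpol_to_laur p dvd 1 \<and> mpol_to_laur p dvd laur_set_zero j (Hl s l)) \<and> Poly_Mapping.lookup e j = 0 \<and>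
       mut_G (can s) l (Hl s l) j = mpol_to_laur p ^ m * (laur_monom e * mpol_to_laur (F' j))"
    if "involves (Fp s j) l" for j
  proof -
    have "exch_rel s l \<sigma> s' j" using ex[of j] that by blast
    then obtain p m u where *: "involves (Fp s' (\<sigma> j)) (\<sigma> l)" "\<not> involves p l" "\<not> involves p j" "p \<noteq> 0"
      "p = 1 \<or> \<not> mpol_to_laur p dvd 1 \<and> mpol_to_laur p dvd laur_set_zero j (Hl s l)" "is_mono j u"
      "FF amb_A (amb_var(l := lemb (laur_set_zero j (Hl s l)) / amb_var l)) s j =
         emb p ^ m * (u * FF amb_A (\<lambda>k. amb_var (\<sigma> k)) s' (\<sigma> j))"
      unfolding exch_rel_def by blast
    obtain e where e: "Poly_Mapping.lookup e j = 0" "u = lemb (laur_monom e)" using *(6) by (auto simp: is_mono_def)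
    have "emb (F' j) = FF amb_A (\<lambda>k. amb_var (\<sigma> k)) s' (\<sigma> j)"
      by (simp add: F'_def emb_def EV_ren)
    then have "lemb (mut_G (can s) l (Hl s l) j) = lemb (mpol_to_laur p ^ m * (laur_monom e * mpol_to_laur (F' j)))"
      unfolding lemb_mut_G *(7) e(2) by (simp add: rhomD(4) rhom_power)
    then have "mut_G (can s) l (Hl s l) j = mpol_to_laur p ^ m * (laur_monom e * mpol_to_laur (F' j))"
      unfolding lemb_eq_iff .
    moreover have "involves (F' j) l" unfolding F'_def involves_ren[OF \<sigma>] by (rule *(1))
    ultimately show ?thesis using * e by blast
  qed
  have ninv: "F' j = Fp s j" if "\<not> involves (Fp s j) l" for j
    using ex[of j] that unfolding exch_rel_def F'_def ren_Fp by (auto simp: Fp_def)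
  show "is_mutation l (can s) (canp \<sigma> s')"
    unfolding is_mutation_def
  proof (intro conjI exI[of _ "Hl s l"] allI impI)
    show "is_seed (can s)" by (rule is_seed_can[OF d(1)])
    show "is_seed (canp \<sigma> s')" by (rule is_seed_canp[OF d(2) \<sigma>])
    show "is_hat (can s) l (Hl s l)" by (rule hat)
    show "cluster (canp \<sigma> s') j = cluster (can s) j" if "j \<noteq> l" for j
      using cl[OF that] by (simp add: canp_def can_def)
    show "cluster (canp \<sigma> s') l = laur_eval amb_const (cluster (can s)) (Hl s l) / cluster (can s) l"
      unfolding cluster_l by (simp add: canp_def)
    fix j
    have F'j: "exch (canp \<sigma> s') j = F' j" by (simp add: canp_def F'_def)
    show "if \<not> involves (exch (can s) j) l then exch (canp \<sigma> s') j = exch (can s) j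
        else \<exists>H e. strip_common l j (laur_set_zero j (Hl s l)) (mut_G (can s) l (Hl s l) j) H \<and>
          Poly_Mapping.lookup e j = 0 \<and> mpol_to_laur (exch (canp \<sigma> s') j) = laur_monom e * H \<and>
          (\<forall>k. \<not> mpol_var k dvd exch (canp \<sigma> s') j)"
    proof (cases "involves (Fp s j) l")
      case True
      from inv[OF this] obtain p m e where *: "involves (F' j) l" "\<not> involves p l" "\<not> involves p j"
        "p = 1 \<or> \<not> mpol_to_laur p dvd 1 \<and> mpol_to_laur p dvd laur_set_zero j (Hl s l)" "Poly_Mapping.lookup e j = 0"
        "mut_G (can s) l (Hl s l) j = mpol_to_laur p ^ m * (laur_monom e * mpol_to_laur (F' j))" by blast
      from exchange_step_ex[OF F'prime F'var *] show ?thesis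
        using True F'var by (simp add: F'j can_def)
    next
      case False
      then show ?thesis using ninv[OF False] by (simp add: F'j can_def)
    qed
  qed
  assume T: "is_mutation l (can s) T"
  then obtain P where P: "is_hat (can s) l P" "\<And>j. j \<noteq> l \<Longrightarrow> cluster T j = cluster (can s) j"
    "cluster T l = laur_eval amb_const (cluster (can s)) P / cluster (can s) l"
    and Tex: "\<And>j. if \<not> involves (exch (can s) j) l then exch T j = exch (can s) j
         else (\<exists>H (e :: 'n \<Rightarrow>\<^sub>0 int).
                 strip_common l j (laur_set_zero j P) (mut_G (can s) l P j) H \<and>
                 Poly_Mapping.lookup e j = 0 \<and>
                 mpol_to_laur (exch T j) = laur_monom e * H \<and>
                 (\<forall>k. \<not> mpol_var k dvd exch T j))"
    unfolding is_mutation_def by blast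
  have seeds: "is_seed (can s)" "is_seed T" using T by (auto simp: is_mutation_def)
  have PH: "P = Hl s l" by (rule is_hat_unique[OF seeds(1) P(1) hat])
  have "cluster T j = cluster (canp \<sigma> s') j" for j
    using P(2)[of j] P(3) cl[of j] cluster_l unfolding PH by (cases "j = l") (auto simp: canp_def can_def)
  moreover have "exch T j = exch (canp \<sigma> s') j \<or> exch T j = - exch (canp \<sigma> s') j" for j
  proof -
    have F'j: "exch (canp \<sigma> s') j = F' j" by (simp add: canp_def F'_def)
    show ?thesis
    proof (cases "involves (Fp s j) l")
      case True
      from inv[OF this] obtain p m e where *: "involves (F' j) l" "p \<noteq> 0"
        "mut_G (can s) l (Hl s l) j = mpol_to_laur p ^ m * (laur_monom e * mpol_to_laur (F' j))" by blast
      obtain H e' where "strip_common l j (laur_set_zero j (Hl s l)) (mut_G (can s) l (Hl s l) j) H"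
        "mpol_to_laur (exch T j) = laur_monom e' * H"
        using Tex[of j] True unfolding PH by (auto simp: can_def)
      moreover have "irreducible (exch T j)" using seeds(2) by (auto simp: is_seed_def)
      ultimately show ?thesis
        using exchange_step_unique[OF F'prime F'var *] unfolding F'j by blast
    next
      case False
      then show ?thesis using Tex[of j] ninv[OF False] unfolding F'j by (simp add: can_def)
    qed
  qed
  ultimately show "cluster T = cluster (canp \<sigma> s') \<and>
      (\<forall>j. exch T j = exch (canp \<sigma> s') j \<or> exch T j = - exch (canp \<sigma> s') j)"
    by blast
qed

lemma mutate_seq_notin: "l \<notin> set s \<Longrightarrow> mutate_seq l s = s @ [l]"
  by (simp add: mutate_seq_def)

lemma the_index:
  assumes "distinct (pre @ l # t)"
  shows "(THE j. j < length (pre @ l # t) \<and> (pre @ l # t) ! j = l) = length pre"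
proof (rule the_equality)
  fix j assume j: "j < length (pre @ l # t) \<and> (pre @ l # t) ! j = l"
  have "(pre @ l # t) ! j = (pre @ l # t) ! length pre" using j by simp
  then show "j = length pre" using nth_eq_iff_index_eq[OF assms, of j "length pre"] j by simp
qed simp

lemma mutate_seq_last: "distinct (pre @ [l]) \<Longrightarrow> mutate_seq l (pre @ [l]) = pre"
  using the_index[of pre l "[]"] by (simp add: mutate_seq_def Let_def)

lemma mutate_seq_inner: "distinct (pre @ l # b # post) \<Longrightarrow> mutate_seq l (pre @ l # b # post) = pre @ b # l # post"
  using the_index[of pre l "b # post"]
  by (simp add: mutate_seq_def Let_def nth_append list_update_append)

lemma FF_linear_eq:
  assumes "distinct (pre @ [j])" "s = pre \<or> s = pre @ [j]" "s' = pre \<or> s' = pre @ [j]"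
  shows "FF A x s j = FF A x s' j"
  using assms by (auto simp: FF_notin FF_last)

lemma mutation_can_seq:
  fixes s :: "'n::{finite,linorder} list"
  assumes d: "distinct s"
  obtains \<sigma> where "distinct (mutate_seq l s)" "\<And>k. \<sigma> (\<sigma> k) = k" "l \<notin> set s \<Longrightarrow> \<sigma> = (\<lambda>k. k)"
    "\<And>j. j \<noteq> l \<Longrightarrow> clu (mutate_seq l s) (\<sigma> j) = clu s j"
    "clu (mutate_seq l s) (\<sigma> l) = HF amb_A (clu s) (\<lambda>k. inverse (clu s k)) s l / clu s l"
    "\<And>j. exch_rel s l \<sigma> (mutate_seq l s) j \<or> \<not> involves (Fp s j) l \<and> FF mpol_A mpol_var s j = FF mpol_A (\<lambda>k. mpol_var (\<sigma> k)) (mutate_seq l s) (\<sigma> j)"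
proof (cases l s rule: index_cases)
  case notin
  let ?s' = "s @ [l]"
  have d': "distinct ?s'" using d notin by auto
  have cl: "clu ?s' l = HF amb_A (clu s) (\<lambda>k. inverse (clu s k)) s l / clu s l"
    using HF_CL_linear[where A = amb_A and x = amb_var and pre = s and l = l and s = s and xi = "\<lambda>k. inverse (clu s k)"] d' notin by (simp add: CL_notin CL_at)
  have cl': "clu ?s' j = clu s j" if "j \<noteq> l" for j using that by (auto simp: CL_def)
  have ex: "exch_rel s l (\<lambda>k. k) ?s' j \<or> \<not> involves (Fp s j) l \<and> FF mpol_A mpol_var s j = FF mpol_A mpol_var ?s' j" for j
  proof (cases "j = l")
    case True
    then show ?thesis using not_involves_self[OF d] FF_linear_eq[OF d', of s ?s' mpol_A mpol_var] by auto
  next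
    case False
    show ?thesis
    proof (cases j s rule: index_cases)
      case notin
      then show ?thesis using exch_rel_append_outside[OF d] \<open>l \<notin> set s\<close> False by blast
    next
      case (last pre)
      then show ?thesis using exch_rel_append_last[of pre j l] d notin by simp
    next
      case (inner pre b post)
      then show ?thesis using exch_rel_append_inner[of pre j b post l] d notin by simp
    qed
  qed
  show ?thesis
    by (rule that[of "\<lambda>k. k"]) (use d' cl cl' ex in \<open>simp_all add: mutate_seq_notin[OF notin]\<close>)
next
  case (last pre)
  have d': "distinct (pre @ [l])" using d last by simp
  have m: "mutate_seq l s = pre" using mutate_seq_last[OF d'] last by simp
  have "clu s l = ZZ amb_A amb_var (insert l (set pre))" using last d' by (simp add: CL_at)
  moreover have "HF amb_A (clu s) (\<lambda>k. inverse (clu s k)) s l = amb_var l * ZZ amb_A amb_var (insert l (set pre))"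
    using HF_CL_linear[OF amb_A_nonzero amb_var_nonzero d', of s] last by simp
  moreover have "clu s l \<noteq> 0" by (rule clu_nonzero[OF d])
  moreover have "clu pre l = amb_var l" using last by (simp add: CL_notin)
  ultimately have cl: "clu pre l = HF amb_A (clu s) (\<lambda>k. inverse (clu s k)) s l / clu s l" by simp
  have cl': "clu pre j = clu s j" if "j \<noteq> l" for j using that last by (auto simp: CL_def)
  have ex: "exch_rel s l (\<lambda>k. k) pre j \<or> \<not> involves (Fp s j) l \<and> FF mpol_A mpol_var s j = FF mpol_A mpol_var pre j" for j
  proof (cases "j = l")
    case True
    then show ?thesis using not_involves_self[OF d] FF_linear_eq[OF d', of s pre mpol_A mpol_var] last by auto
  next
    case False
    show ?thesis
    proof (cases j pre rule: index_cases)
      case notin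
      then show ?thesis using exch_rel_butlast_outside[OF d'] last False by simp
    next
      case (last p)
      then show ?thesis using exch_rel_butlast_last[of p j l] d' \<open>s = pre @ [l]\<close> by simp
    next
      case (inner p b post)
      then show ?thesis using exch_rel_butlast_inner[of p j b post l] d' \<open>s = pre @ [l]\<close> by simp
    qed
  qed
  show ?thesis
    by (rule that[of "\<lambda>k. k"]) (use d' cl cl' ex last m in simp_all)
next
  case (inner pre b post)
  let ?s' = "pre @ b # l # post"
  have d': "distinct (pre @ l # b # post)" using d inner by simp
  have ds': "distinct ?s'" using d' by auto
  have m: "mutate_seq l s = ?s'" using mutate_seq_inner[OF d'] inner by simp
  have lb: "l \<noteq> b" "l \<notin> set pre" "b \<notin> set pre" "l \<notin> set post" "b \<notin> set post" using d' by auto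
  have sl: "clu s l = ZZ amb_A amb_var (insert l (set pre))" unfolding inner(1) by (rule CL_at[OF lb(2)])
  have "clu s l \<noteq> 0" by (rule clu_nonzero[OF d])
  moreover have "HF amb_A (clu s) (\<lambda>k. inverse (clu s k)) s l = clu s l * ZZ amb_A amb_var (insert b (set pre))"
    unfolding sl unfolding inner(1)
    by (rule HF_CL_inner[OF amb_A_nonzero amb_var_nonzero d' clu_nonzero[OF d']])
  moreover have "clu ?s' b = ZZ amb_A amb_var (insert b (set pre))" by (rule CL_at[OF lb(3)])
  ultimately have cl: "clu ?s' (swp l b l) = HF amb_A (clu s) (\<lambda>k. inverse (clu s k)) s l / clu s l" by simp
  have cl': "clu ?s' (swp l b j) = clu s j" if "j \<noteq> l" for j
  proof (cases "j = b")
    case True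
    have "clu (( pre @ [b]) @ l # post) l = ZZ amb_A amb_var (insert l (set (pre @ [b])))"
      by (rule CL_at) (use lb in auto)
    moreover have "clu ((pre @ [l]) @ b # post) b = ZZ amb_A amb_var (insert b (set (pre @ [l])))"
      by (rule CL_at) (use lb in auto)
    ultimately show ?thesis using True inner(1) by (simp add: insert_commute)
  next
    case jb: False
    have "clu ?s' j = clu s j"
    proof (cases "j \<in> set pre")
      case True
      then show ?thesis unfolding inner(1) by (auto simp: CL_def takeWhile_append1 takeWhile_append)
    next
      case False
      then have "takeWhile (\<lambda>k. k \<noteq> j) (pre @ u) = pre @ takeWhile (\<lambda>k. k \<noteq> j) u" for u
        by (intro takeWhile_append2) auto
      then show ?thesis unfolding inner(1) using that jb False by (auto simp: CL_def insert_commute)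
    qed
    then show ?thesis using that jb by simp
  qed
  have ex: "exch_rel s l (swp l b) ?s' j \<or> \<not> involves (Fp s j) l \<and> FF mpol_A mpol_var s j = FF mpol_A (\<lambda>k. mpol_var (swp l b k)) ?s' (swp l b j)" for j
  proof -
    have P: "(\<Prod>k\<in>- set (pre @ l # b # post). mpol_var k) = (\<Prod>k\<in>- set ?s'. mpol_var (swp l b k))"
      by (intro prod.cong) auto
    consider "j = l" | "j = b" | "j \<in> set pre" | "j \<in> set post" | "j \<notin> set s" "j \<noteq> l" "j \<noteq> b" using inner(1) by auto
    then show ?thesis
    proof cases
      case 1
      \<comment> \<open>\<open>F_l\<close> keeps its form: the variable of the second entry of the
        pair stays in slot \<open>b\<close>, and \<open>A_l * A_b\<close> is symmetric.\<close>
      have lz: "lastz (\<lambda>k. mpol_var (swp l b k)) 1 pre = lastz mpol_var 1 pre"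
        using lb last_in_set[of pre] by (cases "pre = []") (auto simp: lastz_def swp_def)
      have MN: "MM (\<lambda>k. mpol_var (swp l b k)) post = MM mpol_var post"
        "NN mpol_A (\<lambda>k. mpol_var (swp l b k)) p z (B * mpol_A b * mpol_A l) post = NN mpol_A mpol_var p z (B * mpol_A l * mpol_A b) post" for p z B
        using lb by (auto intro!: MM_cong NN_cong simp: swp_def)
      have "FF mpol_A mpol_var (pre @ l # b # post) l = FF mpol_A (\<lambda>k. mpol_var (swp l b k)) ?s' b"
        unfolding FF_inner[OF lb(2)] FF_inner[OF lb(3)] lz MN P[symmetric] by simp
      then show ?thesis using 1 not_involves_self[OF d] inner(1) by simp
    next
      case 2
      then show ?thesis
        using exch_rel_swap_next_last[of pre l b] exch_rel_swap_next_inner[of pre l b] d' inner(1)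
        by (cases post) auto
    next
      case 3
      then obtain p0 p1 where p: "pre = p0 @ j # p1" by (meson split_list)
      show ?thesis
        using exch_rel_swap_prev[of p0 j l b post] exch_rel_swap_earlier[of p0 j _ _ l b post] d' inner(1) p
        by (cases p1) auto
    next
      case 4
      then obtain t1 t2 where t: "post = t1 @ j # t2" by (meson split_list)
      let ?w = "\<lambda>k. mpol_var (swp l b k)"
      have jn: "j \<noteq> l" "j \<noteq> b" using 4 lb by auto
      have s: "pre @ l # b # post = (pre @ l # b # t1) @ j # t2" "?s' = (pre @ b # l # t1) @ j # t2" using t by simp_all
      have j: "j \<notin> set (pre @ l # b # t1)" "j \<notin> set (pre @ b # l # t1)" using d' t by auto
      have t1: "l \<notin> set t1" "b \<notin> set t1" "l \<notin> set t2" "b \<notin> set t2" using lb t by auto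
      \<comment> \<open>An index after the pair sees the earlier entries only through the product of
        their \<open>A_i\<close> and the last variable, which stays in the same slot;
        \<open>X_l\<close> does not occur.\<close>
      have lz: "lastz ?w 1 (pre @ b # l # t1) = lastz mpol_var 1 (pre @ l # b # t1)"
        using t1 last_in_set[of t1] by (cases "t1 = []") (auto simp: lastz_def swp_def)
      have lz0: "lastz (mpol_var(l := 0)) 1 (pre @ l # b # t1) = lastz mpol_var 1 (pre @ l # b # t1)"
        using t1 lb last_in_set[of t1] by (auto simp: lastz_def)
      have BB: "BB mpol_A (pre @ b # l # t1) = BB mpol_A (pre @ l # b # t1)" by simp
      have "FF mpol_A mpol_var (pre @ l # b # post) j = FF mpol_A ?w ?s' j \<and>
         FF mpol_A (mpol_var(l := 0)) (pre @ l # b # post) j = FF mpol_A mpol_var (pre @ l # b # post) j"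
      proof (cases t2)
        case Nil
        have P1: "(\<Prod>k\<in>- insert j (set (pre @ b # l # t1)). ?w k) = (\<Prod>k\<in>- insert j (set (pre @ l # b # t1)). mpol_var k)"
          by (intro prod.cong) auto
        have P2: "(\<Prod>k\<in>- insert j (set (pre @ l # b # t1)). (mpol_var(l := 0)) k) = (\<Prod>k\<in>- insert j (set (pre @ l # b # t1)). mpol_var k)"
          by (intro prod.cong) auto
        show ?thesis unfolding s Nil FF_last[OF j(1)] FF_last[OF j(2)] P1 P2 lz lz0 BB by simp
      next
        case (Cons c t)
        have c: "?w c = mpol_var c" "(mpol_var(l := 0)) c = mpol_var c" "l \<notin> set t" "b \<notin> set t" using t1 Cons by (auto simp: swp_def)
        have P1: "(\<Prod>k\<in>- set ((pre @ b # l # t1) @ j # c # t). ?w k) = (\<Prod>k\<in>- set ((pre @ l # b # t1) @ j # c # t). mpol_var k)"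
          by (intro prod.cong) auto
        have P2: "(\<Prod>k\<in>- set ((pre @ l # b # t1) @ j # c # t). (mpol_var(l := 0)) k) = (\<Prod>k\<in>- set ((pre @ l # b # t1) @ j # c # t). mpol_var k)"
          by (intro prod.cong) auto
        have MN: "MM ?w t = MM mpol_var t" "NN mpol_A ?w p z B t = NN mpol_A mpol_var p z B t"
          "MM (mpol_var(l := 0)) t = MM mpol_var t" "NN mpol_A (mpol_var(l := 0)) p z B t = NN mpol_A mpol_var p z B t" for p z B
          using c(3,4) by (auto intro!: MM_cong NN_cong simp: swp_def)
        show ?thesis unfolding s Cons FF_inner[OF j(1)] FF_inner[OF j(2)] P1 P2 lz lz0 BB c(1,2) MN by simp
      qed
      then have "FF mpol_A mpol_var s j = FF mpol_A ?w ?s' j" "sub0 l (Fp s j) = Fp s j"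
        unfolding inner(1) by (simp_all only: sub0_def EV_Fp) (simp_all only: Fp_def)
      then show ?thesis using jn by (simp add: not_involves_iff)
    next
      case 5
      let ?w = "\<lambda>k. mpol_var (swp l b k)"
      have j: "j \<notin> set (pre @ l # b # post)" "j \<notin> set ?s'" using 5 inner(1) by auto
      have lz: "lastz ?w 1 ?s' = lastz mpol_var 1 (pre @ l # b # post)"
        using lb last_in_set[of post] by (cases "post = []") (auto simp: lastz_def swp_def)
      have lz0: "lastz (mpol_var(l := 0)) 1 (pre @ l # b # post) = lastz mpol_var 1 (pre @ l # b # post)"
        using lb last_in_set[of post] by (auto simp: lastz_def)
      have BB: "BB mpol_A ?s' = BB mpol_A (pre @ l # b # post)" by simp
      have P1: "(\<Prod>k\<in>- insert j (set ?s'). ?w k) = (\<Prod>k\<in>- insert j (set (pre @ l # b # post)). mpol_var k)"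
        by (intro prod.cong) auto
      have P2: "(\<Prod>k\<in>- insert j (set (pre @ l # b # post)). (mpol_var(l := 0)) k) = (\<Prod>k\<in>- insert j (set (pre @ l # b # post)). mpol_var k)"
        by (intro prod.cong) auto
      have "FF mpol_A mpol_var (pre @ l # b # post) j = FF mpol_A ?w ?s' j"
         "FF mpol_A (mpol_var(l := 0)) (pre @ l # b # post) j = FF mpol_A mpol_var (pre @ l # b # post) j"
        unfolding FF_notin[OF j(1)] FF_notin[OF j(2)] P1 P2 lz lz0 BB by simp_all
      then have "FF mpol_A mpol_var s j = FF mpol_A ?w ?s' j" "sub0 l (Fp s j) = Fp s j"
        unfolding inner(1) by (simp_all only: sub0_def EV_Fp) (simp_all only: Fp_def)
      then show ?thesis using 5 by (simp add: not_involves_iff)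
    qed
  qed
  show ?thesis
    by (rule that[of "swp l b"]) (use ds' cl cl' ex inner m in simp_all)
qed

section \<open>Change of signs\<close>

definition signs :: "('n \<Rightarrow> int) \<Rightarrow> bool" where
  "signs \<epsilon> \<longleftrightarrow> (\<forall>k. \<epsilon> k = 1 \<or> \<epsilon> k = - 1)"

lemma signsD: "signs \<epsilon> \<Longrightarrow> \<epsilon> k = 1 \<or> \<epsilon> k = - 1"
  by (simp add: signs_def)

lemma signs_square [simp]: "signs \<epsilon> \<Longrightarrow> of_int (\<epsilon> k) * of_int (\<epsilon> k) = (1 :: 'r::ring_1)"
  using signsD[of \<epsilon> k] by auto

lemma signs_square' [simp]: "signs \<epsilon> \<Longrightarrow> of_int (\<epsilon> k) * (of_int (\<epsilon> k) * a) = (a :: 'r::ring_1)"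
  using signsD[of \<epsilon> k] by auto

lemma signs_nonzero: "signs \<epsilon> \<Longrightarrow> of_int (\<epsilon> k) \<noteq> (0 :: 'r::idom)"
  using signsD[of \<epsilon> k] by auto

lemma signs_upd: "signs \<epsilon> \<Longrightarrow> c = 1 \<or> c = - 1 \<Longrightarrow> signs (\<epsilon>(l := c))"
  by (auto simp: signs_def)

lemma signs_mult: "signs \<epsilon> \<Longrightarrow> signs \<delta> \<Longrightarrow> signs (\<lambda>k. \<epsilon> k * \<delta> k)"
  unfolding signs_def
proof
  fix k assume "\<forall>k. \<epsilon> k = 1 \<or> \<epsilon> k = - 1" "\<forall>k. \<delta> k = 1 \<or> \<delta> k = - 1"
  from this[THEN spec, of k] show "\<epsilon> k * \<delta> k = 1 \<or> \<epsilon> k * \<delta> k = - 1" by auto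
qed

definition sg :: "('n \<Rightarrow> int) \<Rightarrow> 'n::{finite,linorder} mpol \<Rightarrow> 'n mpol" where
  "sg \<epsilon> = EV mpol_A (\<lambda>k. of_int (\<epsilon> k) * mpol_var k)"

lemma rhom_sg [simp]: "rhom (sg \<epsilon>)"
  by (simp add: sg_def)

lemma EV_sg: "EV y x (sg \<epsilon> p) = EV y (\<lambda>k. of_int (\<epsilon> k) * x k) p"
  by (simp add: sg_def EV_compose_EV rhomD(4) rhom_of_int)

lemma sg_sg: "sg \<epsilon> (sg \<delta> p) = sg (\<lambda>k. \<epsilon> k * \<delta> k) p"
  unfolding sg_def EV_compose_EV by (simp add: rhomD(4) rhom_of_int mult_ac)

lemma sg_one: "sg (\<lambda>_. 1) p = p"
  by (simp add: sg_def)

lemma sg_invol: "signs \<epsilon> \<Longrightarrow> sg \<epsilon> (sg \<epsilon> p) = p"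
proof -
  assume s: "signs \<epsilon>"
  have "(\<lambda>k. \<epsilon> k * \<epsilon> k) = (\<lambda>_. 1)" using signs_square[OF s, where 'r = int] by (simp add: fun_eq_iff)
  then show ?thesis by (simp add: sg_sg sg_one)
qed

lemma sub0_sg: "sub0 l (sg \<epsilon> p) = sg \<epsilon> (sub0 l p)"
proof -
  have "EV mpol_A (mpol_var(l := 0)) (of_int (\<epsilon> k) * mpol_var k) = EV mpol_A (\<lambda>k. of_int (\<epsilon> k) * mpol_var k) ((mpol_var(l := 0)) k)" for k
    by (simp add: rhomD(1,4) rhom_of_int)
  then show ?thesis unfolding sub0_def sg_def EV_compose_EV by simp
qed

lemma sg_eq_iff: "signs \<epsilon> \<Longrightarrow> sg \<epsilon> p = sg \<epsilon> q \<longleftrightarrow> p = q"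
  by (metis sg_invol)

lemma involves_sg: "signs \<epsilon> \<Longrightarrow> involves (sg \<epsilon> p) l \<longleftrightarrow> involves p l"
proof -
  assume s: "signs \<epsilon>"
  have "\<not> involves (sg \<epsilon> p) l \<longleftrightarrow> \<not> involves p l"
    unfolding not_involves_iff sub0_sg sg_eq_iff[OF s] ..
  then show ?thesis by blast
qed

lemma sg_upd: "\<not> involves p l \<Longrightarrow> sg (\<epsilon>(l := c)) p = sg \<epsilon> p"
proof -
  assume "\<not> involves p l"
  then have p: "p = sub0 l p" by (simp add: not_involves_iff)
  have "sg (\<epsilon>(l := c)) (sub0 l p) = sg \<epsilon> (sub0 l p)"
    unfolding sub0_def sg_def EV_compose_EV by (intro arg_cong2[where f = "\<lambda>a b. EV a b p"]) (auto simp: rhomD(1))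
  then show ?thesis using p by simp
qed

lemma sign_mult_iffs:
  fixes a :: int and p :: "'n::{finite,linorder} mpol"
  assumes "a = 1 \<or> a = - 1"
  shows "involves (of_int a * p) l \<longleftrightarrow> involves p l" "q dvd of_int a * p \<longleftrightarrow> q dvd p" "irreducible (of_int a * p) \<longleftrightarrow> irreducible p"
proof -
  show "q dvd of_int a * p \<longleftrightarrow> q dvd p" using assms by auto
  show "involves (of_int a * p) l \<longleftrightarrow> involves p l" using assms by (auto simp: involves_def)
  have "irreducible (- p)" if "irreducible p" for p :: "'n mpol"
  proof (rule irreducibleI)
    show "- p \<noteq> 0" "\<not> - p dvd 1" using that by (auto simp: irreducible_def)
    fix a b assume "- p = a * b"
    then have "p = (- a) * b" by (metis minus_minus minus_mult_left)
    then have "- a dvd 1 \<or> b dvd 1" using that unfolding irreducible_def by blast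
    then show "a dvd 1 \<or> b dvd 1" by simp
  qed
  from this[of p] this[of "- p"] show "irreducible (of_int a * p) \<longleftrightarrow> irreducible p" using assms by auto
qed

text \<open>The exchange polynomials are stored as formal polynomials in the slots, so a sign change
  of the cluster has to be compensated by \<open>sg \<epsilon>\<close>. The element of the ambient
  field then changes by \<open>\<delta>\<close> alone.\<close>

definition twist :: "('n \<Rightarrow> int) \<Rightarrow> ('n \<Rightarrow> int) \<Rightarrow> 'n::{finite,linorder} seed \<Rightarrow> 'n seed" where
  "twist \<epsilon> \<delta> S = \<lparr>cluster = (\<lambda>k. of_int (\<epsilon> k) * cluster S k), exch = (\<lambda>j. of_int (\<delta> j) * sg \<epsilon> (exch S j))\<rparr>"

lemma twist_twist: "twist \<epsilon> \<delta> (twist \<epsilon>' \<delta>' S) = twist (\<lambda>k. \<epsilon> k * \<epsilon>' k) (\<lambda>k. \<delta> k * \<delta>' k) S"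
  by (simp add: twist_def fun_eq_iff rhomD(4) rhom_of_int sg_sg mult.assoc)

lemma twist_one: "twist (\<lambda>_. 1) (\<lambda>_. 1) S = S"
  by (simp add: twist_def sg_one)

lemma twist_invol: "signs \<epsilon> \<Longrightarrow> signs \<delta> \<Longrightarrow> twist \<epsilon> \<delta> (twist \<epsilon> \<delta> S) = S"
proof -
  assume s: "signs \<epsilon>" "signs \<delta>"
  have "(\<lambda>k. \<epsilon> k * \<epsilon> k) = (\<lambda>_. 1)" "(\<lambda>k. \<delta> k * \<delta> k) = (\<lambda>_. 1)"
    using signs_square[OF s(1), where 'r = int] signs_square[OF s(2), where 'r = int] by (simp_all add: fun_eq_iff)
  then show ?thesis by (simp add: twist_twist twist_one)
qed

lemma is_seed_twist:
  fixes S :: "'n::{finite,linorder} seed"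
  assumes s: "signs \<epsilon>" "signs \<delta>" and S: "is_seed S"
  shows "is_seed (twist \<epsilon> \<delta> S)"
proof -
  let ?q = "\<lambda>k. of_int (\<epsilon> k) * Poly_Mapping.single (Poly_Mapping.single k 1) 1 :: 'n frpol"
  have h0: "rhom (mpol_eval (Poly_Mapping.single 0) ?q)" using rhom_single0 by (rule rhom_mpol_eval)
  have h1: "rhom (mpol_eval amb_scalar x)" for x by simp
  have "mpol_eval (Poly_Mapping.single 0) ?q (Poly_Mapping.single (Poly_Mapping.single k 1) 1) = ?q k" for k
    by (subst mpol_eval_single) (simp_all add: rhom_single0 prod_power_single)
  then have q: "mpol_eval (Poly_Mapping.single 0) ?q (?q k) = Poly_Mapping.single (Poly_Mapping.single k 1) 1" for k
    unfolding rhomD(4)[OF h0] rhom_of_int[OF h0] by (simp add: s)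
  have e: "mpol_eval amb_scalar x (?q k) = of_int (\<epsilon> k) * x k" for x k
    unfolding rhomD(4)[OF h1] rhom_of_int[OF h1] frpol_eval_var ..
  have "alg_independent (\<lambda>k. of_int (\<epsilon> k) * cluster S k)" "generates_ambient (\<lambda>k. of_int (\<epsilon> k) * cluster S k)"
    using frpol_subst_basis[of "cluster S" ?q, OF _ _ q] S unfolding e by (auto simp: is_seed_def)
  moreover have "irreducible (sg \<epsilon> (exch S i))" for i
    by (rule invol_irreducible[OF rhom_sg sg_invol[OF s(1)]]) (use S in \<open>simp add: is_seed_def\<close>)
  moreover have sg0: "sg \<epsilon> p = 0 \<longleftrightarrow> p = 0" for p
    using sg_eq_iff[OF s(1), of p 0] by (simp add: rhomD(1)[OF rhom_sg])
  moreover have "mpol_var j dvd sg \<epsilon> p \<longleftrightarrow> mpol_var j dvd p" for j p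
    unfolding var_dvd_iff sub0_sg sg0 ..
  ultimately show ?thesis
    using S signsD[OF s(2)] by (simp add: is_seed_def twist_def sign_mult_iffs involves_sg[OF s(1)])
qed

text \<open>The value of the monomial \<open>m\<close> at the signs \<open>\<epsilon>\<close>,
  written with parities to avoid negative powers of integers.\<close>

definition msign :: "('n \<Rightarrow> int) \<Rightarrow> ('n::finite \<Rightarrow>\<^sub>0 int) \<Rightarrow> int" where
  "msign \<epsilon> m = (\<Prod>k\<in>UNIV. if even (Poly_Mapping.lookup m k) then 1 else \<epsilon> k)"

lemma msign_values: "signs \<epsilon> \<Longrightarrow> msign \<epsilon> m = 1 \<or> msign \<epsilon> m = - 1"
proof -
  assume s: "signs \<epsilon>"
  have "(\<Prod>k\<in>S. if even (Poly_Mapping.lookup m k) then 1 else \<epsilon> k) = 1 \<or> (\<Prod>k\<in>S. if even (Poly_Mapping.lookup m k) then 1 else \<epsilon> k) = - 1" if "finite S" for S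
    using that
  proof (induction S rule: finite_induct)
    case (insert k S)
    then show ?case using signsD[OF s, of k] by auto
  qed simp
  then show ?thesis by (simp add: msign_def)
qed

lemma msign_add: "signs \<epsilon> \<Longrightarrow> msign \<epsilon> (m + m') = msign \<epsilon> m * msign \<epsilon> m'"
  unfolding msign_def prod.distrib[symmetric]
  by (intro prod.cong refl) (use signs_square[where 'r = int] in \<open>auto simp: lookup_add\<close>)

lemma msign_upd: "Poly_Mapping.lookup m l = 0 \<Longrightarrow> msign (\<epsilon>(l := c)) m = msign \<epsilon> m"
  unfolding msign_def by (intro prod.cong) auto

text \<open>Multiplies each \<open>X_k\<close> by its sign. It is given through the monomials
  because \<open>laur_eval\<close> takes values in fields only.\<close>

definition sgl :: "('n \<Rightarrow> int) \<Rightarrow> 'n::{finite,linorder} laur \<Rightarrow> 'n laur" where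
  "sgl \<epsilon> = peval laur_const (\<lambda>m. of_int (msign \<epsilon> m) * laur_monom m)"

lemma rhom_sgl [simp]: "signs \<epsilon> \<Longrightarrow> rhom (sgl \<epsilon>)"
  unfolding sgl_def
  by (rule rhom_peval) (auto simp: msign_add laur_monom_add mult_ac, simp add: msign_def)

lemma sgl_single: "sgl \<epsilon> (Poly_Mapping.single m c) = of_int (msign \<epsilon> m) * Poly_Mapping.single m c"
proof -
  have "sgl \<epsilon> (Poly_Mapping.single m c) = laur_const c * (of_int (msign \<epsilon> m) * laur_monom m)"
    unfolding sgl_def by (rule peval_single) (simp add: rhomD(1))
  also have "laur_const c * laur_monom m = Poly_Mapping.single m c" by (simp add: laur_const_def laur_monom_def mult_single)
  then have "laur_const c * (of_int (msign \<epsilon> m) * laur_monom m) = of_int (msign \<epsilon> m) * Poly_Mapping.single m c"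
    by (metis mult.left_commute)
  finally show ?thesis .
qed

lemma lookup_sign: "a = 1 \<or> a = - 1 \<Longrightarrow> Poly_Mapping.lookup (of_int a * p) m = of_int a * Poly_Mapping.lookup p m"
  for p :: "'n::{finite,linorder} laur"
  by auto

lemma lookup_sgl: "signs \<epsilon> \<Longrightarrow> Poly_Mapping.lookup (sgl \<epsilon> p) m = of_int (msign \<epsilon> m) * Poly_Mapping.lookup p m"
proof (induction p rule: poly_mapping_induct)
  case (single k c)
  then show ?case using lookup_sign[OF msign_values[OF single], of k "Poly_Mapping.single k c" m]
    by (auto simp: sgl_single lookup_single when_def)
next
  case (add p q)
  then show ?case by (simp add: rhomD(3) lookup_add distrib_left)
qed

lemma sgl_A [simp]: "sgl \<epsilon> (laur_A i) = laur_A i"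
  unfolding laur_A_def laur_const_def sgl_single by (simp add: msign_def)

lemma msign_single: "msign \<epsilon> (Poly_Mapping.single i 1) = \<epsilon> i" "msign \<epsilon> (Poly_Mapping.single i (- 1)) = \<epsilon> i"
proof -
  have "msign \<epsilon> (Poly_Mapping.single i n) = (\<Prod>k\<in>UNIV. if k = i then \<epsilon> i else 1)" if "odd n" for n
    unfolding msign_def using that by (intro prod.cong) (auto simp: lookup_single when_def)
  then show "msign \<epsilon> (Poly_Mapping.single i 1) = \<epsilon> i" "msign \<epsilon> (Poly_Mapping.single i (- 1)) = \<epsilon> i" by simp_all
qed

lemma sgl_monom: "sgl \<epsilon> (laur_monom e) = of_int (msign \<epsilon> e) * laur_monom e"
  unfolding laur_monom_def sgl_single ..

lemma sgl_X [simp]: "sgl \<epsilon> (laur_var i) = of_int (\<epsilon> i) * laur_var i"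
  unfolding laur_var_def sgl_monom msign_single ..

lemma sgl_Xi [simp]: "sgl \<epsilon> (laur_inv i) = of_int (\<epsilon> i) * laur_inv i"
  unfolding laur_inv_def sgl_monom msign_single ..

lemma sgl_invol: "signs \<epsilon> \<Longrightarrow> sgl \<epsilon> (sgl \<epsilon> p) = p"
proof (rule rhom_laur_eq[where f = "\<lambda>p. sgl \<epsilon> (sgl \<epsilon> p)" and g = "\<lambda>p. p"])
  assume s: "signs \<epsilon>"
  show "rhom (\<lambda>p. sgl \<epsilon> (sgl \<epsilon> p))" by (rule rhom_compose[OF rhom_sgl[OF s] rhom_sgl[OF s]])
  show "sgl \<epsilon> (sgl \<epsilon> (laur_var i)) = laur_var i" for i
    using s by (simp add: rhomD(4) rhom_of_int)
qed simp_all

lemma sgl_mpol_to_laur: "signs \<epsilon> \<Longrightarrow> sgl \<epsilon> (mpol_to_laur p) = mpol_to_laur (sg \<epsilon> p)"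
proof (rule rhom_mpol_eq[where f = "\<lambda>p. sgl \<epsilon> (mpol_to_laur p)" and g = "\<lambda>p. mpol_to_laur (sg \<epsilon> p)"])
  assume s: "signs \<epsilon>"
  show "rhom (\<lambda>p. sgl \<epsilon> (mpol_to_laur p))" by (rule rhom_compose[OF rhom_sgl[OF s] rhom_mpol_to_laur])
  show "rhom (\<lambda>p. mpol_to_laur (sg \<epsilon> p))" by (rule rhom_compose[OF rhom_mpol_to_laur rhom_sg])
qed (simp_all add: sg_def rhomD(4) rhom_of_int)

lemma sgl_dvd: "signs \<epsilon> \<Longrightarrow> sgl \<epsilon> p dvd sgl \<epsilon> q \<longleftrightarrow> p dvd q"
  using rhom_dvd[of "sgl \<epsilon>" p q] rhom_dvd[of "sgl \<epsilon>" "sgl \<epsilon> p" "sgl \<epsilon> q"] by (auto simp: sgl_invol)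

lemma LV_sgl:
  assumes s: "signs \<epsilon>" and x: "\<And>k. x k \<noteq> 0"
  shows "LV y x (sgl \<epsilon> p) = LV y (\<lambda>k. of_int (\<epsilon> k) * x k) (p :: 'n::{finite,linorder} laur)"
proof (rule rhom_laur_eq[where f = "\<lambda>p. LV y x (sgl \<epsilon> p)"])
  have h: "rhom (LV y x)" by (rule rhom_LV) (rule x)
  show "rhom (\<lambda>p. LV y x (sgl \<epsilon> p))" using rhom_compose[OF h rhom_sgl[OF s]] .
  show "rhom (LV y (\<lambda>k. of_int (\<epsilon> k) * x k))" by (rule rhom_LV) (simp add: x signs_nonzero[OF s])
  show "LV y x (sgl \<epsilon> (laur_var i)) = LV y (\<lambda>k. of_int (\<epsilon> k) * x k) (laur_var i)" for i
    by (simp add: rhomD(4)[OF h] rhom_of_int[OF h])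
qed simp

lemma sign_dvd:
  fixes p q :: "'a::comm_ring_1"
  assumes "a = 1 \<or> a = - 1" shows "of_int a * p dvd q \<longleftrightarrow> p dvd q" "p dvd of_int a * q \<longleftrightarrow> p dvd q"
  using assms by auto

text \<open>The same \<open>n\<close> and \<open>R\<close> work at every point \<open>x\<close>.
  This is what turns an equation at the formal variables into an identity of Laurent polynomials
  that can be evaluated elsewhere.\<close>

lemma hat_subst_clear:
  fixes F :: "'n::{finite,linorder} mpol" and P :: "'n laur"
  shows "\<exists>n R. \<forall>x. (\<forall>k. x k \<noteq> 0) \<longrightarrow> EV amb_A x F \<noteq> 0 \<longrightarrow>
    LV amb_A (x(j := EV amb_A x F / x j)) P * EV amb_A x F ^ n = LV amb_A x R"
proof -
  let ?ok = "\<lambda>x. (\<forall>k. x k \<noteq> 0) \<and> EV amb_A x F \<noteq> 0" and ?y = "\<lambda>x. x(j := EV amb_A x F / x j)"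
  have y: "rhom (LV amb_A (?y x))" if "?ok x" for x using that by (intro rhom_LV) auto
  have x: "rhom (LV amb_A x)" if "?ok x" for x :: "'n \<Rightarrow> 'n ambient" using that by (intro rhom_LV) auto
  have FL: "LV amb_A x (mpol_to_laur F) = EV amb_A x F" if "?ok x" for x using that by (intro LV_mpol_to_laur) auto
  have Li: "LV amb_A x (laur_inv i) = inverse (x i)" if "\<forall>k. x k \<noteq> 0" for x :: "'n \<Rightarrow> 'n ambient" and i
    by (rule LV_inv) (use that in blast)
  have "\<exists>n R. \<forall>x. ?ok x \<longrightarrow> LV amb_A (?y x) P * EV amb_A x F ^ n = LV amb_A x R"
  proof (induction P rule: laur_induct)
    case (of_int a)
    have "\<forall>x. ?ok x \<longrightarrow> LV amb_A (?y x) (of_int a) * EV amb_A x F ^ 0 = LV amb_A x (of_int a)"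
      by (auto simp: rhom_of_int[OF y] rhom_of_int[OF x])
    then show ?case by blast
  next
    case (A i)
    have "\<forall>x. ?ok x \<longrightarrow> LV amb_A (?y x) (laur_A i) * EV amb_A x F ^ 0 = LV amb_A x (laur_A i)" by simp
    then show ?case by blast
  next
    case (X i)
    have "\<forall>x. ?ok x \<longrightarrow> LV amb_A (?y x) (laur_var i) * EV amb_A x F ^ 0 = LV amb_A x (if i = j then mpol_to_laur F * laur_inv j else laur_var i)"
      by (auto simp: rhomD(4)[OF x] FL Li divide_inverse)
    then show ?case by blast
  next
    case (Xi i)
    have "LV amb_A (?y x) (laur_inv i) * EV amb_A x F ^ 1 = LV amb_A x (if i = j then laur_var i else mpol_to_laur F * laur_inv i)" if "?ok x" for x
    proof -
      have "LV amb_A (?y x) (laur_inv i) = inverse (?y x i)" using that by (intro Li) auto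
      then show ?thesis using that by (auto simp: rhomD(4)[OF x] FL Li field_simps)
    qed
    then show ?case by blast
  next
    case (add P Q)
    then obtain n R m R' where *: "\<And>x. ?ok x \<Longrightarrow> LV amb_A (?y x) P * EV amb_A x F ^ n = LV amb_A x R"
      "\<And>x. ?ok x \<Longrightarrow> LV amb_A (?y x) Q * EV amb_A x F ^ m = LV amb_A x R'" by blast
    have "LV amb_A (?y x) (P + Q) * EV amb_A x F ^ (n + m) = LV amb_A x (R * mpol_to_laur F ^ m + R' * mpol_to_laur F ^ n)" if "?ok x" for x
      unfolding rhomD(3)[OF y[OF that]] rhomD(3,4)[OF x[OF that]] rhom_power[OF x[OF that]] FL[OF that] *[OF that, symmetric]
      by (simp add: power_add algebra_simps)
    then show ?case by blast
  next
    case (mult P Q)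
    then obtain n R m R' where *: "\<And>x. ?ok x \<Longrightarrow> LV amb_A (?y x) P * EV amb_A x F ^ n = LV amb_A x R"
      "\<And>x. ?ok x \<Longrightarrow> LV amb_A (?y x) Q * EV amb_A x F ^ m = LV amb_A x R'" by blast
    have "LV amb_A (?y x) (P * Q) * EV amb_A x F ^ (n + m) = LV amb_A x (R * R')" if "?ok x" for x
      unfolding rhomD(4)[OF y[OF that]] rhomD(4)[OF x[OF that]] *[OF that, symmetric]
      by (simp add: power_add algebra_simps)
    then show ?case by blast
  qed
  then show ?thesis by blast
qed

text \<open>\<open>is_hat\<close> provides \<open>Q\<close> at the formal variables only, whereas a
  change of signs needs it at the variables with signs. After multiplication by a power of
  \<open>F\<close> both sides are Laurent polynomials, and \<open>F\<close> is nonzero at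
  \<open>x\<close>.\<close>

lemma hat_subst_transfer:
  fixes F :: "'n::{finite,linorder} mpol"
  assumes F: "F \<noteq> 0" and Q: "LV amb_A (amb_var(j := emb F / amb_var j)) P = lemb Q"
    and x: "\<And>k. x k \<noteq> 0" "EV amb_A x F \<noteq> 0"
  shows "LV amb_A (x(j := EV amb_A x F / x j)) P = LV amb_A x Q"
proof -
  obtain n R where R: "\<And>x. (\<And>k. x k \<noteq> 0) \<Longrightarrow> EV amb_A x F \<noteq> 0 \<Longrightarrow>
    LV amb_A (x(j := EV amb_A x F / x j)) P * EV amb_A x F ^ n = LV amb_A x R"
    using hat_subst_clear[of F j P] by blast
  have h: "rhom (LV amb_A x)" by (rule rhom_LV) (rule x(1))
  have "lemb Q * emb F ^ n = lemb R"
    using R[of amb_var] F Q by (simp add: emb_def[symmetric] lemb_def[symmetric])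
  then have "lemb (Q * mpol_to_laur F ^ n) = lemb R" by (simp add: rhomD(4) rhom_power)
  then have "R = Q * mpol_to_laur F ^ n" unfolding lemb_eq_iff by simp
  then have "LV amb_A (x(j := EV amb_A x F / x j)) P * EV amb_A x F ^ n = LV amb_A x Q * EV amb_A x F ^ n"
    using R[OF x] by (simp add: rhomD(4)[OF h] rhom_power[OF h] LV_mpol_to_laur x(1))
  then show ?thesis using x(2) by simp
qed

lemma is_hat_twist:
  fixes S :: "'n::{finite,linorder} seed"
  assumes s: "signs \<epsilon>" "signs \<delta>" and S: "is_seed S" and P: "is_hat S i P"
  obtains c where "c = 1 \<or> c = - 1" "is_hat (twist \<epsilon> \<delta> S) i (of_int c * sgl \<epsilon> P)"
proof -
  obtain a where a: "Poly_Mapping.lookup a i = 0" "\<And>j. Poly_Mapping.lookup a j \<le> 0" "P = laur_monom a * mpol_to_laur (exch S i)"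
    using P unfolding is_hat_def by blast
  \<comment> \<open>The sign of \<open>F_i\<close> and the sign that the monomial \<open>a\<close>
    acquires under \<open>sgl \<epsilon>\<close>.\<close>
  define c where "c = \<delta> i * msign \<epsilon> a"
  have c: "c = 1 \<or> c = - 1" unfolding c_def using signsD[OF s(2), of i] msign_values[OF s(1), of a] by auto
  have m1: "of_int (msign \<epsilon> a) * (of_int (msign \<epsilon> a) * p) = p" for p :: "'n laur"
    using msign_values[OF s(1), of a] by auto
  have P': "of_int c * sgl \<epsilon> P = laur_monom a * mpol_to_laur (exch (twist \<epsilon> \<delta> S) i)"
    unfolding a(3) twist_def seed.simps c_def
    by (simp add: rhomD(4) rhom_of_int rhomD(4)[OF rhom_sgl[OF s(1)]] sgl_monom sgl_mpol_to_laur[OF s(1)] m1 mult_ac)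
  have "\<exists>Q'. hat_subst (twist \<epsilon> \<delta> S) (of_int c * sgl \<epsilon> P) j = laur_eval amb_const amb_var Q' \<and>
           \<not> mpol_to_laur (exch (twist \<epsilon> \<delta> S) j) dvd Q'" if j: "j \<noteq> i" for j
  proof -
    let ?F = "exch S j"
    have F: "?F \<noteq> 0" "\<not> involves ?F j" using S by (auto simp: is_seed_def irreducible_def)
    obtain Q where Q: "hat_subst S P j = laur_eval amb_const amb_var Q" "\<not> mpol_to_laur ?F dvd Q"
      using P j unfolding is_hat_def by blast
    have Q1: "LV amb_A (amb_var(j := emb ?F / amb_var j)) P = lemb Q"
      using Q(1) by (simp add: hat_subst_def laur_eval_amb_const eval_amb_const lemb_def emb_def)
    \<comment> \<open>In slot \<open>j\<close> the new variable \<open>X\<close> stands in the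
      denominator of \<open>F_j / X\<close>. It absorbs both the sign of \<open>X_j\<close> and the
      sign of \<open>F_j\<close>.\<close>
    define \<epsilon>' where "\<epsilon>' = \<epsilon>(j := \<epsilon> j * \<delta> j)"
    have s': "signs \<epsilon>'" unfolding \<epsilon>'_def using s by (intro signs_upd) (use signsD[OF s(1), of j] signsD[OF s(2), of j] in auto)
    define x where "x = (\<lambda>k. of_int (\<epsilon>' k) * amb_var k)"
    have x0: "x k \<noteq> 0" for k using signs_nonzero[OF s', of k] by (simp add: x_def)
    have xe: "x = (\<lambda>k. of_int (\<epsilon> k) * amb_var k)(j := of_int (\<epsilon>' j) * amb_var j)" by (auto simp: x_def \<epsilon>'_def)
    have Fx: "EV amb_A x ?F = emb (sg \<epsilon> ?F)"
      unfolding emb_def EV_sg xe by (rule EV_not_involves[OF F(2)])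
    have sgF: "sg \<epsilon> ?F \<noteq> 0" using sg_eq_iff[OF s(1), of ?F 0] F(1) by (simp add: rhomD(1))
    define z where "z = amb_var(j := of_int (\<delta> j) * emb (sg \<epsilon> ?F) / amb_var j)"
    have z0: "z k \<noteq> 0" for k using sgF signs_nonzero[OF s(2), of j, where 'r = "'n ambient"] by (simp add: z_def)
    have hz: "rhom (LV amb_A z)" by (rule rhom_LV) (rule z0)
    have inv: "inverse (of_int (\<epsilon> j * \<delta> j)) = (of_int (\<epsilon> j * \<delta> j) :: 'n ambient)"
      using signsD[OF s(1), of j] signsD[OF s(2), of j] by auto
    have "(\<lambda>k. of_int (\<epsilon> k) * z k) = x(j := EV amb_A x ?F / x j)"
      unfolding Fx using inv by (auto simp: fun_eq_iff z_def x_def \<epsilon>'_def divide_inverse mult_ac)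
    moreover have "hat_subst (twist \<epsilon> \<delta> S) (of_int c * sgl \<epsilon> P) j = LV amb_A z (of_int c * sgl \<epsilon> P)"
      by (simp add: hat_subst_def laur_eval_amb_const eval_amb_const twist_def z_def emb_def[symmetric] rhomD(4) rhom_of_int)
    ultimately have "hat_subst (twist \<epsilon> \<delta> S) (of_int c * sgl \<epsilon> P) j = of_int c * LV amb_A (x(j := EV amb_A x ?F / x j)) P"
      by (simp add: rhomD(4)[OF hz] rhom_of_int[OF hz] LV_sgl[OF s(1) z0])
    also have "LV amb_A (x(j := EV amb_A x ?F / x j)) P = LV amb_A x Q"
      by (rule hat_subst_transfer[OF F(1) Q1 x0]) (use sgF Fx in simp)
    also have "LV amb_A x Q = lemb (sgl \<epsilon>' Q)"
      unfolding lemb_def x_def by (rule LV_sgl[OF s', symmetric]) simp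
    also have "of_int c * lemb (sgl \<epsilon>' Q) = lemb (of_int c * sgl \<epsilon>' Q)" by (simp add: rhomD(4) rhom_of_int)
    finally have "hat_subst (twist \<epsilon> \<delta> S) (of_int c * sgl \<epsilon> P) j = laur_eval amb_const amb_var (of_int c * sgl \<epsilon>' Q)"
      by (simp add: laur_eval_amb_const lemb_def)
    moreover have "\<not> mpol_to_laur (exch (twist \<epsilon> \<delta> S) j) dvd of_int c * sgl \<epsilon>' Q"
    proof -
      have "mpol_to_laur (exch (twist \<epsilon> \<delta> S) j) = of_int (\<delta> j) * sgl \<epsilon>' (mpol_to_laur ?F)"
        unfolding sgl_mpol_to_laur[OF s'] unfolding \<epsilon>'_def sg_upd[OF F(2)] by (simp add: twist_def rhomD(4) rhom_of_int)
      then show ?thesis using Q(2) by (simp add: sign_dvd[OF c] sign_dvd[OF signsD[OF s(2)]] sgl_dvd[OF s'])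
    qed
    ultimately show ?thesis by blast
  qed
  then have "is_hat (twist \<epsilon> \<delta> S) i (of_int c * sgl \<epsilon> P)"
    unfolding is_hat_def using a P' by blast
  then show ?thesis using that c by blast
qed

lemma laur_set_zero_sign:
  assumes s: "signs \<epsilon>" and c: "c = 1 \<or> c = - 1"
  shows "laur_set_zero j (of_int c * sgl \<epsilon> P) = of_int c * sgl \<epsilon> (laur_set_zero j P)"
  by (rule poly_mapping_eqI) (simp add: lookup_laur_set_zero lookup_sign[OF c] lookup_sgl[OF s])

lemma sgl_upd:
  assumes s: "signs \<epsilon>" "signs (\<epsilon>(l := c))" and Q: "expo_in {0} l Q"
  shows "sgl (\<epsilon>(l := c)) Q = sgl \<epsilon> Q"
proof (rule poly_mapping_eqI)
  fix m
  show "Poly_Mapping.lookup (sgl (\<epsilon>(l := c)) Q) m = Poly_Mapping.lookup (sgl \<epsilon> Q) m"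
  proof (cases "m \<in> Poly_Mapping.keys Q")
    case True
    then have "Poly_Mapping.lookup m l = 0" using Q by (auto simp: expo_in_def)
    then show ?thesis by (simp add: lookup_sgl s msign_upd)
  qed (simp add: lookup_sgl s in_keys_iff)
qed

lemma strip_common_twist:
  fixes Q Q' :: "'n::{finite,linorder} laur"
  assumes s: "signs \<epsilon>" and a: "a = 1 \<or> a = - 1" and c: "c = 1 \<or> c = - 1"
    and QQ: "Q' = of_int c * sgl \<epsilon> Q" and st: "strip_common i j Q G H"
  shows "strip_common i j Q' (of_int a * sgl \<epsilon> G) (of_int a * sgl \<epsilon> H)"
proof -
  have cf: "common_factor i j Q' (of_int a * sgl \<epsilon> G) (sg \<epsilon> p) \<longleftrightarrow> common_factor i j Q G p" for G p
    unfolding common_factor_def QQ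
    by (simp add: involves_sg[OF s] sign_dvd[OF a] sign_dvd[OF c] sgl_dvd[OF s] flip: sgl_mpol_to_laur[OF s])
      (metis rhomD(2)[OF rhom_sgl[OF s]] sgl_dvd[OF s])
  show ?thesis using st
  proof induction
    case (strip_none G)
    have "\<not> common_factor i j Q' (of_int a * sgl \<epsilon> G) p" for p
      using strip_none[of "sg \<epsilon> p"] cf[of G "sg \<epsilon> p"] by (simp add: sg_invol[OF s])
    then show ?case by (rule strip_common.strip_none)
  next
    case (strip_step p G H)
    have e: "of_int a * sgl \<epsilon> (mpol_to_laur p * G) = mpol_to_laur (sg \<epsilon> p) * (of_int a * sgl \<epsilon> G)"
      by (simp add: rhomD(4)[OF rhom_sgl[OF s]] sgl_mpol_to_laur[OF s] mult_ac)
    have "common_factor i j Q' (of_int a * sgl \<epsilon> (mpol_to_laur p * G)) (sg \<epsilon> p)"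
      unfolding cf by (rule strip_step(1))
    then show ?case using strip_step(3) unfolding e by (rule strip_common.strip_step)
  qed
qed

lemma expo_in_mpol_to_laur:
  fixes p :: "'n::{finite,linorder} mpol"
  assumes "\<not> involves p l" shows "expo_in {0} l (mpol_to_laur p)"
proof -
  have "expo_in {0} l (mpol_to_laur (sub0 l q))" for q :: "'n mpol"
  proof (induction q rule: mpol_induct)
    case (of_int n)
    have "expo_in {0} l (Poly_Mapping.single 0 (of_int n) :: 'n laur)" by (rule expo_in_single) simp
    then show ?case by (simp only: rhom_of_int[OF rhom_sub0] rhom_of_int[OF rhom_mpol_to_laur] single_of_int)
  next
    case (A i)
    show ?case by (simp add: sub0_def expo_in_A)
  next
    case (X i)
    show ?case by (cases "i = l") (simp_all add: sub0_def rhomD(1) free.expo_var, simp add: expo_in_def)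
  qed (simp_all add: rhomD(3,4) expo_in_add free.expo_mult)
  then show ?thesis using assms by (metis not_involves_iff)
qed

lemma expo_in_laur_set_zero: "expo_in S l P \<Longrightarrow> expo_in S l (laur_set_zero j P)"
  by (auto simp: expo_in_def in_keys_iff lookup_laur_set_zero split: if_splits)

lemma mut_G_EV: "mut_G S l P j = EV laur_A (laur_var(l := laur_set_zero j P * laur_inv l)) (exch S j)"
  unfolding mut_G_def mpol_eval_conv_EV[OF rhom_laur_const] laur_A_def[abs_def] laur_inv_def ..

text \<open>Each ingredient of the mutation changes by a sign: hat \<open>F_l\<close>, its value at
  \<open>X_j = 0\<close>, \<open>G_j\<close>, and every stripping step. The resulting seed is thus
  again a change of signs.\<close>

lemma mutation_twist:
  fixes S T :: "'n::{finite,linorder} seed"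
  assumes s: "signs \<epsilon>" "signs \<delta>" and M: "is_mutation l S T"
  obtains \<epsilon>' \<delta>' where "signs \<epsilon>'" "signs \<delta>'" "is_mutation l (twist \<epsilon> \<delta> S) (twist \<epsilon>' \<delta>' T)"
proof -
  obtain P where P: "is_hat S l P" "\<And>j. j \<noteq> l \<Longrightarrow> cluster T j = cluster S j"
    "cluster T l = laur_eval amb_const (cluster S) P / cluster S l"
    and Tex: "\<And>j. if \<not> involves (exch S j) l then exch T j = exch S j
         else (\<exists>H (e :: 'n \<Rightarrow>\<^sub>0 int). strip_common l j (laur_set_zero j P) (mut_G S l P j) H \<and>
                 Poly_Mapping.lookup e j = 0 \<and> mpol_to_laur (exch T j) = laur_monom e * H \<and>
                 (\<forall>k. \<not> mpol_var k dvd exch T j))"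
    and S: "is_seed S" and T: "is_seed T"
    using M unfolding is_mutation_def by blast
  obtain c where c: "c = 1 \<or> c = - 1" and hat: "is_hat (twist \<epsilon> \<delta> S) l (of_int c * sgl \<epsilon> P)"
    using is_hat_twist[OF s S P(1)] by blast
  \<comment> \<open>The new variable is hat \<open>F_l / X_l\<close>, with sign \<open>c\<close>
    from the numerator and \<open>\<epsilon> l\<close> from the denominator. As hat
    \<open>F_l\<close> is free of \<open>X_l\<close>, \<open>sgl \<epsilon>\<close> and
    \<open>sgl \<epsilon>'\<close> agree on it.\<close>
  define \<epsilon>' where "\<epsilon>' = \<epsilon>(l := c * \<epsilon> l)"
  have s': "signs \<epsilon>'" unfolding \<epsilon>'_def using s(1) by (intro signs_upd) (use c signsD[OF s(1), of l] in auto)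
  let ?P' = "of_int c * sgl \<epsilon> P"
  have Pf: "expo_in {0} l P"
  proof -
    obtain a where a: "Poly_Mapping.lookup a l = 0" "P = laur_monom a * mpol_to_laur (exch S l)"
      using P(1) unfolding is_hat_def by blast
    have "\<not> involves (exch S l) l" using S by (simp add: is_seed_def)
    then show ?thesis unfolding a(2) laur_monom_def
      by (intro free.expo_mult expo_in_single expo_in_mpol_to_laur) (use a in auto)
  qed
  have Q: "laur_set_zero j ?P' = of_int c * sgl \<epsilon>' (laur_set_zero j P)" for j
    unfolding laur_set_zero_sign[OF s(1) c] using sgl_upd[OF s(1) s'[unfolded \<epsilon>'_def] expo_in_laur_set_zero[OF Pf]]
    by (simp add: \<epsilon>'_def)
  have G: "mut_G (twist \<epsilon> \<delta> S) l ?P' j = of_int (\<delta> j) * sgl \<epsilon>' (mut_G S l P j)" for j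
  proof -
    have hl: "rhom (sgl \<epsilon>')" by (rule rhom_sgl[OF s'])
    let ?L = "laur_var(l := laur_set_zero j ?P' * laur_inv l)"
    have "mut_G (twist \<epsilon> \<delta> S) l ?P' j = of_int (\<delta> j) * EV laur_A (\<lambda>k. of_int (\<epsilon> k) * ?L k) (exch S j)"
      by (simp add: mut_G_EV twist_def rhomD(4) rhom_of_int EV_sg)
    also have "(\<lambda>k. of_int (\<epsilon> k) * ?L k) = (\<lambda>k. sgl \<epsilon>' ((laur_var(l := laur_set_zero j P * laur_inv l)) k))"
      unfolding Q by (auto simp: fun_eq_iff rhomD(4)[OF hl, unfolded \<epsilon>'_def] \<epsilon>'_def mult_ac)
    also have "EV laur_A \<dots> (exch S j) = sgl \<epsilon>' (mut_G S l P j)"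
      unfolding mut_G_EV rhom_EV_compose[OF hl] by simp
    finally show ?thesis .
  qed
  have "\<exists>d. (d = 1 \<or> d = - 1) \<and> (if \<not> involves (exch S j) l then of_int d * sg \<epsilon>' (exch T j) = of_int (\<delta> j) * sg \<epsilon> (exch S j)
       else (\<exists>H (e :: 'n \<Rightarrow>\<^sub>0 int). strip_common l j (laur_set_zero j ?P') (mut_G (twist \<epsilon> \<delta> S) l ?P' j) H \<and>
                 Poly_Mapping.lookup e j = 0 \<and> mpol_to_laur (of_int d * sg \<epsilon>' (exch T j)) = laur_monom e * H))" for j
  proof (cases "involves (exch S j) l")
    case False
    then have "sg \<epsilon>' (exch T j) = sg \<epsilon> (exch S j)" using Tex[of j] by (simp add: \<epsilon>'_def sg_upd)
    then show ?thesis using False signsD[OF s(2), of j] by auto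
  next
    case True
    then obtain H and e :: "'n \<Rightarrow>\<^sub>0 int" where H: "strip_common l j (laur_set_zero j P) (mut_G S l P j) H"
      "Poly_Mapping.lookup e j = 0" "mpol_to_laur (exch T j) = laur_monom e * H" using Tex[of j] by auto
    \<comment> \<open>The second factor offsets the sign that the normalising monomial
      \<open>e\<close> acquires.\<close>
    define d where "d = \<delta> j * msign \<epsilon>' e"
    have d: "d = 1 \<or> d = - 1" unfolding d_def using signsD[OF s(2), of j] msign_values[OF s', of e] by auto
    have m1: "of_int (msign \<epsilon>' e) * (of_int (msign \<epsilon>' e) * p) = p" for p :: "'n laur"
      using msign_values[OF s', of e] by auto
    have "strip_common l j (laur_set_zero j ?P') (mut_G (twist \<epsilon> \<delta> S) l ?P' j) (of_int (\<delta> j) * sgl \<epsilon>' H)"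
      unfolding G by (rule strip_common_twist[OF s' signsD[OF s(2)] c Q H(1)])
    moreover have "mpol_to_laur (of_int d * sg \<epsilon>' (exch T j)) = laur_monom e * (of_int (\<delta> j) * sgl \<epsilon>' H)"
    proof -
      have "mpol_to_laur (of_int d * sg \<epsilon>' (exch T j)) = of_int d * sgl \<epsilon>' (laur_monom e * H)"
        unfolding H(3)[symmetric] sgl_mpol_to_laur[OF s'] by (simp add: rhomD(4) rhom_of_int)
      also have "\<dots> = of_int (\<delta> j) * (of_int (msign \<epsilon>' e) * (of_int (msign \<epsilon>' e) * (laur_monom e * sgl \<epsilon>' H)))"
        unfolding rhomD(4)[OF rhom_sgl[OF s']] sgl_monom by (simp add: d_def mult_ac)
      finally show ?thesis unfolding m1 by (simp add: mult_ac)
    qed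
    ultimately show ?thesis using True H(2) d by auto
  qed
  then obtain \<delta>' where \<delta>': "\<And>j. \<delta>' j = 1 \<or> \<delta>' j = - 1" and ex: "\<And>j. if \<not> involves (exch S j) l then of_int (\<delta>' j) * sg \<epsilon>' (exch T j) = of_int (\<delta> j) * sg \<epsilon> (exch S j)
       else (\<exists>H (e :: 'n \<Rightarrow>\<^sub>0 int). strip_common l j (laur_set_zero j ?P') (mut_G (twist \<epsilon> \<delta> S) l ?P' j) H \<and>
                 Poly_Mapping.lookup e j = 0 \<and> mpol_to_laur (of_int (\<delta>' j) * sg \<epsilon>' (exch T j)) = laur_monom e * H)"
    by metis
  have sd: "signs \<delta>'" using \<delta>' by (simp add: signs_def)
  have T': "is_seed (twist \<epsilon>' \<delta>' T)" by (rule is_seed_twist[OF s' sd T])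
  have "is_mutation l (twist \<epsilon> \<delta> S) (twist \<epsilon>' \<delta>' T)"
    unfolding is_mutation_def
  proof (intro conjI exI[of _ ?P'] allI impI)
    show "is_seed (twist \<epsilon> \<delta> S)" by (rule is_seed_twist[OF s S])
    show "is_seed (twist \<epsilon>' \<delta>' T)" by (rule T')
    show "is_hat (twist \<epsilon> \<delta> S) l ?P'" by (rule hat)
    show "cluster (twist \<epsilon>' \<delta>' T) j = cluster (twist \<epsilon> \<delta> S) j" if "j \<noteq> l" for j
      using P(2)[OF that] that by (simp add: twist_def \<epsilon>'_def)
    have x0: "cluster S k \<noteq> 0" for k using S alg_independent_nonzero by (auto simp: is_seed_def)
    let ?y = "\<lambda>k. of_int (\<epsilon> k) * cluster S k"
    have y0: "?y k \<noteq> 0" for k using x0 signs_nonzero[OF s(1)] by auto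
    have hy: "rhom (LV amb_A ?y)" by (rule rhom_LV) (rule y0)
    have "LV amb_A ?y ?P' = of_int c * LV amb_A (cluster S) P"
      by (simp add: rhomD(4)[OF hy] rhom_of_int[OF hy] LV_sgl[OF s(1) y0] signs_square'[OF s(1)])
    moreover have "inverse (of_int (\<epsilon> l)) = (of_int (\<epsilon> l) :: 'n ambient)" using signsD[OF s(1), of l] by auto
    ultimately show "cluster (twist \<epsilon>' \<delta>' T) l = laur_eval amb_const (cluster (twist \<epsilon> \<delta> S)) ?P' / cluster (twist \<epsilon> \<delta> S) l"
      by (simp add: twist_def P(3) laur_eval_amb_const \<epsilon>'_def divide_inverse mult_ac)
    fix j
    show "if \<not> involves (exch (twist \<epsilon> \<delta> S) j) l then exch (twist \<epsilon>' \<delta>' T) j = exch (twist \<epsilon> \<delta> S) j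
      else \<exists>H e. strip_common l j (laur_set_zero j ?P') (mut_G (twist \<epsilon> \<delta> S) l ?P' j) H \<and>
          Poly_Mapping.lookup e j = 0 \<and> mpol_to_laur (exch (twist \<epsilon>' \<delta>' T) j) = laur_monom e * H \<and>
          (\<forall>k. \<not> mpol_var k dvd exch (twist \<epsilon>' \<delta>' T) j)"
    proof -
      have "involves (exch (twist \<epsilon> \<delta> S) j) l \<longleftrightarrow> involves (exch S j) l"
        by (simp add: twist_def sign_mult_iffs[OF signsD[OF s(2)]] involves_sg[OF s(1)])
      moreover have "\<not> mpol_var k dvd exch (twist \<epsilon>' \<delta>' T) j" for k using T' by (simp add: is_seed_def)
      moreover have "exch (twist \<epsilon>' \<delta>' T) j = of_int (\<delta>' j) * sg \<epsilon>' (exch T j)" "exch (twist \<epsilon> \<delta> S) j = of_int (\<delta> j) * sg \<epsilon> (exch S j)"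
        by (simp_all add: twist_def)
      ultimately show ?thesis using ex[of j] by (simp split: if_splits)
    qed
  qed
  then show ?thesis using that s' sd by blast
qed

lemma mutation_chain_snoc:
  "mutation_chain (s @ [l]) S T \<longleftrightarrow> (\<exists>S'. mutation_chain s S S' \<and> is_mutation l S' T)"
  by (induction s arbitrary: S) auto

lemma eq_twistI:
  fixes S T :: "'n::{finite,linorder} seed"
  assumes "cluster T = cluster S" "\<And>j. exch T j = exch S j \<or> exch T j = - exch S j"
  obtains \<delta> where "signs \<delta>" "T = twist (\<lambda>_. 1) \<delta> S"
proof
  let ?d = "\<lambda>j. if exch T j = exch S j then 1 else - 1 :: int"
  show "signs ?d" by (simp add: signs_def)
  have "exch T j = of_int (?d j) * exch S j" for j using assms(2)[of j] by auto
  then have "exch T = (\<lambda>j. of_int (?d j) * exch S j)" by blast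
  then show "T = twist (\<lambda>_. 1) ?d S" using assms(1) by (simp add: twist_def sg_one)
qed

text \<open>Changing signs is an involution, so a mutation of a twisted seed can be pulled back to
  one of \<open>can s\<close>, where \<open>mutation_can\<close> describes it, and the signs are
  then restored.\<close>

lemma mutation_of_twist:
  fixes s :: "'n::{finite,linorder} list"
  assumes d: "distinct s" and s: "signs \<epsilon>" "signs \<delta>"
  shows "\<exists>\<sigma>. distinct (mutate_seq l s) \<and> (\<forall>k. \<sigma> (\<sigma> k) = k) \<and> (l \<notin> set s \<longrightarrow> \<sigma> = (\<lambda>k. k)) \<and>
    (\<exists>T. is_mutation l (twist \<epsilon> \<delta> (can s)) T) \<and>
    (\<forall>T. is_mutation l (twist \<epsilon> \<delta> (can s)) T \<longrightarrow>
      (\<exists>\<epsilon>' \<delta>'. signs \<epsilon>' \<and> signs \<delta>' \<and> T = twist \<epsilon>' \<delta>' (canp \<sigma> (mutate_seq l s))))"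
proof (rule mutation_can_seq[OF d, of l])
  fix \<sigma>
  assume d': "distinct (mutate_seq l s)" and \<sigma>: "\<And>k. \<sigma> (\<sigma> k) = k" "l \<notin> set s \<Longrightarrow> \<sigma> = (\<lambda>k. k)"
    and cl: "\<And>j. j \<noteq> l \<Longrightarrow> clu (mutate_seq l s) (\<sigma> j) = clu s j"
    "clu (mutate_seq l s) (\<sigma> l) = HF amb_A (clu s) (\<lambda>k. inverse (clu s k)) s l / clu s l"
    and ex: "\<And>j. exch_rel s l \<sigma> (mutate_seq l s) j \<or> \<not> involves (Fp s j) l \<and> FF mpol_A mpol_var s j = FF mpol_A (\<lambda>k. mpol_var (\<sigma> k)) (mutate_seq l s) (\<sigma> j)"
  have mc1: "is_mutation l (can s) (canp \<sigma> (mutate_seq l s))"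
    by (rule mutation_can(1)[OF d d' \<sigma>(1)]) (assumption | rule cl ex)+
  have mc2: "cluster T = cluster (canp \<sigma> (mutate_seq l s)) \<and>
      (\<forall>j. exch T j = exch (canp \<sigma> (mutate_seq l s)) j \<or> exch T j = - exch (canp \<sigma> (mutate_seq l s)) j)"
    if "is_mutation l (can s) T" for T
    using that by (intro mutation_can(2)[OF d d' \<sigma>(1)]) (assumption | rule cl ex)+
  have 1: "\<exists>T. is_mutation l (twist \<epsilon> \<delta> (can s)) T"
    using mutation_twist[OF s mc1] by blast
  have 2: "\<exists>\<epsilon>' \<delta>'. signs \<epsilon>' \<and> signs \<delta>' \<and> T = twist \<epsilon>' \<delta>' (canp \<sigma> (mutate_seq l s))"
    if T: "is_mutation l (twist \<epsilon> \<delta> (can s)) T" for T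
  proof -
    obtain \<epsilon>' \<delta>' where s': "signs \<epsilon>'" "signs \<delta>'" and M: "is_mutation l (can s) (twist \<epsilon>' \<delta>' T)"
      using mutation_twist[OF s T] unfolding twist_invol[OF s] by blast
    obtain \<delta>'' where d'': "signs \<delta>''" "twist \<epsilon>' \<delta>' T = twist (\<lambda>_. 1) \<delta>'' (canp \<sigma> (mutate_seq l s))"
      using mc2[OF M] eq_twistI[of "twist \<epsilon>' \<delta>' T" "canp \<sigma> (mutate_seq l s)"] by blast
    have "T = twist \<epsilon>' \<delta>' (twist \<epsilon>' \<delta>' T)" by (rule twist_invol[OF s', symmetric])
    also have "\<dots> = twist (\<lambda>k. \<epsilon>' k * 1) (\<lambda>k. \<delta>' k * \<delta>'' k) (canp \<sigma> (mutate_seq l s))"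
      unfolding d''(2) twist_twist ..
    finally show ?thesis using signs_mult[OF s'(2) d''(1)] s'(1) by auto
  qed
  show ?thesis using d' \<sigma> 1 2 by (intro exI[of _ \<sigma>]) blast
qed

lemma generated_by_twist:
  assumes "distinct s"
  shows "\<exists>S. generated_by s S"
    and "generated_by s S \<Longrightarrow> \<exists>\<epsilon> \<delta>. signs \<epsilon> \<and> signs \<delta> \<and> S = twist \<epsilon> \<delta> (can s)"
proof -
  have "(\<exists>S. generated_by s S) \<and> (\<forall>S. generated_by s S \<longrightarrow> (\<exists>\<epsilon> \<delta>. signs \<epsilon> \<and> signs \<delta> \<and> S = twist \<epsilon> \<delta> (can s)))"
    using assms
  proof (induction s rule: rev_induct)
    case Nil
    have "signs (\<lambda>_. 1)" by (simp add: signs_def)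
    then show ?case
      using is_seed_can[of "[]"] twist_one[of "can []"] unfolding generated_by_def tau_can by (metis distinct.simps(1) mutation_chain.simps(1))
  next
    case (snoc l s)
    then have d: "distinct s" "l \<notin> set s" by auto
    note IH = snoc.IH[OF d(1)]
    have m: "mutate_seq l s = s @ [l]" by (rule mutate_seq_notin[OF d(2)])
    have gen: "generated_by (s @ [l]) T \<longleftrightarrow> (\<exists>S. generated_by s S \<and> is_mutation l S T)" for T
      unfolding generated_by_def mutation_chain_snoc is_mutation_def by blast
    have step: "(\<exists>T. is_mutation l (twist \<epsilon> \<delta> (can s)) T) \<and>
       (\<forall>T. is_mutation l (twist \<epsilon> \<delta> (can s)) T \<longrightarrow> (\<exists>\<epsilon>' \<delta>'. signs \<epsilon>' \<and> signs \<delta>' \<and> T = twist \<epsilon>' \<delta>' (can (s @ [l]))))"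
      if sg: "signs \<epsilon>" "signs \<delta>" for \<epsilon> \<delta>
    proof -
      obtain \<sigma> where "l \<notin> set s \<longrightarrow> \<sigma> = (\<lambda>k. k)"
        and 1: "\<exists>T. is_mutation l (twist \<epsilon> \<delta> (can s)) T"
        and 2: "\<forall>T. is_mutation l (twist \<epsilon> \<delta> (can s)) T \<longrightarrow>
            (\<exists>\<epsilon>' \<delta>'. signs \<epsilon>' \<and> signs \<delta>' \<and> T = twist \<epsilon>' \<delta>' (canp \<sigma> (mutate_seq l s)))"
        using mutation_of_twist[OF d(1) sg, of l] by blast
      then have \<sigma>: "\<sigma> = (\<lambda>k. k)" using d(2) by blast
      show ?thesis using 1 2 unfolding \<sigma> m canp_id by blast
    qed
    show ?case unfolding gen using IH step by metis
  qed
  then show "\<exists>S. generated_by s S" "generated_by s S \<Longrightarrow> \<exists>\<epsilon> \<delta>. signs \<epsilon> \<and> signs \<delta> \<and> S = twist \<epsilon> \<delta> (can s)"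
    by blast+
qed

lemma exch_elem_twist: "signs \<epsilon> \<Longrightarrow> exch_elem (twist \<epsilon> \<delta> S) i = of_int (\<delta> i) * exch_elem S i"
  by (simp add: exch_elem_def eval_amb_const twist_def rhomD(4) rhom_of_int EV_sg)

lemma exch_elem_canp: "(\<And>k. \<sigma> (\<sigma> k) = k) \<Longrightarrow> exch_elem (canp \<sigma> s) i = exch_elem (can s) (\<sigma> i)"
  by (simp add: exch_elem_def eval_amb_const canp_def can_def EV_ren)

text \<open>The bijection required by \<open>seed_eq\<close> is the relabelling
  \<open>\<sigma>\<close>, and the units are the products of the signs on both sides.\<close>

lemma seed_eq_twist:
  assumes s: "signs \<epsilon>" "signs \<delta>" "signs \<epsilon>'" "signs \<delta>'" and \<sigma>: "\<And>k. \<sigma> (\<sigma> k) = k"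
  shows "seed_eq (twist \<epsilon> \<delta> (canp \<sigma> s)) (twist \<epsilon>' \<delta>' (can s))"
  unfolding seed_eq_def
proof (intro exI[of _ \<sigma>] conjI allI)
  show "bij \<sigma>" by (rule bijI') (metis \<sigma>)+
  fix i
  have unit: "(of_int (\<alpha> k * \<beta> k') :: 'a coeffs) dvd 1" if "signs \<alpha>" "signs \<beta>" for \<alpha> \<beta> :: "'a \<Rightarrow> int" and k k'
    using signsD[OF that(1), of k] signsD[OF that(2), of k'] by auto
  have amb: "amb_const (of_int n) = of_int n" for n by (rule rhom_of_int[OF rhom_amb_const])
  show "\<exists>u v. u dvd 1 \<and> v dvd 1 \<and> cluster (twist \<epsilon>' \<delta>' (can s)) (\<sigma> i) = amb_const u * cluster (twist \<epsilon> \<delta> (canp \<sigma> s)) i \<and>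
      exch_elem (twist \<epsilon>' \<delta>' (can s)) (\<sigma> i) = amb_const v * exch_elem (twist \<epsilon> \<delta> (canp \<sigma> s)) i"
  proof (intro exI conjI)
    show "of_int (\<epsilon>' (\<sigma> i) * \<epsilon> i) dvd (1 :: 'a coeffs)" "of_int (\<delta>' (\<sigma> i) * \<delta> i) dvd (1 :: 'a coeffs)"
      using unit s by blast+
    show "cluster (twist \<epsilon>' \<delta>' (can s)) (\<sigma> i) = amb_const (of_int (\<epsilon>' (\<sigma> i) * \<epsilon> i)) * cluster (twist \<epsilon> \<delta> (canp \<sigma> s)) i"
      unfolding amb by (simp add: twist_def canp_def can_def s mult.assoc)
    show "exch_elem (twist \<epsilon>' \<delta>' (can s)) (\<sigma> i) = amb_const (of_int (\<delta>' (\<sigma> i) * \<delta> i)) * exch_elem (twist \<epsilon> \<delta> (canp \<sigma> s)) i"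
      unfolding amb exch_elem_twist[OF s(1)] exch_elem_twist[OF s(3)] exch_elem_canp[OF \<sigma>] by (simp add: s mult.assoc)
  qed
qed

text \<open>Mutation being a relation, equality is asserted for all representatives; the existence
  clauses guarantee that there are some.\<close>

theorem theorem4p5:
  fixes s :: "'n::{finite,linorder} list" and l :: 'n
  assumes "distinct s"
  shows "(\<exists>S. generated_by s S) \<and>
         (\<exists>U. generated_by (mutate_seq l s) U) \<and>
         (\<forall>S. generated_by s S \<longrightarrow> (\<exists>T. is_mutation l S T)) \<and>
         (\<forall>S T U. generated_by s S \<longrightarrow> is_mutation l S T \<longrightarrow>
            generated_by (mutate_seq l s) U \<longrightarrow> seed_eq T U)"
proof (intro conjI allI impI)
  have one: "signs (\<lambda>_. 1)" by (simp add: signs_def)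
  have d': "distinct (mutate_seq l s)" using mutation_of_twist[OF assms one one, of l] by (elim exE conjE)
  show "\<exists>S. generated_by s S" by (rule generated_by_twist(1)[OF assms])
  show "\<exists>U. generated_by (mutate_seq l s) U" by (rule generated_by_twist(1)[OF d'])
  show "\<exists>T. is_mutation l S T" if gS: "generated_by s S" for S
  proof -
    obtain \<epsilon> \<delta> where S: "signs \<epsilon>" "signs \<delta>" "S = twist \<epsilon> \<delta> (can s)"
      using generated_by_twist(2)[OF assms gS] by blast
    show ?thesis
      unfolding S(3) using mutation_of_twist[OF assms S(1,2), of l] by blast
  qed
  fix S T U
  assume S: "generated_by s S" and T: "is_mutation l S T" and U: "generated_by (mutate_seq l s) U"
  obtain \<epsilon> \<delta> where S': "signs \<epsilon>" "signs \<delta>" "S = twist \<epsilon> \<delta> (can s)"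
    using generated_by_twist(2)[OF assms S] by blast
  obtain \<sigma> where \<sigma>: "\<forall>k. \<sigma> (\<sigma> k) = k"
    and T'': "\<forall>T. is_mutation l (twist \<epsilon> \<delta> (can s)) T \<longrightarrow>
      (\<exists>\<epsilon>' \<delta>'. signs \<epsilon>' \<and> signs \<delta>' \<and> T = twist \<epsilon>' \<delta>' (canp \<sigma> (mutate_seq l s)))"
    using mutation_of_twist[OF assms S'(1,2), of l] by (elim exE conjE)
  obtain \<epsilon>1 \<delta>1 where T': "signs \<epsilon>1" "signs \<delta>1" "T = twist \<epsilon>1 \<delta>1 (canp \<sigma> (mutate_seq l s))"
    using T'' T S'(3) by blast
  obtain \<epsilon>2 \<delta>2 where U': "signs \<epsilon>2" "signs \<delta>2" "U = twist \<epsilon>2 \<delta>2 (can (mutate_seq l s))"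
    using generated_by_twist(2)[OF d' U] by blast
  show "seed_eq T U" unfolding T'(3) U'(3) by (rule seed_eq_twist[OF T'(1,2) U'(1,2) \<sigma>[rule_format]])
qed

end
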